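(* Let $A\in x^{-m}\mathrm{Diff}^m_b(M;E)$ be $c$-elliptic and symmetric on $\mathcal D_{\min}$, and assume that $-\operatorname{ind}A_{\mathcal D_{\min}}>0$. For any $\lambda\in\mathbb R$ there is $\mathcal D\in\mathfrak{SA}$ (i.e. a domain $\mathcal D\in\mathfrak G$ with $A_{\mathcal D}$ selfadjoint) such that $\lambda\in\operatorname{spec}A_{\mathcal D}$.
   Context: $M$ is a compact smooth manifold with nonempty boundary $Y$ and interior $\mathring M$; $E\to M$ is a Hermitian vector bundle; $\mathfrak m$ is a smooth positive $b$-density; $x$ is a boundary defining function, positive in $\mathring M$, with $\mathfrak m=\frac{dx}{x}\otimes\mathfrak m_Y$ in a collar of $Y$ ($\mathfrak m_Y$ a smooth positive density on $Y$). $\mathrm{Diff}^m_b(M;E)$ is the space of differential operators $P$ of order $m$ which near $Y$ have the form $\sum_{k+|\alpha|\le m}a_{k\alpha}(x,y)D_y^\alpha(xD_x)^k$, $a_{k\alpha}$ smooth up to $x=0$. $A=x^{-m}P$ is $c$-elliptic if its principal symbol is invertible over $\mathring M$ (off the zero section) and near $Y$ the matrix $\sum_{k+|\alpha|=m}a_{k\alpha}(x,y)\eta^\alpha\xi^k$ is invertible for all real $(\xi,\eta)\ne0$, including at $x=0$. $A$ acts in $x^{-m/2}L^2_b(M;E)=L^2(M,x^m\mathfrak m;E)$. $\mathcal D_{\min}$ is the domain of the closure of $A$ on $C_0^\infty(\mathring M;E)$; $\mathcal D_{\max}=\{u\in x^{-m/2}L^2_b:Au\in x^{-m/2}L^2_b\}$.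 For a subspace $\mathcal D_{\min}\subset\mathcal D\subset\mathcal D_{\max}$, $A_{\mathcal D}$ is $A$ with domain $\mathcal D$. Known: $\mathcal D_{\min}$ has finite codimension in $\mathcal D_{\max}$, every $A_{\mathcal D}$ is closed and Fredholm, and $\operatorname{ind}A_{\mathcal D}=\operatorname{ind}A_{\mathcal D_{\min}}+\dim\mathcal D/\mathcal D_{\min}$. Symmetric on $\mathcal D_{\min}$ means $(Au,v)=(u,Av)$ for $u,v\in\mathcal D_{\min}$; then the Hilbert space adjoint of $A_{\mathcal D_{\min}}$ is $A_{\mathcal D_{\max}}$. $\mathfrak G$ is the set of such $\mathcal D$ with $\operatorname{ind}A_{\mathcal D}=0$. *)

theory Defs
  imports "HOL-Analysis.Analysis"
begin

subsection \<open>Smooth maps on subsets of a half space\<close>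

text \<open>For relatively open subsets of a closed half space (the only sets used below) the derivative
  within the set is unique, so this is smoothness up to the boundary.\<close>

primrec C_on :: "nat \<Rightarrow> 'a set \<Rightarrow> ('a::real_normed_vector \<Rightarrow> 'b::real_normed_vector) \<Rightarrow> bool" where
  "C_on 0 S f \<longleftrightarrow> continuous_on S f"
| "C_on (Suc k) S f \<longleftrightarrow>
     (\<exists>f'. (\<forall>x\<in>S. (f has_derivative f' x) (at x within S)) \<and> (\<forall>v. C_on k S (\<lambda>x. f' x v)))"

definition smooth_on :: "'a set \<Rightarrow> ('a::real_normed_vector \<Rightarrow> 'b::real_normed_vector) \<Rightarrow> bool" where
  "smooth_on S f \<longleftrightarrow> (\<forall>k. C_on k S f)"

text \<open>One coordinate vector is singled out as the inward normal of the model half space. The model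
  space has arbitrary dimension \<open>DIM('v) \<ge> 1\<close>.\<close>

definition nrm :: "'v::euclidean_space" where
  "nrm = (SOME b. b \<in> Basis)"

definition halfspace :: "'v::euclidean_space set" where
  "halfspace = {v. 0 \<le> v \<bullet> nrm}"


subsection \<open>Manifolds with boundary, Hermitian bundles, b-densities\<close>

type_synonym ('p, 'v) chart = "'p set \<times> ('p \<Rightarrow> 'v)"

text \<open>The points of the manifold \<open>M\<close> are the elements of the type \<open>'p\<close>. As a set, the bundle \<open>E\<close> is
  \<open>M \<times> \<complex>\<^sup>r\<close> (a basis of each fibre has been chosen, without any continuity in the base point), so
  that sections are functions \<open>'p \<Rightarrow> complex^'r\<close>; topology and smooth structure of \<open>E\<close> are carried
  by the local trivialisations \<open>(V, T) \<in> trivs\<close>, where \<open>T p *v w\<close> is the coordinate vector of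
  \<open>w \<in> E\<^sub>p\<close>. No triviality of \<open>E\<close> is implied. A b-density is given as the measure it defines.\<close>

record ('p, 'v, 'r) cone_geometry =
  atlas :: "('p, 'v) chart set"
  trivs :: "('p set \<times> ('p \<Rightarrow> complex^'r^'r)) set"
  herm :: "'p \<Rightarrow> complex^'r \<Rightarrow> complex^'r \<Rightarrow> complex"
  dens :: "'p measure"
  bdf :: "'p \<Rightarrow> real"

definition is_chart :: "('p::topological_space, 'v::euclidean_space) chart \<Rightarrow> bool" where
  "is_chart = (\<lambda>(U, \<phi>). open U \<and> openin (top_of_set halfspace) (\<phi> ` U) \<and>
     (\<exists>\<psi>. homeomorphism U (\<phi> ` U) \<phi> \<psi>))"

definition compatible ::
    "('p::topological_space, 'v::euclidean_space) chart \<Rightarrow> ('p, 'v) chart \<Rightarrow> bool" where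
  "compatible = (\<lambda>(U, \<phi>) (U', \<phi>'). smooth_on (\<phi> ` (U \<inter> U')) (\<phi>' \<circ> inv_into U \<phi>))"

definition smooth_atlas :: "('p::topological_space, 'v::euclidean_space) chart set \<Rightarrow> bool" where
  "smooth_atlas \<A> \<longleftrightarrow> (\<forall>c\<in>\<A>. is_chart c) \<and> (\<Union>c\<in>\<A>. fst c) = UNIV \<and>
     (\<forall>c\<in>\<A>. \<forall>d\<in>\<A>. compatible c d)"

text \<open>The charts of the maximal atlas.\<close>

definition charts ::
    "('p::topological_space, 'v::euclidean_space, 'r::finite) cone_geometry \<Rightarrow> ('p, 'v) chart set" where
  "charts G = {c. is_chart c \<and> (\<forall>d\<in>atlas G. compatible c d \<and> compatible d c)}"

definition bdry :: "('p::topological_space, 'v::euclidean_space, 'r::finite) cone_geometry \<Rightarrow> 'p set" where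
  "bdry G = {p. \<exists>(U, \<phi>)\<in>atlas G. p \<in> U \<and> \<phi> p \<bullet> nrm = 0}"

definition inter :: "('p::topological_space, 'v::euclidean_space, 'r::finite) cone_geometry \<Rightarrow> 'p set" where
  "inter G = - bdry G"

definition smooth_fun :: "('p::topological_space, 'v::euclidean_space, 'r::finite) cone_geometry \<Rightarrow>
    'p set \<Rightarrow> ('p \<Rightarrow> 'b::real_normed_vector) \<Rightarrow> bool" where
  "smooth_fun G W f \<longleftrightarrow> (\<forall>(U, \<phi>)\<in>atlas G. smooth_on (\<phi> ` (U \<inter> W)) (f \<circ> inv_into U \<phi>))"

definition vector_bundle :: "('p::topological_space, 'v::euclidean_space, 'r::finite) cone_geometry \<Rightarrow> bool" where
  "vector_bundle G \<longleftrightarrow>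
     (\<forall>(V, T)\<in>trivs G. open V \<and> (\<forall>p\<in>V. invertible (T p))) \<and> (\<Union>t\<in>trivs G. fst t) = UNIV \<and>
     (\<forall>(V, T)\<in>trivs G. \<forall>(V', T')\<in>trivs G. smooth_fun G (V \<inter> V') (\<lambda>p. T' p ** matrix_inv (T p)))"

definition hermitian_metric :: "('p::topological_space, 'v::euclidean_space, 'r::finite) cone_geometry \<Rightarrow> bool" where
  "hermitian_metric G \<longleftrightarrow>
     (\<forall>p u v w a. herm G p (a *s u + v) w = a * herm G p u w + herm G p v w) \<and>
     (\<forall>p u v. herm G p v u = cnj (herm G p u v)) \<and>
     (\<forall>p u. u \<noteq> 0 \<longrightarrow> 0 < Re (herm G p u u)) \<and>
     (\<forall>(V, T)\<in>trivs G. \<forall>a b. smooth_fun G V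
        (\<lambda>p. herm G p (matrix_inv (T p) *v a) (matrix_inv (T p) *v b)))"

definition boundary_defining :: "('p::topological_space, 'v::euclidean_space, 'r::finite) cone_geometry \<Rightarrow> bool" where
  "boundary_defining G \<longleftrightarrow> smooth_fun G UNIV (bdf G) \<and>
     (\<forall>p\<in>inter G. 0 < bdf G p) \<and> (\<forall>p\<in>bdry G. bdf G p = 0) \<and>
     (\<forall>(U, \<phi>)\<in>atlas G. \<forall>p\<in>U \<inter> bdry G. \<exists>L.
        (bdf G \<circ> inv_into U \<phi> has_derivative L) (at (\<phi> p) within \<phi> ` U) \<and> L \<noteq> (\<lambda>_. 0))"

text \<open>In the chart \<open>(U, \<phi>)\<close> with normal coordinate \<open>t = v \<bullet> nrm\<close> the density is
  \<open>\<rho> (dt/t) dy\<close>, \<open>\<rho>\<close> smooth and positive up to \<open>t = 0\<close>. Charts not meeting the boundary have \<open>t > 0\<close>,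
  and the condition there describes an ordinary smooth positive density.\<close>

definition b_density_in :: "('p::topological_space, 'v::euclidean_space, 'r::finite) cone_geometry \<Rightarrow>
    ('p, 'v) chart \<Rightarrow> ('v \<Rightarrow> real) \<Rightarrow> bool" where
  "b_density_in G = (\<lambda>(U, \<phi>) \<rho>. smooth_on (\<phi> ` U) \<rho> \<and> (\<forall>v\<in>\<phi> ` U. 0 < \<rho> v) \<and>
     (\<forall>B\<in>sets borel. B \<subseteq> U \<longrightarrow> emeasure (dens G) B =
        (\<integral>\<^sup>+v. ennreal (\<rho> v / (v \<bullet> nrm)) * indicator (\<phi> ` B) v \<partial>lborel)))"

definition b_density :: "('p::topological_space, 'v::euclidean_space, 'r::finite) cone_geometry \<Rightarrow> bool" where
  "b_density G \<longleftrightarrow> sets (dens G) = sets borel \<and> (\<forall>c\<in>atlas G. \<exists>\<rho>. b_density_in G c \<rho>)"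

text \<open>A collar \<open>W\<close> of the boundary \<open>Y\<close> is presented by its projection \<open>\<pi> : W \<rightarrow> Y\<close>: the map
  \<open>p \<mapsto> (x p, \<pi> p)\<close> is a diffeomorphism \<open>W \<rightarrow> [0,\<epsilon>) \<times> Y\<close>. A chart \<open>(U, \<phi>)\<close> of \<open>M\<close> restricts to a chart
  of \<open>Y\<close>, hence induces product coordinates on the preimage of \<open>U\<close>; the diffeomorphism property
  says that these are charts of \<open>M\<close>.\<close>

definition collar_chart :: "('p::topological_space, 'v::euclidean_space, 'r::finite) cone_geometry \<Rightarrow>
    'p set \<Rightarrow> ('p \<Rightarrow> 'p) \<Rightarrow> ('p, 'v) chart \<Rightarrow> ('p, 'v) chart" where
  "collar_chart G W \<pi> = (\<lambda>(U, \<phi>). ({p\<in>W. \<pi> p \<in> U}, \<lambda>p. \<phi> (\<pi> p) + bdf G p *\<^sub>R nrm))"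

definition collar :: "('p::topological_space, 'v::euclidean_space, 'r::finite) cone_geometry \<Rightarrow>
    real \<Rightarrow> 'p set \<Rightarrow> ('p \<Rightarrow> 'p) \<Rightarrow> bool" where
  "collar G \<epsilon> W \<pi> \<longleftrightarrow> 0 < \<epsilon> \<and> open W \<and> bdry G \<subseteq> W \<and> (\<forall>y\<in>bdry G. \<pi> y = y) \<and>
     bij_betw (\<lambda>p. (bdf G p, \<pi> p)) W ({0..<\<epsilon>} \<times> bdry G) \<and>
     (\<forall>c\<in>atlas G. collar_chart G W \<pi> c \<in> charts G)"

text \<open>\<open>dens = dx/x \<otimes> m\<^sub>Y\<close> in a collar: in product coordinates the coefficient \<open>\<rho>\<close> of the density does
  not depend on \<open>x\<close>; \<open>m\<^sub>Y\<close> is the density \<open>\<rho>(y) dy\<close> on \<open>Y\<close>.\<close>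

definition product_density_near_boundary ::
    "('p::topological_space, 'v::euclidean_space, 'r::finite) cone_geometry \<Rightarrow> bool" where
  "product_density_near_boundary G \<longleftrightarrow> (\<exists>\<epsilon> W \<pi>. collar G \<epsilon> W \<pi> \<and>
     (\<forall>c\<in>atlas G. \<exists>\<rho>. b_density_in G (collar_chart G W \<pi> c) \<rho> \<and>
        (\<forall>(U, \<phi>)\<in>{collar_chart G W \<pi> c}. \<forall>v\<in>\<phi> ` U. \<rho> v = \<rho> (v - (v \<bullet> nrm) *\<^sub>R nrm))))"

definition cone_setting :: "('p::t2_space, 'v::euclidean_space, 'r::finite) cone_geometry \<Rightarrow> bool" where
  "cone_setting G \<longleftrightarrow> compact (UNIV :: 'p set) \<and> smooth_atlas (atlas G) \<and> bdry G \<noteq> {} \<and>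
     vector_bundle G \<and> hermitian_metric G \<and> boundary_defining G \<and>
     b_density G \<and> product_density_near_boundary G"


subsection \<open>Cone differential operators\<close>

type_synonym ('p, 'r) sect = "'p \<Rightarrow> complex^'r"

definition smooth_section :: "('p::topological_space, 'v::euclidean_space, 'r::finite) cone_geometry \<Rightarrow>
    'p set \<Rightarrow> ('p, 'r) sect \<Rightarrow> bool" where
  "smooth_section G W u \<longleftrightarrow> (\<forall>(V, T)\<in>trivs G. smooth_fun G (V \<inter> W) (\<lambda>p. T p *v u p))"

text \<open>\<open>C\<^sub>0\<^sup>\<infinity>\<close> of the interior.\<close>

definition test_sections :: "('p::topological_space, 'v::euclidean_space, 'r::finite) cone_geometry \<Rightarrow>
    ('p, 'r) sect set" where
  "test_sections G = {u. smooth_section G (inter G) u \<and>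
     (\<exists>K. compact K \<and> K \<subseteq> inter G \<and> (\<forall>p. p \<notin> K \<longrightarrow> u p = 0))}"

text \<open>\<open>D = -\<i> \<partial>\<close>. The order chosen in \<open>basis_list\<close> is irrelevant on smooth functions.\<close>

definition D_dir :: "'v::euclidean_space \<Rightarrow> ('v \<Rightarrow> complex^'r::finite) \<Rightarrow> 'v \<Rightarrow> complex^'r" where
  "D_dir b f v = (- \<i>) *s vector_derivative (\<lambda>s::real. f (v + s *\<^sub>R b)) (at 0)"

definition xD :: "('v::euclidean_space \<Rightarrow> complex^'r::finite) \<Rightarrow> 'v \<Rightarrow> complex^'r" where
  "xD f v = (v \<bullet> nrm) *\<^sub>R D_dir nrm f v"

definition basis_list :: "'v::euclidean_space list" where
  "basis_list = (SOME bs. distinct bs \<and> set bs = Basis)"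

definition multi_indices :: "nat \<Rightarrow> ('v::euclidean_space \<Rightarrow> nat) set" where
  "multi_indices m = {\<alpha>. (\<forall>b. b \<notin> Basis \<longrightarrow> \<alpha> b = 0) \<and> sum \<alpha> Basis \<le> m}"

definition D_multi :: "('v::euclidean_space \<Rightarrow> nat) \<Rightarrow> ('v \<Rightarrow> complex^'r::finite) \<Rightarrow> 'v \<Rightarrow> complex^'r" where
  "D_multi \<alpha> f = foldr (\<lambda>b g. (D_dir b ^^ \<alpha> b) g) basis_list f"

text \<open>\<open>D\<^sub>y\<^sup>\<alpha> (x D\<^sub>x)\<^sup>k\<close>, the exponent \<open>k\<close> being stored as \<open>\<alpha> nrm\<close>.\<close>

definition bD_multi :: "('v::euclidean_space \<Rightarrow> nat) \<Rightarrow> ('v \<Rightarrow> complex^'r::finite) \<Rightarrow> 'v \<Rightarrow> complex^'r" where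
  "bD_multi \<alpha> f = foldr (\<lambda>b g. (D_dir b ^^ \<alpha> b) g) (filter (\<lambda>b. b \<noteq> nrm) basis_list) ((xD ^^ \<alpha> nrm) f)"

definition local_rep :: "('p, 'v) chart \<Rightarrow> 'p set \<times> ('p \<Rightarrow> complex^'r^'r) \<Rightarrow>
    ('p, 'r::finite) sect \<Rightarrow> 'v \<Rightarrow> complex^'r" where
  "local_rep = (\<lambda>(U, \<phi>) (V, T) u v. T (inv_into U \<phi> v) *v u (inv_into U \<phi> v))"

text \<open>\<open>a\<close> is a family of smooth coefficients of \<open>P\<close> relative to the derivatives \<open>\<D>\<close> (which will be
  \<open>D_multi\<close> or \<open>bD_multi\<close>) in the chart \<open>c\<close> and the trivialisation \<open>t\<close>. The formula for \<open>P u\<close>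
  is required at interior points only; smoothness of \<open>a\<close> is up to the boundary.\<close>

definition local_coeffs :: "('p::topological_space, 'v::euclidean_space, 'r::finite) cone_geometry \<Rightarrow> nat \<Rightarrow>
    (('v \<Rightarrow> nat) \<Rightarrow> ('v \<Rightarrow> complex^'r) \<Rightarrow> 'v \<Rightarrow> complex^'r) \<Rightarrow>
    (('p, 'r) sect \<Rightarrow> ('p, 'r) sect) \<Rightarrow> ('p, 'v) chart \<Rightarrow> 'p set \<times> ('p \<Rightarrow> complex^'r^'r) \<Rightarrow>
    (('v \<Rightarrow> nat) \<Rightarrow> 'v \<Rightarrow> complex^'r^'r) \<Rightarrow> bool" where
  "local_coeffs G m \<D> P c t a \<longleftrightarrow>
     (\<forall>\<alpha>\<in>multi_indices m. smooth_on (snd c ` (fst c \<inter> fst t)) (a \<alpha>)) \<and>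
     (\<forall>u. smooth_section G (inter G) u \<longrightarrow>
        (\<forall>v\<in>snd c ` (fst c \<inter> fst t). 0 < v \<bullet> nrm \<longrightarrow>
           local_rep c t (P u) v = (\<Sum>\<alpha>\<in>multi_indices m. a \<alpha> v *v \<D> \<alpha> (local_rep c t u) v)))"

text \<open>Charts of the form \<open>(x, y)\<close>, the normal coordinate being the given boundary defining function,
  and charts of the interior.\<close>

definition b_charts :: "('p::topological_space, 'v::euclidean_space, 'r::finite) cone_geometry \<Rightarrow> ('p, 'v) chart set" where
  "b_charts G = {(U, \<phi>)\<in>charts G. \<forall>p\<in>U. \<phi> p \<bullet> nrm = bdf G p}"

definition inter_charts :: "('p::topological_space, 'v::euclidean_space, 'r::finite) cone_geometry \<Rightarrow> ('p, 'v) chart set" where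
  "inter_charts G = {(U, \<phi>)\<in>charts G. U \<subseteq> inter G}"

definition Diff_b :: "('p::topological_space, 'v::euclidean_space, 'r::finite) cone_geometry \<Rightarrow> nat \<Rightarrow>
    (('p, 'r) sect \<Rightarrow> ('p, 'r) sect) set" where
  "Diff_b G m = {P.
     (\<forall>c\<in>inter_charts G. \<forall>t\<in>trivs G. \<exists>a. local_coeffs G m D_multi P c t a) \<and>
     (\<forall>c\<in>b_charts G. \<forall>t\<in>trivs G. \<exists>a. local_coeffs G m bD_multi P c t a)}"

text \<open>Operators act on sections over the interior; the value on the (null) boundary is set to 0.\<close>

definition cone_op :: "('p::topological_space, 'v::euclidean_space, 'r::finite) cone_geometry \<Rightarrow> nat \<Rightarrow>
    (('p, 'r) sect \<Rightarrow> ('p, 'r) sect) \<Rightarrow> ('p, 'r) sect \<Rightarrow> ('p, 'r) sect" where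
  "cone_op G m P u p = (if p \<in> inter G then inverse (bdf G p ^ m) *\<^sub>R P u p else 0)"

text \<open>The set \<open>x\<^sup>-\<^sup>m Diff\<^sub>b\<^sup>m\<close>.\<close>

definition cone_Diff :: "('p::topological_space, 'v::euclidean_space, 'r::finite) cone_geometry \<Rightarrow> nat \<Rightarrow>
    (('p, 'r) sect \<Rightarrow> ('p, 'r) sect) set" where
  "cone_Diff G m = cone_op G m ` Diff_b G m"

definition symbol :: "nat \<Rightarrow> (('v::euclidean_space \<Rightarrow> nat) \<Rightarrow> 'v \<Rightarrow> complex^'r::finite^'r) \<Rightarrow> 'v \<Rightarrow> 'v \<Rightarrow> complex^'r^'r" where
  "symbol m a v \<zeta> = (\<Sum>\<alpha> | \<alpha> \<in> multi_indices m \<and> sum \<alpha> Basis = m. (\<Prod>b\<in>Basis. (\<zeta> \<bullet> b) ^ \<alpha> b) *\<^sub>R a \<alpha> v)"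

text \<open>Coefficients are unique, so quantifying over all families \<open>a\<close> is harmless for operators
  in \<open>cone_Diff G m\<close>, for which they exist.\<close>

definition c_elliptic :: "('p::topological_space, 'v::euclidean_space, 'r::finite) cone_geometry \<Rightarrow> nat \<Rightarrow>
    (('p, 'r) sect \<Rightarrow> ('p, 'r) sect) \<Rightarrow> bool" where
  "c_elliptic G m A \<longleftrightarrow> (\<exists>P\<in>Diff_b G m. A = cone_op G m P \<and>
     (\<forall>c\<in>inter_charts G. \<forall>t\<in>trivs G. \<forall>a. local_coeffs G m D_multi A c t a \<longrightarrow>
        (\<forall>v\<in>snd c ` (fst c \<inter> fst t). \<forall>\<zeta>. \<zeta> \<noteq> 0 \<longrightarrow> invertible (symbol m a v \<zeta>))) \<and>
     (\<forall>c\<in>b_charts G. \<forall>t\<in>trivs G. \<forall>a. local_coeffs G m bD_multi P c t a \<longrightarrow>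
        (\<forall>v\<in>snd c ` (fst c \<inter> fst t). \<forall>\<zeta>. \<zeta> \<noteq> 0 \<longrightarrow> invertible (symbol m a v \<zeta>))))"


subsection \<open>The Hilbert space\<close>

text \<open>\<open>x\<^sup>-\<^sup>m\<^sup>/\<^sup>2 L\<^sup>2\<^sub>b = L\<^sup>2(M, x\<^sup>m dens; E)\<close>. Elements are functions; elements of \<open>null_sections\<close> play the role
  of zero, and dimensions below are dimensions of quotients. The boundary is a null set of
  \<open>dens\<close>.\<close>

definition L2 :: "('p::topological_space, 'v::euclidean_space, 'r::finite) cone_geometry \<Rightarrow> nat \<Rightarrow> ('p, 'r) sect set" where
  "L2 G m = {u. (\<forall>(V, T)\<in>trivs G. (\<lambda>p. T p *v u p) \<in> borel_measurable (restrict_space borel V)) \<and>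
     (\<integral>\<^sup>+p. ennreal (bdf G p ^ m * Re (herm G p (u p) (u p))) \<partial>dens G) < \<infinity>}"

definition null_sections :: "('p::topological_space, 'v::euclidean_space, 'r::finite) cone_geometry \<Rightarrow> nat \<Rightarrow> ('p, 'r) sect set" where
  "null_sections G m = {u\<in>L2 G m. AE p in dens G. u p = 0}"

definition ip :: "('p::topological_space, 'v::euclidean_space, 'r::finite) cone_geometry \<Rightarrow> nat \<Rightarrow>
    ('p, 'r) sect \<Rightarrow> ('p, 'r) sect \<Rightarrow> complex" where
  "ip G m u v = (\<integral>p. of_real (bdf G p ^ m) * herm G p (u p) (v p) \<partial>dens G)"

definition nm :: "('p::topological_space, 'v::euclidean_space, 'r::finite) cone_geometry \<Rightarrow> nat \<Rightarrow> ('p, 'r) sect \<Rightarrow> real" where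
  "nm G m u = sqrt (Re (ip G m u u))"

definition csubspace :: "('p, 'r::finite) sect set \<Rightarrow> bool" where
  "csubspace X \<longleftrightarrow> (\<lambda>p. 0) \<in> X \<and> (\<forall>u\<in>X. \<forall>v\<in>X. \<forall>a. (\<lambda>p. a *s u p + v p) \<in> X)"

text \<open>\<open>X / W\<close> has complex dimension \<open>n\<close> (for subspaces \<open>W \<subseteq> X\<close>).\<close>

definition has_qdim :: "('p, 'r::finite) sect set \<Rightarrow> ('p, 'r) sect set \<Rightarrow> nat \<Rightarrow> bool" where
  "has_qdim X W n \<longleftrightarrow> (\<exists>B. finite B \<and> card B = n \<and> B \<subseteq> X \<and>
     (\<forall>u\<in>X. \<exists>c. (\<lambda>p. u p - (\<Sum>b\<in>B. c b *s b p)) \<in> W) \<and>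
     (\<forall>c. (\<lambda>p. \<Sum>b\<in>B. c b *s b p) \<in> W \<longrightarrow> (\<forall>b\<in>B. c b = 0)))"


subsection \<open>Unbounded operators, given by their graphs\<close>

definition ker_of :: "('p::topological_space, 'v::euclidean_space, 'r::finite) cone_geometry \<Rightarrow> nat \<Rightarrow>
    (('p, 'r) sect \<times> ('p, 'r) sect) set \<Rightarrow> ('p, 'r) sect set" where
  "ker_of G m R = {u. \<exists>f\<in>null_sections G m. (u, f) \<in> R}"

definition closed_in_L2 :: "('p::topological_space, 'v::euclidean_space, 'r::finite) cone_geometry \<Rightarrow> nat \<Rightarrow> ('p, 'r) sect set \<Rightarrow> bool" where
  "closed_in_L2 G m X \<longleftrightarrow> (\<forall>u f. (\<forall>n. u n \<in> X) \<and> f \<in> L2 G m \<and>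
     (\<lambda>n::nat. nm G m (\<lambda>p. u n p - f p)) \<longlonglongrightarrow> 0 \<longrightarrow> f \<in> X)"

text \<open>\<open>R\<close> is Fredholm (finite-dimensional kernel, closed range of finite codimension) with
  index \<open>k\<close>.\<close>

definition has_index :: "('p::topological_space, 'v::euclidean_space, 'r::finite) cone_geometry \<Rightarrow> nat \<Rightarrow>
    (('p, 'r) sect \<times> ('p, 'r) sect) set \<Rightarrow> int \<Rightarrow> bool" where
  "has_index G m R k \<longleftrightarrow> closed_in_L2 G m (Range R) \<and>
     (\<exists>i j. has_qdim (ker_of G m R) (null_sections G m) i \<and> has_qdim (L2 G m) (Range R) j \<and> k = int i - int j)"

definition adjoint_graph :: "('p::topological_space, 'v::euclidean_space, 'r::finite) cone_geometry \<Rightarrow> nat \<Rightarrow>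
    (('p, 'r) sect \<times> ('p, 'r) sect) set \<Rightarrow> (('p, 'r) sect \<times> ('p, 'r) sect) set" where
  "adjoint_graph G m R = {(v, g). v \<in> L2 G m \<and> g \<in> L2 G m \<and> (\<forall>(u, f)\<in>R. ip G m f v = ip G m u g)}"

definition densely_defined :: "('p::topological_space, 'v::euclidean_space, 'r::finite) cone_geometry \<Rightarrow> nat \<Rightarrow>
    (('p, 'r) sect \<times> ('p, 'r) sect) set \<Rightarrow> bool" where
  "densely_defined G m R \<longleftrightarrow> (\<forall>u\<in>L2 G m. \<forall>\<epsilon>>0. \<exists>v\<in>Domain R. nm G m (\<lambda>p. u p - v p) < \<epsilon>)"

definition selfadjoint :: "('p::topological_space, 'v::euclidean_space, 'r::finite) cone_geometry \<Rightarrow> nat \<Rightarrow>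
    (('p, 'r) sect \<times> ('p, 'r) sect) set \<Rightarrow> bool" where
  "selfadjoint G m R \<longleftrightarrow> densely_defined G m R \<and> adjoint_graph G m R = R"

definition symmetric_graph :: "('p::topological_space, 'v::euclidean_space, 'r::finite) cone_geometry \<Rightarrow> nat \<Rightarrow>
    (('p, 'r) sect \<times> ('p, 'r) sect) set \<Rightarrow> bool" where
  "symmetric_graph G m R \<longleftrightarrow> (\<forall>(u, f)\<in>R. \<forall>(v, g)\<in>R. ip G m f v = ip G m u g)"

text \<open>The resolvent set: \<open>R - z\<close> is a bijection of the domain onto \<open>L2\<close> with bounded inverse
  (the estimate contains injectivity).\<close>

definition resolvent_set :: "('p::topological_space, 'v::euclidean_space, 'r::finite) cone_geometry \<Rightarrow> nat \<Rightarrow>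
    (('p, 'r) sect \<times> ('p, 'r) sect) set \<Rightarrow> complex set" where
  "resolvent_set G m R = {z.
     (\<exists>C. \<forall>(u, f)\<in>R. nm G m u \<le> C * nm G m (\<lambda>p. f p - z *s u p)) \<and>
     (\<forall>g\<in>L2 G m. \<exists>(u, f)\<in>R. (\<lambda>p. f p - z *s u p - g p) \<in> null_sections G m)}"

definition spec :: "('p::topological_space, 'v::euclidean_space, 'r::finite) cone_geometry \<Rightarrow> nat \<Rightarrow>
    (('p, 'r) sect \<times> ('p, 'r) sect) set \<Rightarrow> complex set" where
  "spec G m R = - resolvent_set G m R"


subsection \<open>Closed extensions of cone operators\<close>

text \<open>\<open>\<psi>\<close> is the formal adjoint of \<open>A\<close> applied to \<open>\<phi>\<close>.\<close>

definition formal_adjoint :: "('p::topological_space, 'v::euclidean_space, 'r::finite) cone_geometry \<Rightarrow> nat \<Rightarrow>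
    (('p, 'r) sect \<Rightarrow> ('p, 'r) sect) \<Rightarrow> ('p, 'r) sect \<Rightarrow> ('p, 'r) sect \<Rightarrow> bool" where
  "formal_adjoint G m A \<phi> \<psi> \<longleftrightarrow> \<phi> \<in> test_sections G \<and> \<psi> \<in> test_sections G \<and>
     (\<forall>\<eta>\<in>test_sections G. ip G m (A \<eta>) \<phi> = ip G m \<eta> \<psi>)"

text \<open>\<open>u\<close> and \<open>f\<close> are in \<open>L2\<close> and \<open>A u = f\<close> in the sense of distributions on the interior.\<close>

definition acts :: "('p::topological_space, 'v::euclidean_space, 'r::finite) cone_geometry \<Rightarrow> nat \<Rightarrow>
    (('p, 'r) sect \<Rightarrow> ('p, 'r) sect) \<Rightarrow> ('p, 'r) sect \<Rightarrow> ('p, 'r) sect \<Rightarrow> bool" where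
  "acts G m A u f \<longleftrightarrow> u \<in> L2 G m \<and> f \<in> L2 G m \<and>
     (\<forall>\<phi> \<psi>. formal_adjoint G m A \<phi> \<psi> \<longrightarrow> ip G m u \<psi> = ip G m f \<phi>)"

definition Dmax :: "('p::topological_space, 'v::euclidean_space, 'r::finite) cone_geometry \<Rightarrow> nat \<Rightarrow>
    (('p, 'r) sect \<Rightarrow> ('p, 'r) sect) \<Rightarrow> ('p, 'r) sect set" where
  "Dmax G m A = {u. \<exists>f. acts G m A u f}"

definition Dmin :: "('p::topological_space, 'v::euclidean_space, 'r::finite) cone_geometry \<Rightarrow> nat \<Rightarrow>
    (('p, 'r) sect \<Rightarrow> ('p, 'r) sect) \<Rightarrow> ('p, 'r) sect set" where
  "Dmin G m A = {u\<in>L2 G m. \<exists>f\<in>L2 G m. \<exists>\<phi>. (\<forall>n::nat. \<phi> n \<in> test_sections G) \<and>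
     (\<lambda>n. nm G m (\<lambda>p. \<phi> n p - u p)) \<longlonglongrightarrow> 0 \<and> (\<lambda>n. nm G m (\<lambda>p. A (\<phi> n) p - f p)) \<longlonglongrightarrow> 0}"

text \<open>The graph of \<open>A\<^sub>\<D>\<close>.\<close>

definition ext_graph :: "('p::topological_space, 'v::euclidean_space, 'r::finite) cone_geometry \<Rightarrow> nat \<Rightarrow>
    (('p, 'r) sect \<Rightarrow> ('p, 'r) sect) \<Rightarrow> ('p, 'r) sect set \<Rightarrow>
    (('p, 'r) sect \<times> ('p, 'r) sect) set" where
  "ext_graph G m A \<D> = {(u, f). u \<in> \<D> \<and> acts G m A u f}"

definition GG :: "('p::topological_space, 'v::euclidean_space, 'r::finite) cone_geometry \<Rightarrow> nat \<Rightarrow>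
    (('p, 'r) sect \<Rightarrow> ('p, 'r) sect) \<Rightarrow> ('p, 'r) sect set set" where
  "GG G m A = {\<D>. csubspace \<D> \<and> Dmin G m A \<subseteq> \<D> \<and> \<D> \<subseteq> Dmax G m A \<and> has_index G m (ext_graph G m A \<D>) 0}"

definition SA :: "('p::topological_space, 'v::euclidean_space, 'r::finite) cone_geometry \<Rightarrow> nat \<Rightarrow>
    (('p, 'r) sect \<Rightarrow> ('p, 'r) sect) \<Rightarrow> ('p, 'r) sect set set" where
  "SA G m A = {\<D>\<in>GG G m A. selfadjoint G m (ext_graph G m A \<D>)}"

end

(*
  Let A_min and A_max be the minimal and maximal extensions and let mu be real. Whenever the range of
  A_min - mu is closed, D_mu = D_min + ker (A_max - mu) is the domain of a selfadjoint extension: a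
  vector v in the domain of the adjoint satisfies (A - mu) v _|_ ker (A_max - mu) = ran (A_min - mu)^_|_,
  hence (A - mu) v lies in ran (A_min - mu). For mu = 0 the range is closed because A_min is Fredholm.

  If ran (A_min - mu) is closed, then ker (A_max - mu) is nonzero, since otherwise A_min would be
  selfadjoint and have index 0; so mu is an eigenvalue on D_mu. If ran (A_min - mu) is not closed,
  then mu lies in the spectrum of every selfadjoint extension, in particular on D_0, because a bounded
  inverse would make A_min - mu bounded below. The index vanishes for each selfadjoint extension, its
  range being closed (it contains the closed, finite codimensional ran A_min) with orthogonal
  complement equal to its kernel.

  From the geometry one needs only that L^2 is complete and that the test sections are dense and
  invariant under A.
*)
theory Submission
  imports Defs "HOL-Library.Function_Algebras"
begin

section \<open>Semi-Hilbert spaces\<close>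

text \<open>Sections are functions, not classes modulo null sets, so their inner product is only
  positive semidefinite. The abstract part therefore works with a complete semidefinite form on a
  subspace \<open>H\<close>: limits and values of an operator are determined only modulo
  \<open>null\<close>, graphs are relations, and dimensions are those of quotients. Three points
  shape the rest. Closedness of the range of an extension is obtained through orthogonal splitting
  (\<open>complemented\<close>), because splitting, unlike closedness itself, is easily seen to
  survive the adjunction of one vector. Distributional action is tested on pairs of a test section
  and its formal adjoint; symmetry together with density makes this formal adjoint equal to A modulo
  \<open>null\<close>, which turns \<open>acts\<close> into the adjoint of the minimal operator.
  Density is a local statement: products of functions exp(-1/t) approximate indicators of boxes,
  boxes generate the Borel sets, and a Borel set can single out where an integrand has positive real
  part.\<close>

locale semi_hilbert = vector_space scale
  for scale :: "complex \<Rightarrow> 'a::ab_group_add \<Rightarrow> 'a" (infixr \<open>\<odot>\<close> 75) +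
  fixes H :: "'a set" and ip :: "'a \<Rightarrow> 'a \<Rightarrow> complex"
  assumes subspace_H: "subspace H"
    and ip_add_left: "\<lbrakk>u \<in> H; v \<in> H; w \<in> H\<rbrakk> \<Longrightarrow> ip (u + v) w = ip u w + ip v w"
    and ip_scale_left: "\<lbrakk>u \<in> H; v \<in> H\<rbrakk> \<Longrightarrow> ip (c \<odot> u) v = c * ip u v"
    and ip_cnj: "\<lbrakk>u \<in> H; v \<in> H\<rbrakk> \<Longrightarrow> ip v u = cnj (ip u v)"
    and ip_nonneg: "u \<in> H \<Longrightarrow> 0 \<le> Re (ip u u)"
    and complete: "\<lbrakk>\<And>n::nat. s n \<in> H;
        \<And>e. e > 0 \<Longrightarrow> \<exists>M. \<forall>i\<ge>M. \<forall>j\<ge>M. sqrt (Re (ip (s i - s j) (s i - s j))) < e\<rbrakk>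
        \<Longrightarrow> \<exists>f\<in>H. (\<lambda>n. sqrt (Re (ip (s n - f) (s n - f)))) \<longlonglongrightarrow> 0"
begin

definition sn :: "'a \<Rightarrow> real" where "sn u = sqrt (Re (ip u u))"

definition null :: "'a set" where "null = {u \<in> H. sn u = 0}"

section \<open>Algebra of the form, Cauchy-Schwarz and the seminorm\<close>

lemma H_closed [simp, intro]:
  "0 \<in> H" "\<lbrakk>u \<in> H; v \<in> H\<rbrakk> \<Longrightarrow> u + v \<in> H" "\<lbrakk>u \<in> H; v \<in> H\<rbrakk> \<Longrightarrow> u - v \<in> H"
  "u \<in> H \<Longrightarrow> c \<odot> u \<in> H" "u \<in> H \<Longrightarrow> - u \<in> H"
  using subspace_H by (auto simp: subspace_0 subspace_add subspace_diff subspace_scale subspace_neg)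

lemma ip_add_right: "\<lbrakk>u \<in> H; v \<in> H; w \<in> H\<rbrakk> \<Longrightarrow> ip w (u + v) = ip w u + ip w v"
  using ip_cnj[of w "u+v"] ip_cnj[of "u+v" w] ip_add_left ip_cnj[of u w] ip_cnj[of v w] by simp

lemma ip_scale_right: "\<lbrakk>u \<in> H; v \<in> H\<rbrakk> \<Longrightarrow> ip u (c \<odot> v) = cnj c * ip u v"
  using ip_cnj[of "c \<odot> v" u] ip_cnj[of v u] ip_scale_left by simp

lemma ip_minus: "\<lbrakk>u \<in> H; v \<in> H\<rbrakk> \<Longrightarrow> ip (- u) v = - ip u v"
  "\<lbrakk>u \<in> H; v \<in> H\<rbrakk> \<Longrightarrow> ip u (- v) = - ip u v"
  using ip_scale_left[of u v "-1"] ip_scale_right[of u v "-1"] by simp_all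

lemma ip_diff_left: "\<lbrakk>u \<in> H; v \<in> H; w \<in> H\<rbrakk> \<Longrightarrow> ip (u - v) w = ip u w - ip v w"
  using ip_add_left[of u "- v" w] by (simp add: ip_minus)

lemma ip_diff_right: "\<lbrakk>u \<in> H; v \<in> H; w \<in> H\<rbrakk> \<Longrightarrow> ip w (u - v) = ip w u - ip w v"
  using ip_add_right[of u "- v" w] by (simp add: ip_minus)

lemma ip_zero [simp]: "u \<in> H \<Longrightarrow> ip 0 u = 0" "u \<in> H \<Longrightarrow> ip u 0 = 0"
  using ip_diff_left[of u u u] ip_diff_right[of u u u] by simp_all

lemmas ip_simps = ip_add_left ip_add_right ip_scale_left ip_scale_right ip_diff_left ip_diff_right

lemma sn_nonneg [simp]: "u \<in> H \<Longrightarrow> 0 \<le> sn u"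
  by (simp add: sn_def ip_nonneg)

lemma sn_power2: "u \<in> H \<Longrightarrow> (sn u)\<^sup>2 = Re (ip u u)"
  by (simp add: sn_def ip_nonneg)

lemma ip_self: "u \<in> H \<Longrightarrow> ip u u = of_real ((sn u)\<^sup>2)"
  using ip_cnj[of u u] by (simp add: sn_power2 complex_eq_iff)

lemma sn_zero [simp]: "sn 0 = 0"
  by (simp add: sn_def)

lemma sn_scale: "u \<in> H \<Longrightarrow> sn (c \<odot> u) = cmod c * sn u"
proof -
  assume u: "u \<in> H"
  have "ip (c \<odot> u) (c \<odot> u) = (c * cnj c) * ip u u"
    using u by (simp add: ip_scale_left ip_scale_right)
  also have "\<dots> = of_real ((cmod c)\<^sup>2 * (sn u)\<^sup>2)"
    by (simp only: ip_self[OF u] complex_norm_square[symmetric] of_real_mult of_real_power)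
  finally have "ip (c \<odot> u) (c \<odot> u) = of_real ((cmod c)\<^sup>2 * (sn u)\<^sup>2)" .
  then have "(sn (c \<odot> u))\<^sup>2 = (cmod c * sn u)\<^sup>2"
    using u by (simp add: sn_power2 power_mult_distrib del: of_real_mult of_real_power)
  then show ?thesis using u by (simp add: power2_eq_iff_nonneg)
qed

lemma sn_minus_commute: "\<lbrakk>u \<in> H; v \<in> H\<rbrakk> \<Longrightarrow> sn (u - v) = sn (v - u)"
  using sn_scale[of "v - u" "-1"] by simp

text \<open>Taking a real multiple of \<open>ip u v\<close> as coefficient makes both cross terms
  the same real number, so the square is a real quadratic polynomial in \<open>t\<close>. A small
  \<open>t\<close> serves the variational argument below, the minimising \<open>t\<close> serves
  Cauchy-Schwarz.\<close>

lemma sn_diff_scale_power2: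
  assumes "u \<in> H" "v \<in> H"
  shows "(sn (u - (of_real t * ip u v) \<odot> v))\<^sup>2
    = (sn u)\<^sup>2 - 2 * t * (cmod (ip u v))\<^sup>2 + t\<^sup>2 * (cmod (ip u v))\<^sup>2 * (sn v)\<^sup>2"
proof -
  let ?a = "ip u v"
  have "ip (u - (of_real t * ?a) \<odot> v) (u - (of_real t * ?a) \<odot> v)
     = ip u u - of_real t * (?a * cnj ?a) - of_real t * (?a * cnj ?a)
       + of_real (t\<^sup>2) * (?a * cnj ?a) * ip v v"
    using assms ip_cnj[of u v] by (simp add: ip_simps algebra_simps power2_eq_square)
  also have "\<dots> = of_real ((sn u)\<^sup>2 - 2 * t * (cmod ?a)\<^sup>2 + t\<^sup>2 * (cmod ?a)\<^sup>2 * (sn v)\<^sup>2)"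
    using assms by (simp add: ip_self complex_norm_square[symmetric] algebra_simps)
  finally show ?thesis using assms by (simp add: sn_power2 del: of_real_power)
qed

lemma ip_zero_if_minimal:
  assumes "u \<in> H" "v \<in> H" and min: "\<And>c. (sn u)\<^sup>2 \<le> (sn (u - c \<odot> v))\<^sup>2"
  shows "ip u v = 0"
proof (rule ccontr)
  assume "ip u v \<noteq> 0"
  \<comment> \<open>Any positive \<open>t\<close> with \<open>t * (sn v)^2 < 2\<close> makes the
    first-order gain exceed the quadratic loss; the summand 1 keeps \<open>t\<close> positive also
    when \<open>sn v = 0\<close>.\<close>
  define t where "t = 1 / ((sn v)\<^sup>2 + 1)"
  have t: "t > 0" "t * (sn v)\<^sup>2 < 2"
  proof -
    show "t > 0" by (simp add: t_def add_nonneg_pos)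
    have "t * (sn v)\<^sup>2 \<le> 1" by (simp add: t_def divide_le_eq add_nonneg_pos)
    then show "t * (sn v)\<^sup>2 < 2" by simp
  qed
  have "(sn u)\<^sup>2 \<le> (sn (u - (of_real t * ip u v) \<odot> v))\<^sup>2" by (rule min)
  then have "0 \<le> t * (cmod (ip u v))\<^sup>2 * (t * (sn v)\<^sup>2 - 2)"
    unfolding sn_diff_scale_power2[OF assms(1,2)] by (simp add: algebra_simps power2_eq_square)
  moreover have "t * (cmod (ip u v))\<^sup>2 * (t * (sn v)\<^sup>2 - 2) < 0"
    using t \<open>ip u v \<noteq> 0\<close> by (intro mult_pos_neg) auto
  ultimately show False by simp
qed

lemma cauchy_schwarz:
  assumes "u \<in> H" "v \<in> H"
  shows "cmod (ip u v) \<le> sn u * sn v"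
proof (cases "sn v = 0")
  case True
  have "ip v u = 0"
  proof (rule ip_zero_if_minimal)
    fix c show "(sn v)\<^sup>2 \<le> (sn (v - c \<odot> u))\<^sup>2" by (simp add: True)
  qed (use assms in auto)
  then show ?thesis using assms ip_cnj[of v u] by simp
next
  case False
  then have pos: "(sn v)\<^sup>2 > 0" by simp
  have "0 \<le> (sn (u - (of_real (1 / (sn v)\<^sup>2) * ip u v) \<odot> v))\<^sup>2" by simp
  also have "\<dots> = (sn u)\<^sup>2 - (cmod (ip u v))\<^sup>2 / (sn v)\<^sup>2"
    unfolding sn_diff_scale_power2[OF assms] using pos by (simp add: field_simps power2_eq_square)
  finally have "(cmod (ip u v))\<^sup>2 \<le> (sn u * sn v)\<^sup>2"
    using pos by (simp add: field_simps power_mult_distrib)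
  then show ?thesis by (rule power2_le_imp_le) (use assms in simp)
qed

lemma sn_triangle:
  assumes "u \<in> H" "v \<in> H"
  shows "sn (u + v) \<le> sn u + sn v"
proof -
  have "(sn (u + v))\<^sup>2 = (sn u)\<^sup>2 + (sn v)\<^sup>2 + 2 * Re (ip u v)"
    using assms ip_cnj[of u v] by (simp add: sn_power2 ip_simps)
  also have "Re (ip u v) \<le> sn u * sn v"
    using cauchy_schwarz[OF assms] complex_Re_le_cmod[of "ip u v"] by linarith
  finally have "(sn (u + v))\<^sup>2 \<le> (sn u + sn v)\<^sup>2" by (simp add: power2_sum)
  then show ?thesis by (rule power2_le_imp_le) (use assms in simp)
qed

lemma sn_triangle_diff:
  assumes "u \<in> H" "v \<in> H" "w \<in> H"
  shows "sn (u - w) \<le> sn (u - v) + sn (v - w)"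
  using sn_triangle[of "u - v" "v - w"] assms by simp

lemma parallelogram:
  assumes "u \<in> H" "v \<in> H"
  shows "(sn (u - v))\<^sup>2 + (sn (u + v))\<^sup>2 = 2 * (sn u)\<^sup>2 + 2 * (sn v)\<^sup>2"
  using assms by (simp add: sn_power2 ip_simps)

lemma null_ip: "\<lbrakk>u \<in> null; v \<in> H\<rbrakk> \<Longrightarrow> ip u v = 0" "\<lbrakk>u \<in> null; v \<in> H\<rbrakk> \<Longrightarrow> ip v u = 0"
  using cauchy_schwarz[of u v] cauchy_schwarz[of v u] by (auto simp: null_def)

lemma subspace_null: "subspace null"
proof (rule subspaceI)
  show "0 \<in> null" by (simp add: null_def)
  show "u + v \<in> null" if "u \<in> null" "v \<in> null" for u v
    using that sn_triangle[of u v] sn_nonneg[of "u + v"] by (auto simp: null_def simp del: sn_nonneg)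
  show "c \<odot> u \<in> null" if "u \<in> null" for c u using that by (auto simp: null_def sn_scale)
qed

lemma null_H: "u \<in> null \<Longrightarrow> u \<in> H" by (simp add: null_def)

lemma null_if_ip_self: "\<lbrakk>u \<in> H; ip u u = 0\<rbrakk> \<Longrightarrow> u \<in> null"
  by (simp add: null_def sn_def)

section \<open>Convergence in the seminorm\<close>

definition tends :: "(nat \<Rightarrow> 'a) \<Rightarrow> 'a \<Rightarrow> bool" where
  "tends s f \<longleftrightarrow> (\<lambda>n. sn (s n - f)) \<longlonglongrightarrow> 0"

lemma tends_const: "tends (\<lambda>_. f) f" by (simp add: tends_def)

lemma tends_add:
  assumes "tends s f" "tends t g" "\<And>n. s n \<in> H" "\<And>n. t n \<in> H" "f \<in> H" "g \<in> H"
  shows "tends (\<lambda>n. s n + t n) (f + g)"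
  unfolding tends_def
proof (rule tendsto_sandwich[of "\<lambda>_. 0" _ _ "\<lambda>n. sn (s n - f) + sn (t n - g)"])
  show "\<forall>\<^sub>F n in sequentially. sn (s n + t n - (f + g)) \<le> sn (s n - f) + sn (t n - g)"
    using sn_triangle[of "s n - f" "t n - g" for n] assms by (simp add: algebra_simps)
  show "(\<lambda>n. sn (s n - f) + sn (t n - g)) \<longlonglongrightarrow> 0"
    using tendsto_add[OF assms(1,2)[unfolded tends_def]] by simp
qed (use assms in simp_all)

lemma tends_scale:
  assumes "tends s f" "\<And>n. s n \<in> H" "f \<in> H"
  shows "tends (\<lambda>n. c \<odot> s n) (c \<odot> f)"
proof -
  have "sn (c \<odot> s n - c \<odot> f) = cmod c * sn (s n - f)" for n
    using sn_scale[of "s n - f" c] assms by (simp add: scale_right_diff_distrib)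
  then show ?thesis
    using tendsto_mult_left[OF assms(1)[unfolded tends_def], of "cmod c"] by (simp add: tends_def)
qed

lemma tends_diff:
  assumes "tends s f" "tends t g" "\<And>n. s n \<in> H" "\<And>n. t n \<in> H" "f \<in> H" "g \<in> H"
  shows "tends (\<lambda>n. s n - t n) (f - g)"
  using tends_add[OF assms(1) tends_scale[OF assms(2), of "-1"]] assms by simp

lemma tends_ip_left:
  assumes "tends s f" "\<And>n. s n \<in> H" "f \<in> H" "v \<in> H"
  shows "(\<lambda>n. ip (s n) v) \<longlonglongrightarrow> ip f v"
proof (rule Lim_null[THEN iffD2], rule Lim_null_comparison)
  show "\<forall>\<^sub>F n in sequentially. norm (ip (s n) v - ip f v) \<le> sn (s n - f) * sn v"
    using cauchy_schwarz[of "s n - f" v for n] assms by (simp add: ip_diff_left)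
  show "(\<lambda>n. sn (s n - f) * sn v) \<longlonglongrightarrow> 0"
    using tendsto_mult_right[OF assms(1)[unfolded tends_def], of "sn v"] by simp
qed

lemma tends_null_diff:
  assumes "tends s f" "\<And>n. s n \<in> H" "f \<in> H" "g \<in> H" "f - g \<in> null"
  shows "tends s g"
proof -
  have "sn (s n - g) \<le> sn (s n - f)" for n
    using sn_triangle_diff[of "s n" f g] assms by (simp add: null_def)
  then show ?thesis
    using tendsto_sandwich[of "\<lambda>_. 0" "\<lambda>n. sn (s n - g)" sequentially "\<lambda>n. sn (s n - f)" 0]
      assms by (simp add: tends_def)
qed

lemma tends_cauchy:
  assumes "tends s f" "\<And>n. s n \<in> H" "f \<in> H" "e > 0"
  shows "\<exists>M. \<forall>i\<ge>M. \<forall>j\<ge>M. sn (s i - s j) < e"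
proof -
  obtain M where M: "\<And>n. n \<ge> M \<Longrightarrow> sn (s n - f) < e / 2"
    using assms(1) \<open>e > 0\<close> unfolding tends_def LIMSEQ_iff by (metis half_gt_zero real_norm_def abs_ge_self diff_zero le_less_trans)
  have "sn (s i - s j) < e" if "i \<ge> M" "j \<ge> M" for i j
    using M[OF that(1)] M[OF that(2)] sn_triangle_diff[of "s i" f "s j"] sn_minus_commute[of f "s j"] assms
    by simp
  then show ?thesis by blast
qed

lemma complete_tends:
  assumes "\<And>n. s n \<in> H" "\<And>e. e > 0 \<Longrightarrow> \<exists>M. \<forall>i\<ge>M. \<forall>j\<ge>M. sn (s i - s j) < e"
  shows "\<exists>f\<in>H. tends s f"
  using complete[of s] assms by (simp add: sn_def tends_def)

text \<open>\<open>X\<close> need not be closed, so the point nearest to \<open>u\<close> is found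
  only as a limit of a minimising sequence in \<open>X\<close>. In this form the lemma gives both
  the projection onto a closed subspace and the density criterion
  \<open>dense_if_perp_null\<close>.\<close>

lemma projection_limit:
  assumes X: "subspace X" "X \<subseteq> H" and u: "u \<in> H"
  obtains s f where "\<And>n. s n \<in> X" "f \<in> H" "tends s f" "\<And>x. x \<in> X \<Longrightarrow> ip (u - f) x = 0"
proof -
  define d where "d = Inf ((\<lambda>x. (sn (u - x))\<^sup>2) ` X)"
  have bdd: "bdd_below ((\<lambda>x. (sn (u - x))\<^sup>2) ` X)" by (auto intro: bdd_belowI[of _ 0])
  have ne: "X \<noteq> {}" using X(1) subspace_0 by auto
  have d_le: "d \<le> (sn (u - x))\<^sup>2" if "x \<in> X" for x
    unfolding d_def using that bdd by (auto intro: cInf_lower)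
  have "\<exists>x\<in>X. (sn (u - x))\<^sup>2 < d + 1 / real (Suc n)" for n
    using cInf_lessD[of "(\<lambda>x. (sn (u - x))\<^sup>2) ` X" "d + 1 / real (Suc n)"] ne by (auto simp: d_def)
  then obtain s where s: "\<And>n. s n \<in> X" "\<And>n. (sn (u - s n))\<^sup>2 < d + 1 / real (Suc n)" by metis
  have sH: "s n \<in> H" for n using s X by auto
  have bound: "(sn (s i - s j))\<^sup>2 \<le> 2 / real (Suc i) + 2 / real (Suc j)" for i j
  proof -
    \<comment> \<open>The midpoint of two almost minimal points lies in \<open>X\<close>, hence is
      at squared distance at least \<open>d\<close> from \<open>u\<close>; the parallelogram law
      then forces the two points to be close.\<close>
    define w where "w = (1/2) \<odot> (s i + s j)"
    have w: "w \<in> X" unfolding w_def using X s by (auto intro: subspace_scale subspace_add)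
    have two: "2 \<odot> (u - w) = (u - s i) + (u - s j)"
      by (simp add: w_def scale_right_diff_distrib, metis add_diff_add scale_left_distrib scale_one one_add_one)
    have "(sn (2 \<odot> (u - w)))\<^sup>2 = 4 * (sn (u - w))\<^sup>2"
      using u w X by (subst sn_scale) (auto simp: power_mult_distrib)
    then have "(sn ((u - s i) + (u - s j)))\<^sup>2 \<ge> 4 * d" using d_le[OF w] two by simp
    moreover have "sn ((u - s i) - (u - s j)) = sn (s i - s j)"
      using sn_minus_commute[of "s i" "s j"] sH by simp
    moreover have "2 * d + 2 * d + 2 / real (Suc i) + 2 / real (Suc j) - 4 * d
        = 2 / real (Suc i) + 2 / real (Suc j)" by simp
    ultimately show ?thesis
      using parallelogram[of "u - s i" "u - s j"] s(2)[of i] s(2)[of j] u sH by simp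
  qed
  have "\<exists>M. \<forall>i\<ge>M. \<forall>j\<ge>M. sn (s i - s j) < e" if "e > 0" for e
  proof -
    obtain M where M: "1 / real (Suc M) < e\<^sup>2 / 4"
      using reals_Archimedean[of "e\<^sup>2 / 4"] \<open>e > 0\<close> by (auto simp: inverse_eq_divide)
    have "sn (s i - s j) < e" if "i \<ge> M" "j \<ge> M" for i j
    proof -
      have "1 / real (Suc i) \<le> 1 / real (Suc M)" "1 / real (Suc j) \<le> 1 / real (Suc M)"
        using that by (auto intro!: divide_left_mono)
      then have "(sn (s i - s j))\<^sup>2 < e\<^sup>2" using bound[of i j] M by simp
      then show ?thesis using \<open>e > 0\<close> by (simp add: power2_less_imp_less)
    qed
    then show ?thesis by blast
  qed
  then obtain f where f: "f \<in> H" "tends s f" using complete_tends sH by blast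
  \<comment> \<open>The displacement \<open>x\<close> lets minimality be tested before the limit:
    \<open>s n + c \<odot> x\<close> is in \<open>X\<close>, whereas \<open>f + c \<odot> x\<close>
    need not be.\<close>
  have lim: "(\<lambda>n. (sn (u - (s n + x)))\<^sup>2) \<longlonglongrightarrow> (sn (u - (f + x)))\<^sup>2" if x: "x \<in> H" for x
  proof -
    have t: "tends (\<lambda>n. u - (s n + x)) (u - (f + x))"
      by (intro tends_diff tends_add tends_const f) (use u sH x f in auto)
    have "\<bar>sn (u - (s n + x)) - sn (u - (f + x))\<bar> \<le> sn ((u - (s n + x)) - (u - (f + x)))" for n
      using sn_triangle[of "(u - (s n + x)) - (u - (f + x))" "u - (f + x)"]
        sn_triangle[of "(u - (f + x)) - (u - (s n + x))" "u - (s n + x)"]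
        sn_minus_commute[of "u - (f + x)" "u - (s n + x)"] u x f sH by (simp add: algebra_simps)
    then have "(\<lambda>n. sn (u - (s n + x)) - sn (u - (f + x))) \<longlonglongrightarrow> 0"
      by (intro Lim_null_comparison[OF _ t[unfolded tends_def]]) auto
    then show ?thesis by (intro tendsto_power) (simp add: Lim_null[symmetric])
  qed
  have le: "(sn (u - f))\<^sup>2 \<le> d"
  proof (rule LIMSEQ_le[OF lim[of 0, simplified]])
    show "(\<lambda>n. d + 1 / real (Suc n)) \<longlonglongrightarrow> d" using tendsto_add[OF tendsto_const LIMSEQ_inverse_real_of_nat, of d] by (simp add: inverse_eq_divide)
    show "\<exists>N. \<forall>n\<ge>N. (sn (u - s n))\<^sup>2 \<le> d + 1 / real (Suc n)" using s(2) less_imp_le by blast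
  qed
  have "ip (u - f) x = 0" if x: "x \<in> X" for x
  proof (rule ip_zero_if_minimal)
    fix c
    have "d \<le> (sn (u - (f + c \<odot> x)))\<^sup>2"
    proof (rule LIMSEQ_le_const[OF lim])
      show "c \<odot> x \<in> H" using x X by auto
      show "\<exists>N. \<forall>n\<ge>N. d \<le> (sn (u - (s n + c \<odot> x)))\<^sup>2"
        using d_le s x X by (auto intro: subspace_add subspace_scale)
    qed
    then show "(sn (u - f))\<^sup>2 \<le> (sn (u - f - c \<odot> x))\<^sup>2" using le by (simp add: diff_diff_eq)
  qed (use u f x X in auto)
  with s f show ?thesis using that by blast
qed

section \<open>Closed and complemented subspaces\<close>

definition is_closed :: "'a set \<Rightarrow> bool" where
  "is_closed X \<longleftrightarrow> (\<forall>s f. (\<forall>n. s n \<in> X) \<and> f \<in> H \<and> tends s f \<longrightarrow> f \<in> X)"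

definition perp :: "'a set \<Rightarrow> 'a set" where
  "perp X = {v \<in> H. \<forall>x\<in>X. ip v x = 0}"

lemma subspace_perp: "X \<subseteq> H \<Longrightarrow> subspace (perp X)"
  by (rule subspaceI) (auto simp: perp_def ip_simps subset_iff)

text \<open>For subspaces of \<open>H\<close> that contain \<open>null\<close> this is equivalent to
  closedness, by the next two lemmas. It is the form that passes to larger subspaces by a
  Gram-Schmidt step.\<close>

definition complemented :: "'a set \<Rightarrow> bool" where
  "complemented X \<longleftrightarrow> (\<forall>u\<in>H. \<exists>f\<in>X. u - f \<in> perp X)"

lemma closed_complemented:
  assumes "subspace X" "X \<subseteq> H" "is_closed X"
  shows "complemented X"
  unfolding complemented_def
proof
  fix u assume "u \<in> H"
  then obtain s f where *: "\<And>n. s n \<in> X" "f \<in> H" "tends s f" "\<And>x. x \<in> X \<Longrightarrow> ip (u - f) x = 0"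
    using projection_limit[OF assms(1,2)] by blast
  then have "f \<in> X" using assms(3) by (auto simp: is_closed_def)
  with * \<open>u \<in> H\<close> show "\<exists>f\<in>X. u - f \<in> perp X" by (auto simp: perp_def)
qed

text \<open>If \<open>f\<close> is the component of the limit \<open>u\<close> in \<open>X\<close>,
  then \<open>u - f\<close> is a limit of elements of \<open>X\<close>, all orthogonal to
  \<open>u - f\<close>. So \<open>u - f\<close> is orthogonal to itself, hence in
  \<open>null\<close>, which lies in \<open>X\<close>.\<close>

lemma complemented_closed:
  assumes "subspace X" "X \<subseteq> H" "null \<subseteq> X" "complemented X"
  shows "is_closed X"
  unfolding is_closed_def
proof (intro allI impI, elim conjE)
  fix s u assume s: "\<forall>n. s n \<in> X" and u: "u \<in> H" and t: "tends s u"
  obtain f where f: "f \<in> X" "u - f \<in> perp X" using assms(4) u by (auto simp: complemented_def)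
  have fH: "f \<in> H" and sH: "\<And>n. s n \<in> H" using f s assms(2) by auto
  have "(\<lambda>n. ip (s n - f) (u - f)) \<longlonglongrightarrow> ip (u - f) (u - f)"
    by (intro tends_ip_left tends_diff tends_const t) (use u fH sH in auto)
  moreover have "ip (s n - f) (u - f) = 0" for n
    using f s ip_cnj[of "u - f" "s n - f"] u fH sH assms(1) by (auto simp: perp_def subspace_diff)
  ultimately have "ip (u - f) (u - f) = 0" by (simp add: LIMSEQ_const_iff)
  then have "u - f \<in> X" using null_if_ip_self[of "u - f"] u fH assms(3) by auto
  then show "u \<in> X" using subspace_add[OF assms(1) _ f(1)] by fastforce
qed

lemma perp_perp:
  assumes "subspace X" "X \<subseteq> H" "is_closed X" "null \<subseteq> X"
  shows "perp (perp X) \<subseteq> X"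
proof
  fix u assume u: "u \<in> perp (perp X)"
  then have uH: "u \<in> H" by (simp add: perp_def)
  obtain f where f: "f \<in> X" "u - f \<in> perp X"
    using closed_complemented[OF assms(1-3)] uH by (auto simp: complemented_def)
  then have "ip u (u - f) = 0" "ip (u - f) f = 0" "f \<in> H" using u assms(2) by (auto simp: perp_def)
  then have "ip (u - f) (u - f) = 0" using ip_cnj[of "u - f" f] uH by (simp add: ip_diff_left[of u f "u - f"])
  then have "u - f \<in> X" using null_if_ip_self uH \<open>f \<in> H\<close> assms(4) by auto
  then show "u \<in> X" using subspace_add[OF assms(1) _ f(1)] by fastforce
qed

text \<open>The residual of the projection is orthogonal to \<open>X\<close> and so in
  \<open>null\<close>; the minimising sequence thus converges to \<open>u\<close> as well as to its
  projection.\<close>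

lemma dense_if_perp_null:
  assumes "subspace X" "X \<subseteq> H" "perp X \<subseteq> null" "u \<in> H" "e > 0"
  shows "\<exists>x\<in>X. sn (u - x) < e"
proof -
  obtain s f where *: "\<And>n. s n \<in> X" "f \<in> H" "tends s f" "\<And>x. x \<in> X \<Longrightarrow> ip (u - f) x = 0"
    using projection_limit[OF assms(1,2,4)] by blast
  then have "u - f \<in> null" using assms by (auto simp: perp_def)
  then have "f - u \<in> null" using subspace_neg[OF subspace_null, of "u - f"] by simp
  then have "tends s u" using tends_null_diff[OF *(3)] * assms by auto
  then obtain n where "sn (s n - u) < e" using \<open>e > 0\<close>
    unfolding tends_def LIMSEQ_iff by (metis diff_zero le_refl real_norm_def abs_ge_self le_less_trans)
  then show ?thesis using * assms sn_minus_commute[of "s n" u] by (metis subsetD)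
qed

end

section \<open>Selfadjoint extensions of symmetric operators\<close>

text \<open>Gaussian elimination, one equation per induction step. It is stated for coefficients
  because the independence that occurs later is independence modulo a subspace.\<close>

lemma homogeneous_system_nontrivial:
  fixes M :: "'i \<Rightarrow> 'j \<Rightarrow> 'c::field"
  assumes "finite J" "finite I" "card J < card I"
  shows "\<exists>x. (\<exists>i\<in>I. x i \<noteq> 0) \<and> (\<forall>j\<in>J. (\<Sum>i\<in>I. x i * M i j) = 0)"
  using assms
proof (induction J arbitrary: I M rule: finite_induct)
  case empty
  then obtain i where "i \<in> I" by fastforce
  then show ?case by (intro exI[of _ "\<lambda>_. 1"]) auto
next
  case (insert j J)
  show ?case
  proof (cases "\<forall>i\<in>I. M i j = 0")
    case True
    have "card J < card I" using insert by simp
    from insert.IH[OF insert.prems(1) this, of M] True show ?thesis by auto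
  next
    case False
    then obtain k where k: "k \<in> I" "M k j \<noteq> 0" by auto
    define M' where "M' i l = M i l - M i j / M k j * M k l" for i l
    have "card J < card (I - {k})" "finite (I - {k})" using insert k by auto
    from insert.IH[OF this(2,1), of M'] obtain x where
      x: "\<exists>i\<in>I - {k}. x i \<noteq> 0" "\<And>l. l \<in> J \<Longrightarrow> (\<Sum>i\<in>I - {k}. x i * M' i l) = 0" by auto
    \<comment> \<open>\<open>M'\<close> is the system after elimination of the unknown
      \<open>k\<close> with pivot \<open>M k j\<close>; the value \<open>y k\<close> is the one that
      solves equation \<open>j\<close>.\<close>
    define y where "y i = (if i = k then - (\<Sum>i\<in>I - {k}. x i * M i j) / M k j else x i)" for i
    have sum_y: "(\<Sum>i\<in>I. y i * M i l) = y k * M k l + (\<Sum>i\<in>I - {k}. x i * M i l)" for l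
      using insert.prems(1) k by (subst sum.remove[of I k]) (auto simp: y_def intro!: sum.cong)
    have "(\<Sum>i\<in>I. y i * M i l) = 0" if "l \<in> insert j J" for l
    proof (cases "l = j")
      case True
      then show ?thesis unfolding sum_y using k by (simp add: y_def)
    next
      case False
      then have "0 = (\<Sum>i\<in>I - {k}. x i * M' i l)" using that x by auto
      also have "\<dots> = (\<Sum>i\<in>I - {k}. x i * M i l) - (\<Sum>i\<in>I - {k}. x i * M i j) / M k j * M k l"
        by (simp add: M'_def sum_subtractf right_diff_distrib sum_distrib_left sum_divide_distrib mult_ac)
      finally show ?thesis unfolding sum_y by (simp add: y_def)
    qed
    moreover have "\<exists>i\<in>I. y i \<noteq> 0" using x(1) by (auto simp: y_def)
    ultimately show ?thesis by blast
  qed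
qed

section \<open>Dimensions of quotients\<close>

context semi_hilbert
begin

definition qdim :: "'a set \<Rightarrow> 'a set \<Rightarrow> nat \<Rightarrow> bool" where
  "qdim X W n \<longleftrightarrow> (\<exists>B. finite B \<and> card B = n \<and> B \<subseteq> X \<and>
     (\<forall>u\<in>X. \<exists>c. u - (\<Sum>b\<in>B. c b \<odot> b) \<in> W) \<and>
     (\<forall>c. (\<Sum>b\<in>B. c b \<odot> b) \<in> W \<longrightarrow> (\<forall>b\<in>B. c b = 0)))"

lemma qdim_if_spanned:
  assumes "finite B" "B \<subseteq> X" "subspace W" "\<forall>u\<in>X. \<exists>c. u - (\<Sum>b\<in>B. c b \<odot> b) \<in> W"
  shows "\<exists>n. qdim X W n"
  using assms(1,2,4)
proof (induction B rule: finite_psubset_induct)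
  case (psubset B)
  show ?case
  proof (cases "\<forall>c. (\<Sum>b\<in>B. c b \<odot> b) \<in> W \<longrightarrow> (\<forall>b\<in>B. c b = 0)")
    case True
    then show ?thesis using psubset unfolding qdim_def by blast
  next
    case False
    then obtain c k where c: "(\<Sum>b\<in>B. c b \<odot> b) \<in> W" "k \<in> B" "c k \<noteq> 0" by auto
    have "\<exists>e. u - (\<Sum>b\<in>B - {k}. e b \<odot> b) \<in> W" if "u \<in> X" for u
    proof -
      obtain d where d: "u - (\<Sum>b\<in>B. d b \<odot> b) \<in> W" using psubset.prems(2) \<open>u \<in> X\<close> by blast
      \<comment> \<open>The multiple of the relation \<open>c\<close> is chosen so that
        \<open>e k = 0\<close>; the sums over \<open>B\<close> and over \<open>B - {k}\<close> then
        agree.\<close>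
      define e where "e b = d b - d k / c k * c b" for b
      have "(\<Sum>b\<in>B - {k}. e b \<odot> b) = (\<Sum>b\<in>B. e b \<odot> b)"
        using c psubset.hyps by (simp add: sum.remove[of B k] e_def)
      also have "\<dots> = (\<Sum>b\<in>B. d b \<odot> b) - (d k / c k) \<odot> (\<Sum>b\<in>B. c b \<odot> b)"
        by (simp only: e_def scale_left_diff_distrib sum_subtractf scale_sum_right scale_scale)
      finally have eq: "u - (\<Sum>b\<in>B - {k}. e b \<odot> b)
          = (u - (\<Sum>b\<in>B. d b \<odot> b)) + (d k / c k) \<odot> (\<Sum>b\<in>B. c b \<odot> b)" by simp
      show ?thesis
        using subspace_add[OF assms(3) d subspace_scale[OF assms(3) c(1)]] by (intro exI[of _ e]) (simp only: eq)
    qed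
    then show ?thesis using psubset.IH[of "B - {k}"] psubset.prems c(2) by blast
  qed
qed

text \<open>Expand the independent vectors modulo \<open>W\<close> in the spanning ones. If there
  were more of the former, the coefficient system would have a nontrivial solution, that is, a
  nontrivial combination lying in \<open>W\<close>.\<close>

lemma qdim_le:
  assumes "subspace W" "qdim X W n" "qdim X W k"
  shows "n \<le> k"
proof (rule ccontr)
  assume "\<not> n \<le> k"
  obtain B where B: "finite B" "card B = n" "B \<subseteq> X"
    and ind: "\<And>c. (\<Sum>b\<in>B. c b \<odot> b) \<in> W \<Longrightarrow> (\<forall>b\<in>B. c b = 0)"
    using assms(2) unfolding qdim_def by blast
  obtain C where C: "finite C" "card C = k"
    and span: "\<And>u. u \<in> X \<Longrightarrow> \<exists>c. u - (\<Sum>b\<in>C. c b \<odot> b) \<in> W"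
    using assms(3) unfolding qdim_def by blast
  obtain M where M: "\<And>b. b \<in> B \<Longrightarrow> b - (\<Sum>d\<in>C. (M b d) \<odot> d) \<in> W"
    using span B(3) by (metis subsetD)
  obtain x where x: "\<exists>b\<in>B. x b \<noteq> 0" "\<And>d. d \<in> C \<Longrightarrow> (\<Sum>b\<in>B. x b * M b d) = 0"
    using homogeneous_system_nontrivial[OF C(1) B(1), of M] B C \<open>\<not> n \<le> k\<close> by auto
  have "(\<Sum>b\<in>B. x b \<odot> (\<Sum>d\<in>C. (M b d) \<odot> d)) = (\<Sum>d\<in>C. \<Sum>b\<in>B. (x b * M b d) \<odot> d)"
    by (subst sum.swap) (simp add: scale_sum_right)
  also have "\<dots> = 0" using x(2) by (simp flip: scale_sum_left)
  finally have "(\<Sum>b\<in>B. x b \<odot> b) = (\<Sum>b\<in>B. x b \<odot> (b - (\<Sum>d\<in>C. (M b d) \<odot> d)))"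
    by (simp add: scale_right_diff_distrib sum_subtractf)
  also have "\<dots> \<in> W" using assms(1) M by (intro subspace_sum subspace_scale) auto
  finally show False using ind x(1) by blast
qed

lemma qdim_unique: "\<lbrakk>subspace W; qdim X W n; qdim X W k\<rbrakk> \<Longrightarrow> n = k"
  by (simp add: le_antisym qdim_le)

section \<open>Adjoining finitely many vectors to a complemented subspace\<close>

lemma subspace_add_multiples:
  assumes "subspace R"
  shows "subspace {x + t \<odot> r | x t. x \<in> R}"
proof (rule subspaceI, goal_cases)
  case 1
  show ?case using assms by (auto intro!: exI[of _ 0] simp: subspace_0)
next
  case (2 x y)
  then obtain a s b t where "x = a + s \<odot> r" "y = b + t \<odot> r" "a \<in> R" "b \<in> R" by blast
  then have "x + y = (a + b) + (s + t) \<odot> r" "a + b \<in> R"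
    using assms by (auto simp: scale_left_distrib subspace_add algebra_simps)
  then show ?case by blast
next
  case (3 c x)
  then obtain a s where "x = a + s \<odot> r" "a \<in> R" by blast
  then have "c \<odot> x = c \<odot> a + (c * s) \<odot> r" "c \<odot> a \<in> R"
    using assms by (auto simp: scale_right_distrib subspace_scale)
  then show ?case by blast
qed

text \<open>One Gram-Schmidt step: only the part \<open>g\<close> of \<open>r\<close> orthogonal to
  \<open>R\<close> is new, so \<open>u\<close> is projected first onto \<open>R\<close> and what
  remains onto \<open>g\<close>.\<close>

lemma complemented_add_multiples:
  assumes R: "subspace R" "R \<subseteq> H" "complemented R" and r: "r \<in> H"
  shows "complemented {x + t \<odot> r | x t. x \<in> R}"
proof -
  have "\<exists>f\<in>{x + t \<odot> r | x t. x \<in> R}. u - f \<in> perp {x + t \<odot> r | x t. x \<in> R}" if u: "u \<in> H" for u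
  proof -
    obtain r0 where r0: "r0 \<in> R" "r - r0 \<in> perp R" using R(3) r by (auto simp: complemented_def)
    obtain u0 where u0: "u0 \<in> R" "u - u0 \<in> perp R" using R(3) u by (auto simp: complemented_def)
    have H: "r0 \<in> H" "u0 \<in> H" using r0 u0 R(2) by auto
    define g where "g = r - r0"
    \<comment> \<open>If \<open>ip g g = 0\<close>, division makes \<open>t = 0\<close>; then
      \<open>g\<close> is in \<open>null\<close> and \<open>ip (u - u0) g\<close> vanishes as well,
      so the identity \<open>tg\<close> holds in both cases.\<close>
    define t where "t = ip (u - u0) g / ip g g"
    have g: "g \<in> H" unfolding g_def using H r by simp
    have tg: "ip (u - u0) g = t * ip g g"
    proof (cases "ip g g = 0")
      case True
      then have "g \<in> null" using g null_if_ip_self by simp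
      then show ?thesis using null_ip(2)[of g "u - u0"] u H True by simp
    qed (simp add: t_def)
    have perp_R: "ip (u - u0 - t \<odot> g) x = 0" if "x \<in> R" for x
      using that r0(2) u0(2) u H g R(2)
      by (simp add: perp_def g_def[symmetric] ip_diff_left[of "u - u0" "t \<odot> g"] ip_scale_left subset_iff)
    have perp_g: "ip (u - u0 - t \<odot> g) g = 0"
      using tg u H g by (simp add: ip_diff_left[of "u - u0"] ip_scale_left)
    have "ip (u - u0 - t \<odot> g) (x + s \<odot> r) = 0" if "x \<in> R" for x s
    proof -
      have "x + s \<odot> r = (x + s \<odot> r0) + s \<odot> g" by (simp add: g_def scale_right_diff_distrib)
      moreover have "x + s \<odot> r0 \<in> R" using that r0 R(1) by (simp add: subspace_add subspace_scale)
      ultimately show ?thesis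
        using perp_R[of "x + s \<odot> r0"] perp_g u H g R(2)
          ip_add_right[of "x + s \<odot> r0" "s \<odot> g" "u - u0 - t \<odot> g"]
        by (simp add: ip_scale_right subset_iff add.assoc)
    qed
    then have "u - u0 - t \<odot> g \<in> perp {x + t \<odot> r | x t. x \<in> R}"
      using u H g by (auto simp: perp_def)
    then have "u - (u0 + t \<odot> g) \<in> perp {x + t \<odot> r | x t. x \<in> R}" by (simp only: diff_diff_eq)
    moreover have "u0 + t \<odot> g = (u0 - t \<odot> r0) + t \<odot> r" "u0 - t \<odot> r0 \<in> R"
      using u0 r0 R(1) by (auto simp: g_def scale_right_diff_distrib subspace_diff subspace_scale)
    ultimately show ?thesis by blast
  qed
  then show ?thesis by (simp add: complemented_def)
qed

text \<open>The vectors in \<open>B\<close> need not belong to \<open>R\<close>, so they cannot be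
  adjoined themselves. If \<open>b\<close> is indispensable, some \<open>r\<close> in
  \<open>R\<close> has a nonzero coefficient at \<open>b\<close>; adjoining \<open>r\<close> to
  \<open>R0\<close> makes \<open>b\<close> dispensable and stays inside \<open>R\<close>.\<close>

lemma complemented_finite_extension:
  assumes "finite B" "subspace R0" "complemented R0" "R0 \<subseteq> R" "subspace R" "R \<subseteq> H"
    and "\<forall>u\<in>R. \<exists>c. u - (\<Sum>b\<in>B. c b \<odot> b) \<in> R0"
  shows "complemented R"
  using assms(1-4,7)
proof (induction B arbitrary: R0 rule: finite_induct)
  case empty
  then have "R = R0" by auto
  then show ?case using empty by simp
next
  case (insert b B)
  show ?case
  proof (cases "\<forall>u\<in>R. \<exists>c. u - (\<Sum>b\<in>B. c b \<odot> b) \<in> R0")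
    case True
    then show ?thesis using insert by blast
  next
    case False
    then obtain r where r: "r \<in> R" "\<And>c. r - (\<Sum>b\<in>B. c b \<odot> b) \<notin> R0" by blast
    obtain c where c: "r - (\<Sum>b\<in>insert b B. c b \<odot> b) \<in> R0" using insert.prems r by blast
    have cb: "c b \<noteq> 0" using c r(2)[of c] insert.hyps by auto
    let ?R1 = "{x + t \<odot> r | x t. x \<in> R0}"
    have "\<exists>e. u - (\<Sum>b\<in>B. e b \<odot> b) \<in> ?R1" if u: "u \<in> R" for u
    proof -
      obtain d where d: "u - (\<Sum>b\<in>insert b B. d b \<odot> b) \<in> R0" using insert.prems u by blast
      \<comment> \<open>Subtracting \<open>t\<close> times the expansion of \<open>r\<close> cancels
        the coefficient at \<open>b\<close>, since \<open>d b - t * c b = 0\<close>.\<close>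
      define t where "t = d b / c b"
      define x where "x = (u - (\<Sum>b\<in>insert b B. d b \<odot> b)) - t \<odot> (r - (\<Sum>b\<in>insert b B. c b \<odot> b))"
      have "u - (\<Sum>b\<in>B. (d b - t * c b) \<odot> b) = x + t \<odot> r"
        using insert.hyps cb
        by (simp add: x_def t_def scale_left_diff_distrib sum_subtractf scale_right_diff_distrib
            scale_right_distrib scale_sum_right algebra_simps)
      moreover have "x \<in> R0" unfolding x_def
        by (rule subspace_diff[OF insert.prems(1) d subspace_scale[OF insert.prems(1) c]])
      ultimately show ?thesis by (intro exI[of _ "\<lambda>b. d b - t * c b"]) blast
    qed
    moreover have "?R1 \<subseteq> R" using insert.prems(3) r(1) assms(5) by (auto intro!: subspace_add subspace_scale)
    moreover have "complemented ?R1"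
      using insert.prems r(1) assms(6) by (intro complemented_add_multiples) auto
    ultimately show ?thesis
      using insert.IH[of ?R1] subspace_add_multiples[OF insert.prems(1)] by blast
  qed
qed

text \<open>The components \<open>g b\<close> of the representatives orthogonal to \<open>R\<close>
  represent the same classes modulo \<open>R\<close>, and \<open>R\<close> meets its orthogonal
  complement only in \<open>null\<close>.\<close>

lemma qdim_perp:
  assumes R: "subspace R" "R \<subseteq> H" "complemented R" "null \<subseteq> R" and q: "qdim H R n"
  shows "qdim (perp R) null n"
proof -
  obtain B where B: "finite B" "card B = n" "B \<subseteq> H"
    and span: "\<And>u. u \<in> H \<Longrightarrow> \<exists>c. u - (\<Sum>b\<in>B. c b \<odot> b) \<in> R"
    and ind: "\<And>c. (\<Sum>b\<in>B. c b \<odot> b) \<in> R \<Longrightarrow> (\<forall>b\<in>B. c b = 0)"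
    using q unfolding qdim_def by blast
  obtain f where f: "\<And>b. b \<in> B \<Longrightarrow> f b \<in> R \<and> b - f b \<in> perp R"
    using R(3) B(3) unfolding complemented_def by (metis subsetD)
  define g where "g b = b - f b" for b
  have sum_g: "(\<Sum>b\<in>B. c b \<odot> g b) = (\<Sum>b\<in>B. c b \<odot> b) - (\<Sum>b\<in>B. c b \<odot> f b)" for c
    by (simp add: g_def scale_right_diff_distrib sum_subtractf)
  have sum_f: "(\<Sum>b\<in>B. c b \<odot> f b) \<in> R" for c
    using R(1) f by (intro subspace_sum subspace_scale) auto
  \<comment> \<open>A dimension is the cardinality of a set, so the new representatives must be
    distinct: \<open>g b = g d\<close> would put \<open>b - d\<close> into \<open>R\<close>, against
    independence.\<close>
  have inj: "inj_on g B"
  proof (rule inj_onI, rule ccontr)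
    fix b d assume bd: "b \<in> B" "d \<in> B" "g b = g d" "b \<noteq> d"
    have "(\<Sum>x\<in>B. ((if x = b then 1 else 0) - (if x = d then 1 else 0)) \<odot> x) = b - d"
      using bd B(1) by (simp add: scale_left_diff_distrib sum_subtractf if_distrib[of "\<lambda>c. c \<odot> _"] sum.delta cong: if_cong)
    also have "\<dots> = f b - f d" using bd(3) by (simp add: g_def algebra_simps)
    also have "\<dots> \<in> R" using f bd R(1) by (simp add: subspace_diff)
    finally have "\<forall>x\<in>B. (if x = b then 1 else 0) - (if x = d then 1 else 0 :: complex) = 0" by (rule ind)
    then show False using bd by force
  qed
  have "R \<inter> perp R \<subseteq> null" using R(2) null_if_ip_self by (auto simp: perp_def)
  have "\<exists>c. u - (\<Sum>b\<in>g ` B. c b \<odot> b) \<in> null" if u: "u \<in> perp R" for u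
  proof -
    obtain c where c: "u - (\<Sum>b\<in>B. c b \<odot> b) \<in> R" using span u by (auto simp: perp_def)
    have eq: "(\<Sum>b\<in>g ` B. c (inv_into B g b) \<odot> b) = (\<Sum>b\<in>B. c b \<odot> g b)"
      using inj by (simp add: sum.reindex)
    have "u - (\<Sum>b\<in>B. c b \<odot> g b) = (u - (\<Sum>b\<in>B. c b \<odot> b)) + (\<Sum>b\<in>B. c b \<odot> f b)"
      by (simp add: sum_g)
    then have "u - (\<Sum>b\<in>B. c b \<odot> g b) \<in> R" using subspace_add[OF R(1) c sum_f] by metis
    moreover have "u - (\<Sum>b\<in>B. c b \<odot> g b) \<in> perp R"
      using u f by (intro subspace_diff subspace_sum subspace_scale subspace_perp R(2)) (auto simp: g_def)
    ultimately have "u - (\<Sum>b\<in>B. c b \<odot> g b) \<in> null" using \<open>R \<inter> perp R \<subseteq> null\<close> by blast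
    then show ?thesis using eq by metis
  qed
  moreover have "\<forall>b\<in>g ` B. c b = 0" if "(\<Sum>b\<in>g ` B. c b \<odot> b) \<in> null" for c
  proof -
    have "(\<Sum>b\<in>B. c (g b) \<odot> g b) \<in> R" using that inj R(4) by (auto simp: sum.reindex)
    then have "(\<Sum>b\<in>B. c (g b) \<odot> g b) + (\<Sum>b\<in>B. c (g b) \<odot> f b) \<in> R"
      using sum_f R(1) by (simp add: subspace_add)
    then show ?thesis using ind[of "\<lambda>b. c (g b)"] by (auto simp: sum_g)
  qed
  ultimately show ?thesis
    unfolding qdim_def using B inj f by (intro exI[of _ "g ` B"]) (auto simp: card_image simp flip: g_def)
qed

end

section \<open>Minimal and maximal extensions of a symmetric operator\<close>

locale symmetric_operator = semi_hilbert scale H ip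
  for scale :: "complex \<Rightarrow> 'a::ab_group_add \<Rightarrow> 'a" (infixr \<open>\<odot>\<close> 75) and H ip +
  fixes T :: "'a set" and A :: "'a \<Rightarrow> 'a"
  assumes subspace_T: "subspace T" and T_subset: "T \<subseteq> H"
    and A_T: "\<phi> \<in> T \<Longrightarrow> A \<phi> \<in> T"
    and A_add: "\<lbrakk>\<phi> \<in> T; \<psi> \<in> T\<rbrakk> \<Longrightarrow> A (\<phi> + \<psi>) = A \<phi> + A \<psi>"
    and A_scale: "\<phi> \<in> T \<Longrightarrow> A (c \<odot> \<phi>) = c \<odot> A \<phi>"
    and A_sym: "\<lbrakk>\<phi> \<in> T; \<psi> \<in> T\<rbrakk> \<Longrightarrow> ip (A \<phi>) \<psi> = ip \<phi> (A \<psi>)"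
    and perp_T: "perp T \<subseteq> null"
begin

definition dmin :: "'a set" where
  "dmin = {u \<in> H. \<exists>f\<in>H. \<exists>\<phi>. (\<forall>n. \<phi> n \<in> T) \<and> tends \<phi> u \<and> tends (\<lambda>n. A (\<phi> n)) f}"

text \<open>The weak action, tested with A itself because A is symmetric on \<open>T\<close>.
  Density of \<open>T\<close>, in the form \<open>perp_T\<close>, determines \<open>f\<close> modulo
  \<open>null\<close>. The graph of every extension pairs its domain with this action, so
  \<open>graph_on\<close> contains all values \<open>f\<close> and not a chosen one.\<close>

definition acts_on :: "'a \<Rightarrow> 'a \<Rightarrow> bool" where
  "acts_on u f \<longleftrightarrow> u \<in> H \<and> f \<in> H \<and> (\<forall>\<phi>\<in>T. ip u (A \<phi>) = ip f \<phi>)"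

definition graph_on :: "'a set \<Rightarrow> ('a \<times> 'a) set" where
  "graph_on D = {(u, f). u \<in> D \<and> acts_on u f}"

definition adjoint :: "('a \<times> 'a) set \<Rightarrow> ('a \<times> 'a) set" where
  "adjoint R = {(v, g). v \<in> H \<and> g \<in> H \<and> (\<forall>(u, f)\<in>R. ip f v = ip u g)}"

definition kern :: "('a \<times> 'a) set \<Rightarrow> 'a set" where
  "kern R = {u. \<exists>f\<in>null. (u, f) \<in> R}"

lemma T_H: "\<phi> \<in> T \<Longrightarrow> \<phi> \<in> H" using T_subset by auto

lemma AT_H: "\<phi> \<in> T \<Longrightarrow> A \<phi> \<in> H" using A_T T_H by auto

lemma acts_onD: "acts_on u f \<Longrightarrow> u \<in> H" "acts_on u f \<Longrightarrow> f \<in> H"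
  by (auto simp: acts_on_def)

lemma acts_on_add: "\<lbrakk>acts_on u f; acts_on v g\<rbrakk> \<Longrightarrow> acts_on (u + v) (f + g)"
  by (auto simp: acts_on_def ip_add_left T_H AT_H)

lemma acts_on_scale: "acts_on u f \<Longrightarrow> acts_on (c \<odot> u) (c \<odot> f)"
  by (auto simp: acts_on_def ip_scale_left T_H AT_H)

lemma acts_on_diff: "\<lbrakk>acts_on u f; acts_on v g\<rbrakk> \<Longrightarrow> acts_on (u - v) (f - g)"
  by (auto simp: acts_on_def ip_diff_left T_H AT_H)

lemma acts_on_null: "\<lbrakk>u \<in> null; f \<in> null\<rbrakk> \<Longrightarrow> acts_on u f"
  by (auto simp: acts_on_def null_ip null_H T_H AT_H)

lemma acts_on_unique: "\<lbrakk>acts_on u f; acts_on u g\<rbrakk> \<Longrightarrow> f - g \<in> null"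
  using perp_T by (auto simp: acts_on_def perp_def ip_diff_left T_H)

lemma acts_on_T: "\<phi> \<in> T \<Longrightarrow> acts_on \<phi> (A \<phi>)"
  by (simp add: acts_on_def A_sym T_H AT_H)

lemma acts_on_limit:
  assumes "\<And>n. \<phi> n \<in> T" "tends \<phi> u" "tends (\<lambda>n. A (\<phi> n)) f" "u \<in> H" "f \<in> H"
  shows "acts_on u f"
proof -
  have "ip u (A \<psi>) = ip f \<psi>" if "\<psi> \<in> T" for \<psi>
  proof (rule LIMSEQ_unique)
    show "(\<lambda>n. ip (\<phi> n) (A \<psi>)) \<longlonglongrightarrow> ip u (A \<psi>)"
      by (rule tends_ip_left) (use assms that T_H AT_H in auto)
    have "(\<lambda>n. ip (A (\<phi> n)) \<psi>) \<longlonglongrightarrow> ip f \<psi>"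
      by (rule tends_ip_left) (use assms that T_H AT_H in auto)
    then show "(\<lambda>n. ip (\<phi> n) (A \<psi>)) \<longlonglongrightarrow> ip f \<psi>" using A_sym assms(1) that by simp
  qed
  then show ?thesis using assms by (simp add: acts_on_def)
qed

definition gmin :: "('a \<times> 'a) set" where "gmin = graph_on dmin"

text \<open>Membership in \<open>dmin\<close> gives an approximating sequence for some value, while
  the graph carries every weak value. Both are weak values of \<open>u\<close>, so they differ by an
  element of \<open>null\<close>, and the same sequence approximates either.\<close>

lemma gmin_iff:
  "(u, f) \<in> gmin \<longleftrightarrow> u \<in> H \<and> f \<in> H \<and> (\<exists>\<phi>. (\<forall>n. \<phi> n \<in> T) \<and> tends \<phi> u \<and> tends (\<lambda>n. A (\<phi> n)) f)"
proof
  assume "(u, f) \<in> gmin"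
  then obtain g \<phi> where *: "acts_on u f" "g \<in> H" "\<And>n. \<phi> n \<in> T" "tends \<phi> u" "tends (\<lambda>n. A (\<phi> n)) g"
    by (auto simp: gmin_def graph_on_def dmin_def)
  then have "g - f \<in> null" using acts_on_unique[OF acts_on_limit *(1)] acts_onD by blast
  then have "tends (\<lambda>n. A (\<phi> n)) f" using tends_null_diff[OF *(5)] * acts_onD AT_H by blast
  then show "u \<in> H \<and> f \<in> H \<and> (\<exists>\<phi>. (\<forall>n. \<phi> n \<in> T) \<and> tends \<phi> u \<and> tends (\<lambda>n. A (\<phi> n)) f)"
    using * acts_onD by blast
next
  assume "u \<in> H \<and> f \<in> H \<and> (\<exists>\<phi>. (\<forall>n. \<phi> n \<in> T) \<and> tends \<phi> u \<and> tends (\<lambda>n. A (\<phi> n)) f)"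
  then show "(u, f) \<in> gmin" using acts_on_limit by (auto simp: gmin_def graph_on_def dmin_def)
qed

lemma gmin_acts: "(u, f) \<in> gmin \<Longrightarrow> acts_on u f"
  by (auto simp: gmin_def graph_on_def)

lemma gmin_H: "(u, f) \<in> gmin \<Longrightarrow> u \<in> H" "(u, f) \<in> gmin \<Longrightarrow> f \<in> H"
  using gmin_acts acts_onD by blast+

lemma gmin_T: "\<phi> \<in> T \<Longrightarrow> (\<phi>, A \<phi>) \<in> gmin"
  by (auto simp: gmin_iff T_H AT_H intro!: exI[of _ "\<lambda>_. \<phi>"] tends_const)

lemma gmin_add:
  assumes "(u, f) \<in> gmin" "(v, g) \<in> gmin"
  shows "(u + v, f + g) \<in> gmin"
proof -
  obtain \<phi> \<psi> where *: "\<And>n. \<phi> n \<in> T" "tends \<phi> u" "tends (\<lambda>n. A (\<phi> n)) f"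
    "\<And>n. \<psi> n \<in> T" "tends \<psi> v" "tends (\<lambda>n. A (\<psi> n)) g" using assms by (auto simp: gmin_iff)
  have "tends (\<lambda>n. \<phi> n + \<psi> n) (u + v)"
    by (rule tends_add) (use * T_H gmin_H assms in auto)
  moreover have "tends (\<lambda>n. A (\<phi> n) + A (\<psi> n)) (f + g)"
    by (rule tends_add) (use * AT_H gmin_H assms in auto)
  ultimately show ?thesis unfolding gmin_iff using * gmin_H[OF assms(1)] gmin_H[OF assms(2)] subspace_T
    by (intro conjI exI[of _ "\<lambda>n. \<phi> n + \<psi> n"]) (simp_all add: A_add subspace_add)
qed

lemma gmin_scale:
  assumes "(u, f) \<in> gmin"
  shows "(c \<odot> u, c \<odot> f) \<in> gmin"
proof -
  obtain \<phi> where *: "\<And>n. \<phi> n \<in> T" "tends \<phi> u" "tends (\<lambda>n. A (\<phi> n)) f"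
    using assms by (auto simp: gmin_iff)
  have "tends (\<lambda>n. c \<odot> \<phi> n) (c \<odot> u)" "tends (\<lambda>n. c \<odot> A (\<phi> n)) (c \<odot> f)"
    by (rule tends_scale; use * T_H AT_H gmin_H assms in auto)+
  then show ?thesis unfolding gmin_iff using * gmin_H[OF assms] subspace_T
    by (intro conjI exI[of _ "\<lambda>n. c \<odot> \<phi> n"]) (simp_all add: A_scale subspace_scale)
qed

lemma gmin_diff: "\<lbrakk>(u, f) \<in> gmin; (v, g) \<in> gmin\<rbrakk> \<Longrightarrow> (u - v, f - g) \<in> gmin"
  using gmin_add[OF _ gmin_scale[of v g "-1"], of u f] by simp

lemma gmin_null:
  assumes "u \<in> null" "f \<in> null"
  shows "(u, f) \<in> gmin"
proof -
  have "tends (\<lambda>_. 0) u" "tends (\<lambda>_. 0) f"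
    using assms sn_minus_commute[of 0 u] sn_minus_commute[of 0 f] by (auto simp: tends_def null_def)
  moreover have "A 0 = 0" using A_scale[of 0 0] subspace_0[OF subspace_T] by simp
  ultimately show ?thesis using assms null_H subspace_0[OF subspace_T]
    by (auto simp: gmin_iff intro!: exI[of _ "\<lambda>_. 0"])
qed

text \<open>A diagonal argument: each pair \<open>(u n, f n)\<close> is replaced by a pair
  \<open>(\<phi>, A \<phi>)\<close> with \<open>\<phi>\<close> in \<open>T\<close> that is within
  1/(n+1) of it in both components.\<close>

lemma gmin_closed:
  assumes "\<And>n. (u n, f n) \<in> gmin" "tends u v" "tends f g" "v \<in> H" "g \<in> H"
  shows "(v, g) \<in> gmin"
proof -
  have "\<exists>\<phi>\<in>T. sn (\<phi> - u n) < 1 / real (Suc n) \<and> sn (A \<phi> - f n) < 1 / real (Suc n)" for n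
  proof -
    obtain \<phi> where *: "\<And>n. \<phi> n \<in> T" "tends \<phi> (u n)" "tends (\<lambda>n. A (\<phi> n)) (f n)"
      using assms(1)[of n] by (auto simp: gmin_iff)
    have "eventually (\<lambda>k. sn (\<phi> k - u n) < 1 / real (Suc n) \<and> sn (A (\<phi> k) - f n) < 1 / real (Suc n)) sequentially"
      using *(2,3) unfolding tends_def by (intro eventually_conj order_tendstoD) auto
    then show ?thesis using *(1) unfolding eventually_sequentially by blast
  qed
  then obtain \<phi> where \<phi>: "\<And>n. \<phi> n \<in> T" "\<And>n. sn (\<phi> n - u n) < 1 / real (Suc n)"
      "\<And>n. sn (A (\<phi> n) - f n) < 1 / real (Suc n)" by metis
  have lim: "tends s w" if "\<And>n. sn (s n - t n) < 1 / real (Suc n)" "tends t w"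
    "\<And>n. s n \<in> H" "\<And>n. t n \<in> H" "w \<in> H" for s t w
    unfolding tends_def
  proof (rule tendsto_sandwich[of "\<lambda>_. 0" _ _ "\<lambda>n. inverse (real (Suc n)) + sn (t n - w)"])
    have "sn (s n - w) \<le> inverse (real (Suc n)) + sn (t n - w)" for n
      using sn_triangle_diff[of "s n" "t n" w] that(1)[of n] that(3-5) by (simp add: inverse_eq_divide)
    then show "\<forall>\<^sub>F n in sequentially. sn (s n - w) \<le> inverse (real (Suc n)) + sn (t n - w)" by simp
    show "(\<lambda>n. inverse (real (Suc n)) + sn (t n - w)) \<longlonglongrightarrow> 0"
      using tendsto_add[OF LIMSEQ_inverse_real_of_nat that(2)[unfolded tends_def]] by simp
  qed (use that in simp_all)
  have "tends \<phi> v" "tends (\<lambda>n. A (\<phi> n)) g"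
    using \<phi> assms(2-5) gmin_H[OF assms(1)] T_H AT_H by (blast intro: lim)+
  then show ?thesis using \<phi> assms by (auto simp: gmin_iff)
qed

lemma dmin_iff: "u \<in> dmin \<longleftrightarrow> (\<exists>f. (u, f) \<in> gmin)"
  by (auto simp: dmin_def gmin_iff)

lemma subspace_dmin: "subspace dmin"
  using gmin_null[of 0 0] subspace_0[OF subspace_null]
  by (intro subspaceI) (auto simp: dmin_iff dest: gmin_add gmin_scale intro: exI)

text \<open>Testing the adjoint relation on \<open>T\<close> yields the weak action. Conversely the
  weak identity passes from \<open>T\<close> to \<open>gmin\<close> along approximating sequences,
  the form being continuous. So \<open>acts_on\<close> is the maximal operator.\<close>

lemma adjoint_gmin: "(v, g) \<in> adjoint gmin \<longleftrightarrow> acts_on v g"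
proof
  assume "(v, g) \<in> adjoint gmin"
  then have *: "v \<in> H" "g \<in> H" "\<And>u f. (u, f) \<in> gmin \<Longrightarrow> ip f v = ip u g" by (auto simp: adjoint_def)
  have "ip v (A \<phi>) = ip g \<phi>" if "\<phi> \<in> T" for \<phi>
    using *(3)[OF gmin_T[OF that]] ip_cnj[of "A \<phi>" v] ip_cnj[of \<phi> g] * that T_H AT_H by simp
  then show "acts_on v g" using * by (simp add: acts_on_def)
next
  assume a: "acts_on v g"
  have "ip f v = ip u g" if uf: "(u, f) \<in> gmin" for u f
  proof -
    obtain \<phi> where *: "\<And>n. \<phi> n \<in> T" "tends \<phi> u" "tends (\<lambda>n. A (\<phi> n)) f"
      using uf by (auto simp: gmin_iff)
    have "(\<lambda>n. ip (A (\<phi> n)) v) \<longlonglongrightarrow> ip f v" "(\<lambda>n. ip (\<phi> n) g) \<longlonglongrightarrow> ip u g"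
      by (rule tends_ip_left; use * AT_H T_H gmin_H[OF uf] acts_onD[OF a] in auto)+
    moreover have "ip (A (\<phi> n)) v = ip (\<phi> n) g" for n
      using a *(1)[of n] ip_cnj[of v "A (\<phi> n)"] ip_cnj[of g "\<phi> n"] AT_H T_H by (simp add: acts_on_def)
    ultimately show ?thesis using LIMSEQ_unique by simp
  qed
  then show "(v, g) \<in> adjoint gmin" using acts_onD[OF a] by (auto simp: adjoint_def)
qed

lemma gmin_sym: "\<lbrakk>(u, f) \<in> gmin; acts_on v g\<rbrakk> \<Longrightarrow> ip f v = ip u g"
  using adjoint_gmin[of v g] by (auto simp: adjoint_def)

section \<open>Ranges and eigenspaces at a real parameter\<close>

definition ran :: "real \<Rightarrow> 'a set" where
  "ran \<mu> = {f - of_real \<mu> \<odot> u | u f. (u, f) \<in> gmin}"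

text \<open>The kernel of the maximal operator minus \<open>\<mu>\<close>. It contains
  \<open>null\<close>; genuine eigenvectors are its elements outside \<open>null\<close>.\<close>

definition eigen :: "real \<Rightarrow> 'a set" where
  "eigen \<mu> = {u. acts_on u (of_real \<mu> \<odot> u)}"

lemma ran_0: "ran 0 = Range gmin"
  by (auto simp: ran_def)

lemma ran_H: "ran \<mu> \<subseteq> H"
  using gmin_H by (auto simp: ran_def)

lemma null_ran: "null \<subseteq> ran \<mu>"
  using gmin_null[of 0] subspace_0[OF subspace_null] by (force simp: ran_def)

lemma subspace_ran: "subspace (ran \<mu>)"
proof (rule subspaceI)
  show "0 \<in> ran \<mu>" using null_ran subspace_0[OF subspace_null] by auto
  show "x + y \<in> ran \<mu>" if "x \<in> ran \<mu>" "y \<in> ran \<mu>" for x y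
  proof -
    obtain u f v g where "(u, f) \<in> gmin" "(v, g) \<in> gmin"
      "x = f - of_real \<mu> \<odot> u" "y = g - of_real \<mu> \<odot> v" using \<open>x \<in> ran \<mu>\<close> \<open>y \<in> ran \<mu>\<close> by (auto simp: ran_def)
    then show ?thesis unfolding ran_def mem_Collect_eq
      by (intro exI[of _ "u + v"] exI[of _ "f + g"]) (auto simp: gmin_add scale_right_distrib)
  qed
  show "c \<odot> x \<in> ran \<mu>" if "x \<in> ran \<mu>" for c x
  proof -
    obtain u f where "(u, f) \<in> gmin" "x = f - of_real \<mu> \<odot> u"
      using \<open>x \<in> ran \<mu>\<close> by (auto simp: ran_def)
    then show ?thesis unfolding ran_def mem_Collect_eq
      by (intro exI[of _ "c \<odot> u"] exI[of _ "c \<odot> f"]) (auto simp: gmin_scale scale_right_diff_distrib mult.commute)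
  qed
qed

text \<open>The orthogonal complement of a range is the kernel of the adjoint, and the adjoint of
  \<open>gmin\<close> is the maximal operator. As \<open>\<mu>\<close> is real, no conjugate
  appears.\<close>

lemma eigen_eq_perp_ran: "eigen \<mu> = perp (ran \<mu>)"
proof (intro set_eqI iffI)
  fix v assume "v \<in> eigen \<mu>"
  then have v: "acts_on v (of_real \<mu> \<odot> v)" by (simp add: eigen_def)
  have "ip v x = 0" if "x \<in> ran \<mu>" for x
  proof -
    obtain u f where uf: "(u, f) \<in> gmin" "x = f - of_real \<mu> \<odot> u"
      using \<open>x \<in> ran \<mu>\<close> by (auto simp: ran_def)
    have "ip x v = 0"
      using gmin_sym[OF uf(1) v] gmin_H[OF uf(1)] acts_onD(1)[OF v] uf(2) by (simp add: ip_simps)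
    then show ?thesis using ip_cnj[of x v] acts_onD(1)[OF v] that ran_H by auto
  qed
  then show "v \<in> perp (ran \<mu>)" using acts_onD(1)[OF v] by (simp add: perp_def)
next
  fix v assume v: "v \<in> perp (ran \<mu>)"
  then have vH: "v \<in> H" by (simp add: perp_def)
  have "ip f v = ip u (of_real \<mu> \<odot> v)" if uf: "(u, f) \<in> gmin" for u f
  proof -
    have "ip v (f - of_real \<mu> \<odot> u) = 0" using v uf by (auto simp: perp_def ran_def)
    then have "ip (f - of_real \<mu> \<odot> u) v = 0"
      using ip_cnj[of v "f - of_real \<mu> \<odot> u"] vH gmin_H[OF uf] by simp
    then show ?thesis using vH gmin_H[OF uf] by (simp add: ip_simps)
  qed
  then have "(v, of_real \<mu> \<odot> v) \<in> adjoint gmin" using vH by (auto simp: adjoint_def)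
  then show "v \<in> eigen \<mu>" by (simp add: adjoint_gmin eigen_def)
qed

lemma subspace_eigen: "subspace (eigen \<mu>)"
  unfolding eigen_eq_perp_ran by (rule subspace_perp[OF ran_H])

section \<open>The extensions with domain \<open>dmin\<close> plus an eigenspace, and their
  index\<close>

definition dext :: "real \<Rightarrow> 'a set" where
  "dext \<mu> = {u + n | u n. u \<in> dmin \<and> n \<in> eigen \<mu>}"

lemma subspace_dext: "subspace (dext \<mu>)"
  unfolding dext_def using subspace_sums[OF subspace_dmin subspace_eigen] by simp

lemma dmin_dext: "dmin \<subseteq> dext \<mu>"
proof
  fix u assume "u \<in> dmin"
  then show "u \<in> dext \<mu>"
    unfolding dext_def using subspace_0[OF subspace_eigen, of \<mu>] by force
qed

lemma eigen_dext: "eigen \<mu> \<subseteq> dext \<mu>"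
proof
  fix u assume "u \<in> eigen \<mu>"
  then show "u \<in> dext \<mu>"
    unfolding dext_def using subspace_0[OF subspace_dmin] by force
qed

lemma dext_acts: "u \<in> dext \<mu> \<Longrightarrow> \<exists>f. acts_on u f"
  unfolding dext_def using gmin_acts acts_on_add by (fastforce simp: dmin_iff eigen_def)

lemma selfadjoint_dext:
  assumes "is_closed (ran \<mu>)"
  shows "adjoint (graph_on (dext \<mu>)) = graph_on (dext \<mu>)"
proof (intro set_eqI iffI; clarify)
  fix v g assume adj: "(v, g) \<in> adjoint (graph_on (dext \<mu>))"
  moreover have "gmin \<subseteq> graph_on (dext \<mu>)" using dmin_dext by (auto simp: gmin_def graph_on_def)
  ultimately have "(v, g) \<in> adjoint gmin" by (auto simp: adjoint_def)
  then have vg: "acts_on v g" by (simp add: adjoint_gmin)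
  let ?h = "g - of_real \<mu> \<odot> v"
  have hH: "?h \<in> H" using acts_onD[OF vg] by simp
  have "ip ?h n = 0" if n: "n \<in> eigen \<mu>" for n
  proof -
    have an: "acts_on n (of_real \<mu> \<odot> n)" using n by (simp add: eigen_def)
    then have "(n, of_real \<mu> \<odot> n) \<in> graph_on (dext \<mu>)"
      using n eigen_dext by (auto simp: graph_on_def)
    then have "ip (of_real \<mu> \<odot> n) v = ip n g" using adj by (auto simp: adjoint_def)
    then have "ip n ?h = 0" using acts_onD[OF vg] acts_onD[OF an] by (simp add: ip_simps)
    then show ?thesis using ip_cnj[of n ?h] hH acts_onD(1)[OF an] by simp
  qed
  then have "?h \<in> perp (perp (ran \<mu>))" using hH by (auto simp: perp_def[of "perp (ran \<mu>)"] eigen_eq_perp_ran)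
  then have "?h \<in> ran \<mu>" using perp_perp[OF subspace_ran ran_H assms null_ran] by blast
  then obtain u f where uf: "(u, f) \<in> gmin" "?h = f - of_real \<mu> \<odot> u" by (auto simp: ran_def)
  \<comment> \<open>This says that the weak value of \<open>v - u\<close> is \<open>\<mu>\<close>
    times \<open>v - u\<close>, so \<open>v\<close> differs from an element of \<open>dmin\<close>
    by an element of \<open>eigen \<mu>\<close>.\<close>
  have "g - f = of_real \<mu> \<odot> (v - u)"
    using uf(2) by (simp add: scale_right_diff_distrib algebra_simps)
  then have "v - u \<in> eigen \<mu>" using acts_on_diff[OF vg gmin_acts[OF uf(1)]] by (simp add: eigen_def)
  moreover have "v = u + (v - u)" "u \<in> dmin" using uf(1) by (auto simp: dmin_iff)
  ultimately have "v \<in> dext \<mu>" unfolding dext_def by blast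
  then show "(v, g) \<in> graph_on (dext \<mu>)" using vg by (simp add: graph_on_def)
next
  \<comment> \<open>For the reverse inclusion the value \<open>f\<close> must be compared with the
    sum of the values of the two parts of \<open>u\<close>; the two agree only modulo
    \<open>null\<close>, which the form does not see.\<close>
  have split: "\<exists>u0 f0 n. (u0, f0) \<in> gmin \<and> acts_on n (of_real \<mu> \<odot> n) \<and> n \<in> eigen \<mu> \<and>
      u = u0 + n \<and> f - (f0 + of_real \<mu> \<odot> n) \<in> null" if uf: "(u, f) \<in> graph_on (dext \<mu>)" for u f
  proof -
    obtain u0 f0 n where *: "(u0, f0) \<in> gmin" "n \<in> eigen \<mu>" "u = u0 + n"
      using uf by (auto simp: graph_on_def dext_def dmin_iff)
    then have n: "acts_on n (of_real \<mu> \<odot> n)" by (simp add: eigen_def)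
    have "acts_on u (f0 + of_real \<mu> \<odot> n)"
      using acts_on_add[OF gmin_acts[OF *(1)] n] *(3) by simp
    then have "f - (f0 + of_real \<mu> \<odot> n) \<in> null" using uf acts_on_unique by (auto simp: graph_on_def)
    then show ?thesis using * n by blast
  qed
  fix v g assume vg: "(v, g) \<in> graph_on (dext \<mu>)"
  have vgH: "v \<in> H" "g \<in> H" using vg acts_onD by (auto simp: graph_on_def)
  have "ip f v = ip u g" if uf: "(u, f) \<in> graph_on (dext \<mu>)" for u f
  proof -
    obtain u0 f0 n where 1: "(u0, f0) \<in> gmin" "acts_on n (of_real \<mu> \<odot> n)"
      "u = u0 + n" "f - (f0 + of_real \<mu> \<odot> n) \<in> null" using split[OF uf] by blast
    obtain v0 g0 k where 2: "(v0, g0) \<in> gmin" "acts_on k (of_real \<mu> \<odot> k)"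
      "v = v0 + k" "g - (g0 + of_real \<mu> \<odot> k) \<in> null" using split[OF vg] by blast
    have H: "u0 \<in> H" "f0 \<in> H" "n \<in> H" "v0 \<in> H" "g0 \<in> H" "k \<in> H" "u \<in> H" "f \<in> H"
      using 1 2 uf gmin_H acts_onD by (auto simp: graph_on_def)
    have "ip f v = ip (f0 + of_real \<mu> \<odot> n) v"
      using null_ip(1)[OF 1(4) vgH(1)] H vgH by (simp add: ip_diff_left)
    \<comment> \<open>Three of these products move across because \<open>gmin\<close> is symmetric
      against the maximal operator; the product of \<open>n\<close> and \<open>k\<close> does so
      because \<open>\<mu>\<close> is real.\<close>
    also have "\<dots> = ip f0 v0 + ip f0 k + complex_of_real \<mu> * ip n v0 + complex_of_real \<mu> * ip n k"
      using H 2(3) by (simp add: ip_simps distrib_left)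
    also have "ip f0 v0 = ip u0 g0" using gmin_sym[OF 1(1) gmin_acts[OF 2(1)]] .
    also have "ip f0 k = complex_of_real \<mu> * ip u0 k" using gmin_sym[OF 1(1) 2(2)] H by (simp add: ip_simps)
    also have "complex_of_real \<mu> * ip n v0 = ip n g0"
      using gmin_sym[OF 2(1) 1(2)] ip_cnj[of g0 n] ip_cnj[of v0 "of_real \<mu> \<odot> n"] H
      by (simp add: ip_simps)
    also have "ip u0 g0 + complex_of_real \<mu> * ip u0 k + ip n g0 + complex_of_real \<mu> * ip n k
        = ip u (g0 + of_real \<mu> \<odot> k)"
      using H 1(3) by (simp add: ip_simps distrib_left)
    also have "\<dots> = ip u g" using null_ip(2)[OF 2(4) H(7)] H vgH by (simp add: ip_diff_right)
    finally show ?thesis .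
  qed
  then show "(v, g) \<in> adjoint (graph_on (dext \<mu>))" using vgH by (auto simp: adjoint_def)
qed

lemma Range_graph_on:
  assumes "subspace D" "dmin \<subseteq> D"
  shows "subspace (Range (graph_on D))" "Range (graph_on D) \<subseteq> H" "Range gmin \<subseteq> Range (graph_on D)"
proof -
  show "Range gmin \<subseteq> Range (graph_on D)" using assms(2) by (auto simp: gmin_def graph_on_def)
  show "Range (graph_on D) \<subseteq> H" using acts_onD by (auto simp: graph_on_def)
  show "subspace (Range (graph_on D))"
  proof (rule subspaceI)
    show "0 \<in> Range (graph_on D)"
      using acts_on_null[of 0 0] subspace_0[OF subspace_null] subspace_0[OF assms(1)] by (auto simp: graph_on_def)
    show "x + y \<in> Range (graph_on D)" if "x \<in> Range (graph_on D)" "y \<in> Range (graph_on D)" for x y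
      using that acts_on_add subspace_add[OF assms(1)] by (fastforce simp: graph_on_def)
    show "c \<odot> x \<in> Range (graph_on D)" if "x \<in> Range (graph_on D)" for c x
      using that acts_on_scale subspace_scale[OF assms(1)] by (fastforce simp: graph_on_def)
  qed
qed

lemma index_zero:
  assumes D: "subspace D" "dmin \<subseteq> D" and sa: "adjoint (graph_on D) = graph_on D"
    and cl: "is_closed (Range gmin)" and q: "qdim H (Range gmin) j"
  shows "is_closed (Range (graph_on D))"
    and "\<exists>n. qdim (kern (graph_on D)) null n \<and> qdim H (Range (graph_on D)) n"
proof -
  let ?R = "Range (graph_on D)"
  note R = Range_graph_on[OF D]
  have min: "subspace (Range gmin)" "Range gmin \<subseteq> H" "null \<subseteq> Range gmin"
    using subspace_ran[of 0] ran_H[of 0] null_ran[of 0] by (simp_all add: ran_0)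
  obtain B where B: "finite B" "B \<subseteq> H" "\<forall>u\<in>H. \<exists>c. u - (\<Sum>b\<in>B. c b \<odot> b) \<in> Range gmin"
    using q unfolding qdim_def by blast
  \<comment> \<open>The finite set \<open>B\<close> spans \<open>H\<close>, hence also
    \<open>?R\<close>, modulo \<open>Range gmin\<close>. So \<open>?R\<close> arises from a
    complemented subspace by adjoining finitely many vectors.\<close>
  have comp: "complemented ?R"
    using complemented_finite_extension[OF B(1) min(1) closed_complemented[OF min(1,2) cl] R(3,1,2)] B(3) R(2)
    by blast
  have nR: "null \<subseteq> ?R" using min(3) R(3) by blast
  show "is_closed ?R" using complemented_closed[OF R(1,2) nR comp] .
  obtain n where n: "qdim H ?R n" using qdim_if_spanned[OF B(1,2) R(1)] B(3) R(3) by blast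
  \<comment> \<open>Orthogonality of \<open>v\<close> to the range says that \<open>(v, 0)\<close>
    is in the adjoint, which is the graph itself. Conversely a value in \<open>null\<close> is
    orthogonal to everything.\<close>
  have "kern (graph_on D) = perp ?R"
  proof (intro set_eqI iffI)
    fix v assume "v \<in> kern (graph_on D)"
    then obtain g where g: "g \<in> null" "(v, g) \<in> adjoint (graph_on D)" by (auto simp: kern_def sa)
    have vH: "v \<in> H" using g by (simp add: adjoint_def)
    have "ip v f = 0" if f: "(u, f) \<in> graph_on D" for u f
    proof -
      have H: "u \<in> H" "f \<in> H" using f acts_onD by (auto simp: graph_on_def)
      have "ip f v = ip u g" using g f by (auto simp: adjoint_def)
      then show ?thesis using null_ip(2)[OF g(1) H(1)] ip_cnj[of f v] H vH by simp
    qed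
    then show "v \<in> perp ?R" using vH by (auto simp: perp_def)
  next
    fix v assume v: "v \<in> perp ?R"
    then have vH: "v \<in> H" by (simp add: perp_def)
    have "ip f v = ip u 0" if f: "(u, f) \<in> graph_on D" for u f
    proof -
      have H: "u \<in> H" "f \<in> H" using f acts_onD by (auto simp: graph_on_def)
      have "ip v f = 0" using v f by (auto simp: perp_def)
      then show ?thesis using ip_cnj[of v f] H vH by simp
    qed
    then have "(v, 0) \<in> adjoint (graph_on D)" using vH by (auto simp: adjoint_def)
    then show "v \<in> kern (graph_on D)" using subspace_0[OF subspace_null] by (auto simp: kern_def sa)
  qed
  then show "\<exists>n. qdim (kern (graph_on D)) null n \<and> qdim H ?R n"
    using n qdim_perp[OF R(1,2) comp nR n] by auto
qed

text \<open>The estimate turns convergence in the range into a Cauchy sequence of preimages, and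
  completeness with \<open>gmin_closed\<close> supplies a preimage of the limit.\<close>

lemma closed_ran_if_bounded_below:
  assumes "\<And>u f. (u, f) \<in> gmin \<Longrightarrow> sn u \<le> C * sn (f - of_real \<mu> \<odot> u)"
  shows "is_closed (ran \<mu>)"
  unfolding is_closed_def
proof (intro allI impI, elim conjE)
  fix s g assume s: "\<forall>n. s n \<in> ran \<mu>" and g: "g \<in> H" and t: "tends s g"
  let ?m = "complex_of_real \<mu>"
  obtain u f where uf: "\<And>n. (u n, f n) \<in> gmin" "\<And>n. s n = f n - ?m \<odot> u n"
    using s unfolding ran_def mem_Collect_eq by metis
  have H: "u n \<in> H" "f n \<in> H" "s n \<in> H" for n using uf gmin_H s ran_H by blast+
  \<comment> \<open>\<open>C\<close> may be zero or negative; \<open>K\<close> is positive, so the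
    tolerance \<open>e / K\<close> makes sense.\<close>
  define K where "K = \<bar>C\<bar> + 1"
  have bound: "sn (u i - u j) \<le> K * sn (s i - s j)" for i j
  proof -
    have "s i - s j = (f i - f j) - ?m \<odot> (u i - u j)"
      by (simp add: uf(2) scale_right_diff_distrib algebra_simps)
    then have "sn (u i - u j) \<le> C * sn (s i - s j)"
      using assms[OF gmin_diff[OF uf(1) uf(1)], of i j] by simp
    also have "\<dots> \<le> K * sn (s i - s j)" unfolding K_def using H by (intro mult_right_mono) auto
    finally show ?thesis .
  qed
  have "\<exists>M. \<forall>i\<ge>M. \<forall>j\<ge>M. sn (u i - u j) < e" if "e > 0" for e
  proof -
    have "K > 0" by (simp add: K_def)
    then obtain M where M: "\<And>i j. i \<ge> M \<Longrightarrow> j \<ge> M \<Longrightarrow> sn (s i - s j) < e / K"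
      using tends_cauchy[OF t _ g, of "e / K"] H \<open>e > 0\<close> by (metis divide_pos_pos)
    have "sn (u i - u j) < e" if "i \<ge> M" "j \<ge> M" for i j
      using bound[of i j] M[OF that] \<open>K > 0\<close> by (simp add: pos_less_divide_eq mult.commute)
    then show ?thesis by blast
  qed
  then obtain v where v: "v \<in> H" "tends u v" using complete_tends[of u] H by blast
  have "tends (\<lambda>n. s n + ?m \<odot> u n) (g + ?m \<odot> v)"
    by (intro tends_add tends_scale t v) (use H g v in auto)
  then have "(v, g + ?m \<odot> v) \<in> gmin" using gmin_closed[OF uf(1) v(2)] v g by (simp add: uf(2))
  moreover have "g = (g + ?m \<odot> v) - ?m \<odot> v" by simp
  ultimately show "g \<in> ran \<mu>" unfolding ran_def by blast
qed

text \<open>The spectral statement is the failure of every lower bound for the extension minus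
  \<open>\<mu>\<close>. This single form covers both an eigenvector outside \<open>null\<close> and
  a range of \<open>gmin\<close> minus \<open>\<mu>\<close> that is not closed; \<open>i < j\<close>
  is the negative index.\<close>

theorem selfadjoint_extension_with_spectrum:
  assumes cl: "is_closed (Range gmin)" and i: "qdim (kern gmin) null i"
    and j: "qdim H (Range gmin) j" and "i < j"
  obtains D where "subspace D" "dmin \<subseteq> D" "\<And>u. u \<in> D \<Longrightarrow> \<exists>f. acts_on u f"
    "adjoint (graph_on D) = graph_on D" "is_closed (Range (graph_on D))"
    "\<exists>n. qdim (kern (graph_on D)) null n \<and> qdim H (Range (graph_on D)) n"
    "\<not> (\<exists>C. \<forall>(u, f)\<in>graph_on D. sn u \<le> C * sn (f - of_real \<mu> \<odot> u))"
proof -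
  let ?m = "complex_of_real \<mu>"
  note result = that
  have dext: thesis if "is_closed (ran \<nu>)"
    "\<not> (\<exists>C. \<forall>(u, f)\<in>graph_on (dext \<nu>). sn u \<le> C * sn (f - ?m \<odot> u))" for \<nu>
    using that(2) that(1) index_zero[OF subspace_dext dmin_dext selfadjoint_dext[OF that(1)] cl j]
    by (intro result[OF subspace_dext dmin_dext dext_acts selfadjoint_dext[OF that(1)]]) auto
  show thesis
  proof (cases "is_closed (ran \<mu>)")
    case True
    have "\<not> eigen \<mu> \<subseteq> null"
    proof
      assume null: "eigen \<mu> \<subseteq> null"
      \<comment> \<open>A closed range with complement inside \<open>null\<close> is all of
        \<open>H\<close>. Hence every \<open>v\<close> with a weak value shares its image under A
        minus \<open>\<mu>\<close> with some \<open>u\<close> in \<open>dmin\<close>, and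
        \<open>v - u\<close> is in \<open>eigen \<mu>\<close>, thus in \<open>null\<close>: the
        maximal operator is no larger than \<open>gmin\<close>.\<close>
      have all: "g \<in> ran \<mu>" if g: "g \<in> H" for g
      proof -
        obtain f where f: "f \<in> ran \<mu>" "g - f \<in> perp (ran \<mu>)"
          using closed_complemented[OF subspace_ran ran_H True] g by (auto simp: complemented_def)
        then have "g - f \<in> ran \<mu>" using null null_ran by (auto simp: eigen_eq_perp_ran)
        then show ?thesis using subspace_add[OF subspace_ran _ f(1)] by fastforce
      qed
      have max: "(v, g) \<in> gmin" if vg: "acts_on v g" for v g
      proof -
        have "g - ?m \<odot> v \<in> ran \<mu>" using all acts_onD[OF vg] by simp
        then obtain u f where uf: "(u, f) \<in> gmin" "g - ?m \<odot> v = f - ?m \<odot> u" by (auto simp: ran_def)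
        have eq: "g - f = ?m \<odot> (v - u)" using uf(2) by (simp add: scale_right_diff_distrib algebra_simps)
        then have "v - u \<in> eigen \<mu>" using acts_on_diff[OF vg gmin_acts[OF uf(1)]] by (simp add: eigen_def)
        then have "v - u \<in> null" "g - f \<in> null" using null eq subspace_scale[OF subspace_null] by auto
        then show ?thesis using gmin_add[OF uf(1) gmin_null] by fastforce
      qed
      have "adjoint gmin = gmin" using adjoint_gmin max gmin_acts by auto
      then obtain n where n: "qdim (kern gmin) null n" "qdim H (Range gmin) n"
        using index_zero(2)[OF subspace_dmin order_refl _ cl j] by (auto simp: gmin_def)
      have "i = n" using qdim_unique[OF subspace_null i n(1)] .
      moreover have "j = n" using qdim_unique[OF subspace_ran[of 0, unfolded ran_0] j n(2)] .
      ultimately show False using \<open>i < j\<close> by simp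
    qed
    then obtain n where n: "n \<in> eigen \<mu>" "n \<notin> null" by blast
    then have an: "(n, ?m \<odot> n) \<in> graph_on (dext \<mu>)" using eigen_dext by (auto simp: graph_on_def eigen_def)
    then have "n \<in> H" using acts_onD by (auto simp: graph_on_def)
    have "\<not> (\<exists>C. \<forall>(u, f)\<in>graph_on (dext \<mu>). sn u \<le> C * sn (f - ?m \<odot> u))"
    proof
      assume "\<exists>C. \<forall>(u, f)\<in>graph_on (dext \<mu>). sn u \<le> C * sn (f - ?m \<odot> u)"
      \<comment> \<open>On the pair \<open>(n, ?m \<odot> n)\<close> the right side of the estimate
        is a multiple of \<open>sn 0\<close>.\<close>
      then have "sn n \<le> 0" using an by fastforce
      then have "sn n = 0" using sn_nonneg[OF \<open>n \<in> H\<close>] by linarith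
      then show False using n \<open>n \<in> H\<close> by (simp add: null_def)
    qed
    then show thesis using dext True by blast
  next
    case False
    have "\<not> (\<exists>C. \<forall>(u, f)\<in>graph_on (dext 0). sn u \<le> C * sn (f - ?m \<odot> u))"
    proof
      assume "\<exists>C. \<forall>(u, f)\<in>graph_on (dext 0). sn u \<le> C * sn (f - ?m \<odot> u)"
      then obtain C where "\<And>u f. (u, f) \<in> graph_on (dext 0) \<Longrightarrow> sn u \<le> C * sn (f - ?m \<odot> u)" by blast
      then have "\<And>u f. (u, f) \<in> gmin \<Longrightarrow> sn u \<le> C * sn (f - ?m \<odot> u)"
        using dmin_dext by (auto simp: gmin_def graph_on_def)
      then show False using closed_ran_if_bounded_below False by blast
    qed
    moreover have "is_closed (ran 0)" using cl by (simp add: ran_0)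
    ultimately show thesis using dext by blast
  qed
qed

end

section \<open>Smooth functions and local differential operators\<close>

lemma C_on_cong:
  assumes "\<And>x. x \<in> S \<Longrightarrow> f x = g x" "C_on k S f"
  shows "C_on k S g"
proof (cases k)
  case 0
  then show ?thesis using assms continuous_on_cong[of S S f g] by simp
next
  case (Suc j)
  then obtain f' where "\<forall>x\<in>S. (f has_derivative f' x) (at x within S)" "\<forall>v. C_on j S (\<lambda>x. f' x v)"
    using assms(2) by auto
  moreover have "\<And>x. x \<in> S \<Longrightarrow> (f has_derivative f' x) (at x within S) \<Longrightarrow> (g has_derivative f' x) (at x within S)"
    by (rule has_derivative_transform[of _ S g f]) (use assms(1) in auto)
  ultimately show ?thesis using Suc by auto
qed

lemma C_on_subset: "\<lbrakk>C_on k S f; S' \<subseteq> S\<rbrakk> \<Longrightarrow> C_on k S' f"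
proof (induction k arbitrary: f)
  case 0
  then show ?case using continuous_on_subset by auto
next
  case (Suc k)
  then obtain f' where "\<forall>x\<in>S. (f has_derivative f' x) (at x within S)" "\<forall>v. C_on k S (\<lambda>x. f' x v)" by auto
  then show ?case using Suc by (auto intro!: exI[of _ f'] intro: has_derivative_subset)
qed

lemma C_on_continuous: "C_on k S f \<Longrightarrow> continuous_on S f"
  by (cases k) (auto intro: has_derivative_continuous_on)

lemma C_on_SucD: "C_on (Suc k) S f \<Longrightarrow> C_on k S f"
proof (induction k arbitrary: f)
  case 0
  then show ?case unfolding C_on.simps(1)[of S f] by (rule C_on_continuous)
next
  case (Suc k)
  then obtain f' where "\<forall>x\<in>S. (f has_derivative f' x) (at x within S)" "\<forall>v. C_on (Suc k) S (\<lambda>x. f' x v)"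
    unfolding C_on.simps(2)[of "Suc k"] by blast
  then show ?case using Suc.IH by auto
qed

lemma C_on_const: "C_on k S (\<lambda>_. c)"
proof (induction k arbitrary: c)
  case (Suc k)
  then show ?case by (auto intro!: exI[of _ "\<lambda>_ _. 0"])
qed simp

lemma C_on_add: "\<lbrakk>C_on k S f; C_on k S g\<rbrakk> \<Longrightarrow> C_on k S (\<lambda>x. f x + g x)"
proof (induction k arbitrary: f g)
  case (Suc k)
  then obtain f' g' where "\<forall>x\<in>S. (f has_derivative f' x) (at x within S)" "\<forall>v. C_on k S (\<lambda>x. f' x v)"
    "\<forall>x\<in>S. (g has_derivative g' x) (at x within S)" "\<forall>v. C_on k S (\<lambda>x. g' x v)" by auto
  then show ?case using Suc.IH
    by (auto intro!: exI[of _ "\<lambda>x v. f' x v + g' x v"] has_derivative_add)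
qed (auto intro: continuous_on_add)

lemma C_on_bounded_linear: "bounded_linear L \<Longrightarrow> C_on k S L"
  by (cases k) (auto simp: bounded_linear.has_derivative linear_continuous_on C_on_const bounded_linear_imp_has_derivative intro!: exI[of _ "\<lambda>_. L"])

lemma C_on_bilinear:
  assumes "bounded_bilinear b"
  shows "\<lbrakk>C_on k S f; C_on k S g\<rbrakk> \<Longrightarrow> C_on k S (\<lambda>x. b (f x) (g x))"
proof (induction k arbitrary: f g)
  case 0
  then show ?case by (simp add: bounded_bilinear.continuous_on[OF assms])
next
  case (Suc k)
  then obtain f' g' where *: "\<forall>x\<in>S. (f has_derivative f' x) (at x within S)" "\<forall>v. C_on k S (\<lambda>x. f' x v)"
    "\<forall>x\<in>S. (g has_derivative g' x) (at x within S)" "\<forall>v. C_on k S (\<lambda>x. g' x v)" by auto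
  have "C_on k S f" "C_on k S g" using Suc.prems C_on_SucD by auto
  then have "C_on k S (\<lambda>x. b (f x) (g' x v) + b (f' x v) (g x))" for v
    using * by (intro C_on_add Suc.IH) auto
  then show ?case using *
    by (auto intro!: exI[of _ "\<lambda>x v. b (f x) (g' x v) + b (f' x v) (g x)"] bounded_bilinear.FDERIV[OF assms])
qed

lemma C_on_inverse:
  fixes f :: "'a::real_normed_vector \<Rightarrow> real"
  assumes "\<And>x. x \<in> S \<Longrightarrow> f x \<noteq> 0"
  shows "C_on k S f \<Longrightarrow> C_on k S (\<lambda>x. inverse (f x))"
proof (induction k)
  case 0
  then show ?case using assms by (auto intro: continuous_on_inverse)
next
  case (Suc k)
  then obtain f' where f': "\<forall>x\<in>S. (f has_derivative f' x) (at x within S)" "\<forall>v. C_on k S (\<lambda>x. f' x v)" by auto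
  have i: "C_on k S (\<lambda>x. inverse (f x))" using Suc C_on_SucD by blast
  have 1: "C_on k S (\<lambda>x. (- 1) * (inverse (f x) * (f' x v * inverse (f x))))" for v
    using f' i by (intro C_on_bilinear[OF bounded_bilinear_mult] C_on_const) auto
  have 2: "((\<lambda>x. inverse (f x)) has_derivative (\<lambda>v. (- 1) * (inverse (f x) * (f' x v * inverse (f x))))) (at x within S)"
    if "x \<in> S" for x
    using Deriv.has_derivative_inverse[OF assms[OF that] f'(1)[rule_format, OF that]] by (simp add: mult.assoc)
  show ?case unfolding C_on.simps
    by (intro exI[of _ "\<lambda>x v. (- 1) * (inverse (f x) * (f' x v * inverse (f x)))"] conjI ballI allI 1 2)
qed

text \<open>\<open>C_on\<close> asserts some choice of derivative relative to the set. On an open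
  set this is the Frechet derivative, which does not depend on the set; that is why smoothness on
  two open sets gives smoothness on their union.\<close>

lemma C_on_Suc_open:
  assumes "open S"
  shows "C_on (Suc k) S f \<longleftrightarrow> (\<forall>x\<in>S. f differentiable (at x)) \<and>
    (\<forall>v. C_on k S (\<lambda>x. frechet_derivative f (at x) v))"
proof
  assume "C_on (Suc k) S f"
  then obtain f' where f': "\<forall>x\<in>S. (f has_derivative f' x) (at x within S)" "\<forall>v. C_on k S (\<lambda>x. f' x v)" by auto
  then have d: "\<And>x. x \<in> S \<Longrightarrow> (f has_derivative f' x) (at x)"
    using assms by (metis at_within_open)
  then have eq: "\<And>x. x \<in> S \<Longrightarrow> f' x = frechet_derivative f (at x)" by (metis frechet_derivative_at)
  show "(\<forall>x\<in>S. f differentiable (at x)) \<and> (\<forall>v. C_on k S (\<lambda>x. frechet_derivative f (at x) v))"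
  proof (intro conjI ballI allI)
    show "f differentiable at x" if "x \<in> S" for x using d[OF that] by (auto simp: differentiable_def)
    show "C_on k S (\<lambda>x. frechet_derivative f (at x) v)" for v
      by (rule C_on_cong[OF _ f'(2)[rule_format, of v]]) (simp add: eq)
  qed
next
  assume "(\<forall>x\<in>S. f differentiable (at x)) \<and> (\<forall>v. C_on k S (\<lambda>x. frechet_derivative f (at x) v))"
  then show "C_on (Suc k) S f"
    by (auto intro!: exI[of _ "\<lambda>x. frechet_derivative f (at x)"]
        intro: has_derivative_at_withinI simp: frechet_derivative_works)
qed

lemma C_on_Un_open:
  "\<lbrakk>open S; open S'; C_on k S f; C_on k S' f\<rbrakk> \<Longrightarrow> C_on k (S \<union> S') f"
proof (induction k arbitrary: f)
  case 0
  then show ?case by (simp add: continuous_on_open_Un)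
next
  case (Suc k)
  then show ?case by (auto simp: C_on_Suc_open open_Un simp del: C_on.simps)
qed

lemma smooth_on_cong: "\<lbrakk>smooth_on S f; \<And>x. x \<in> S \<Longrightarrow> f x = g x\<rbrakk> \<Longrightarrow> smooth_on S g"
  unfolding smooth_on_def using C_on_cong by blast

lemma smooth_on_subset: "\<lbrakk>smooth_on S f; S' \<subseteq> S\<rbrakk> \<Longrightarrow> smooth_on S' f"
  unfolding smooth_on_def using C_on_subset by blast

lemma smooth_on_continuous: "smooth_on S f \<Longrightarrow> continuous_on S f"
  unfolding smooth_on_def using C_on_continuous by blast

lemma smooth_on_const: "smooth_on S (\<lambda>_. c)"
  by (simp add: smooth_on_def C_on_const)

lemma smooth_on_add: "\<lbrakk>smooth_on S f; smooth_on S g\<rbrakk> \<Longrightarrow> smooth_on S (\<lambda>x. f x + g x)"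
  by (simp add: smooth_on_def C_on_add)

lemma smooth_on_bounded_linear: "bounded_linear L \<Longrightarrow> smooth_on S L"
  by (simp add: smooth_on_def C_on_bounded_linear)

lemma smooth_on_bounded_bilinear:
  "\<lbrakk>bounded_bilinear b; smooth_on S f; smooth_on S g\<rbrakk> \<Longrightarrow> smooth_on S (\<lambda>x. b (f x) (g x))"
  by (simp add: smooth_on_def C_on_bilinear)

lemma smooth_on_sum: "(\<And>i. i \<in> I \<Longrightarrow> smooth_on S (f i)) \<Longrightarrow> smooth_on S (\<lambda>x. \<Sum>i\<in>I. f i x)"
  by (induction I rule: infinite_finite_induct) (auto intro: smooth_on_const smooth_on_add)

lemma smooth_on_mult:
  fixes f g :: "'a::real_normed_vector \<Rightarrow> real"
  shows "\<lbrakk>smooth_on S f; smooth_on S g\<rbrakk> \<Longrightarrow> smooth_on S (\<lambda>x. f x * g x)"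
  by (rule smooth_on_bounded_bilinear[OF bounded_bilinear_mult])

lemma smooth_on_prod:
  fixes f :: "'i \<Rightarrow> 'a::real_normed_vector \<Rightarrow> real"
  shows "(\<And>i. i \<in> I \<Longrightarrow> smooth_on S (f i)) \<Longrightarrow> smooth_on S (\<lambda>x. \<Prod>i\<in>I. f i x)"
  by (induction I rule: infinite_finite_induct) (auto intro: smooth_on_const smooth_on_mult)

lemma smooth_on_power:
  fixes f :: "'a::real_normed_vector \<Rightarrow> real"
  shows "smooth_on S f \<Longrightarrow> smooth_on S (\<lambda>x. f x ^ n)"
  by (induction n) (auto intro: smooth_on_const smooth_on_mult)

lemma smooth_on_inverse:
  fixes f :: "'a::real_normed_vector \<Rightarrow> real"
  shows "\<lbrakk>smooth_on S f; \<And>x. x \<in> S \<Longrightarrow> f x \<noteq> 0\<rbrakk> \<Longrightarrow> smooth_on S (\<lambda>x. inverse (f x))"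
  by (simp add: smooth_on_def C_on_inverse)

lemma smooth_on_scaleR: "\<lbrakk>smooth_on S f; smooth_on S g\<rbrakk> \<Longrightarrow> smooth_on S (\<lambda>x. f x *\<^sub>R g x)"
  by (rule smooth_on_bounded_bilinear[OF bounded_bilinear_scaleR])

lemma smooth_on_Un_open: "\<lbrakk>open S; open S'; smooth_on S f; smooth_on S' f\<rbrakk> \<Longrightarrow> smooth_on (S \<union> S') f"
  by (simp add: smooth_on_def C_on_Un_open)

lemma bounded_bilinear_matrix_vector:
  "bounded_bilinear ((*v) :: complex^'n::finite^'m::finite \<Rightarrow> complex^'n \<Rightarrow> complex^'m)"
  unfolding bilinear_conv_bounded_bilinear[symmetric] bilinear_def
  by (auto intro!: linearI simp: vec_eq_iff matrix_vector_mult_def algebra_simps sum.distrib scaleR_sum_right)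

lemma bounded_bilinear_vector_scale:
  "bounded_bilinear ((*s) :: complex \<Rightarrow> complex^'n::finite \<Rightarrow> complex^'n)"
  unfolding bilinear_conv_bounded_bilinear[symmetric] bilinear_def
  by (auto intro!: linearI simp: vec_eq_iff algebra_simps)

lemma smooth_on_matrix_vector:
  fixes f :: "'a::real_normed_vector \<Rightarrow> complex^'n::finite^'m::finite"
  shows "\<lbrakk>smooth_on S f; smooth_on S g\<rbrakk> \<Longrightarrow> smooth_on S (\<lambda>x. f x *v g x)"
  by (rule smooth_on_bounded_bilinear[OF bounded_bilinear_matrix_vector])

lemma smooth_on_vector_scale:
  fixes g :: "'a::real_normed_vector \<Rightarrow> complex^'n::finite"
  shows "\<lbrakk>smooth_on S f; smooth_on S g\<rbrakk> \<Longrightarrow> smooth_on S (\<lambda>x. f x *s g x)"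
  by (rule smooth_on_bounded_bilinear[OF bounded_bilinear_vector_scale])

section \<open>The smooth cutoff exp(-1/t)\<close>

definition flat :: "nat \<Rightarrow> real \<Rightarrow> real" where
  "flat n t = (if t > 0 then inverse t ^ n * exp (- inverse t) else 0)"

lemma flat_tendsto_0: "((\<lambda>t. inverse t ^ n * exp (- inverse t)) \<longlongrightarrow> 0) (at_right (0::real))"
proof -
  have "((\<lambda>t::real. t ^ n * exp (- t)) \<longlongrightarrow> 0) at_top"
    using tendsto_power_div_exp_0[of n] by (simp add: exp_minus divide_inverse)
  then show ?thesis by (rule filterlim_compose) (rule filterlim_inverse_at_top_right)
qed

text \<open>The powers of \<open>inverse t\<close> make the family closed under differentiation, so
  smoothness becomes an induction on the order with \<open>n\<close> arbitrary.\<close>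

lemma flat_has_derivative:
  "(flat n has_real_derivative (- real n * flat (Suc n) t + flat (Suc (Suc n)) t)) (at t)"
proof -
  consider "t > 0" | "t < 0" | "t = 0" by linarith
  then show ?thesis
  proof cases
    case 1
    have "((\<lambda>t. inverse t ^ n * exp (- inverse t)) has_real_derivative
        real n * (- (inverse t * inverse t)) * inverse t ^ (n - Suc 0) * exp (- inverse t) +
        exp (- inverse t) * (inverse t * inverse t) * inverse t ^ n) (at t)"
      using 1 by (auto intro!: derivative_eq_intros)
    also have "real n * (- (inverse t * inverse t)) * inverse t ^ (n - Suc 0) * exp (- inverse t) +
        exp (- inverse t) * (inverse t * inverse t) * inverse t ^ n
        = - real n * flat (Suc n) t + flat (Suc (Suc n)) t"
      using 1 by (cases n) (simp_all add: flat_def algebra_simps)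
    finally have "((\<lambda>t. inverse t ^ n * exp (- inverse t)) has_real_derivative
        (- real n * flat (Suc n) t + flat (Suc (Suc n)) t)) (at t)" .
    then show ?thesis
      by (rule has_field_derivative_transform_within_open[of _ _ _ "{0<..}"]) (use 1 in \<open>auto simp: flat_def\<close>)
  next
    case 2
    have "((\<lambda>t. 0) has_real_derivative (- real n * flat (Suc n) t + flat (Suc (Suc n)) t)) (at t)"
      using 2 by (auto intro!: derivative_eq_intros simp: flat_def)
    then show ?thesis
      by (rule has_field_derivative_transform_within_open[of _ _ _ "{..<0}"]) (use 2 in \<open>auto simp: flat_def\<close>)
  next
    case 3
    have "((\<lambda>s. flat (Suc n) s) \<longlongrightarrow> 0) (at 0)"
    proof (subst filterlim_at_split, intro conjI)
      show "(flat (Suc n) \<longlongrightarrow> 0) (at_left 0)"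
        by (rule tendsto_eventually) (auto simp: flat_def eventually_at_filter)
      show "(flat (Suc n) \<longlongrightarrow> 0) (at_right 0)"
        by (rule Lim_transform_eventually[OF flat_tendsto_0[of "Suc n"]])
          (auto simp: flat_def eventually_at_filter)
    qed
    \<comment> \<open>At 0 the difference quotient of \<open>flat n\<close> is
      \<open>flat (Suc n)\<close> itself, for both signs of \<open>s\<close>, so the derivative at 0
      is the limit just computed.\<close>
    moreover have "(flat n (0 + s) - flat n 0) / s = flat (Suc n) s" for s
      by (simp add: flat_def divide_inverse)
    ultimately show ?thesis using 3 by (simp add: DERIV_def flat_def)
  qed
qed

lemma C_on_flat: "C_on k S g \<Longrightarrow> C_on k S (\<lambda>x. flat n (g x))"
proof (induction k arbitrary: n)
  case 0
  have "continuous_on UNIV (flat n)"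
    by (intro continuous_at_imp_continuous_on ballI DERIV_isCont[OF flat_has_derivative])
  then show ?case using 0 continuous_on_compose2[of UNIV "flat n" S g] by simp
next
  case (Suc k)
  then obtain g' where g': "\<forall>x\<in>S. (g has_derivative g' x) (at x within S)" "\<forall>v. C_on k S (\<lambda>x. g' x v)" by auto
  have IH: "C_on k S (\<lambda>x. flat j (g x))" for j using Suc C_on_SucD by blast
  have 1: "C_on k S (\<lambda>x. (- real n * flat (Suc n) (g x) + flat (Suc (Suc n)) (g x)) * g' x v)" for v
    using g' IH by (intro C_on_bilinear[OF bounded_bilinear_mult] C_on_add C_on_const) auto
  have 2: "((\<lambda>x. flat n (g x)) has_derivative
      (\<lambda>v. (- real n * flat (Suc n) (g x) + flat (Suc (Suc n)) (g x)) * g' x v)) (at x within S)" if "x \<in> S" for x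
    using has_derivative_compose[OF g'(1)[rule_format, OF that] flat_has_derivative[unfolded has_field_derivative_def]] .
  show ?case unfolding C_on.simps
    by (intro exI[of _ "\<lambda>x v. (- real n * flat (Suc n) (g x) + flat (Suc (Suc n)) (g x)) * g' x v"]
        conjI ballI allI 1 2)
qed

lemma smooth_on_flat: "smooth_on S g \<Longrightarrow> smooth_on S (\<lambda>x. flat n (g x))"
  by (simp add: smooth_on_def C_on_flat)

text \<open>The clause for subsets expresses locality: \<open>F\<close> acts compatibly on every open part of \<open>S\<close>.\<close>

definition local_linear :: "'v::euclidean_space set \<Rightarrow>
    (('v \<Rightarrow> complex^'r::finite) \<Rightarrow> 'v \<Rightarrow> complex^'r) \<Rightarrow> bool" where
  "local_linear S F \<longleftrightarrow> (\<forall>S' f g h c. open S' \<and> S' \<subseteq> S \<and> smooth_on S' f \<and> smooth_on S' g \<and>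
     (\<forall>v\<in>S'. h v = c *s f v + g v) \<longrightarrow> smooth_on S' (F h) \<and> (\<forall>v\<in>S'. F h v = c *s F f v + F g v))"

lemma local_linearI:
  fixes F :: "('v::euclidean_space \<Rightarrow> complex^'r::finite) \<Rightarrow> 'v \<Rightarrow> complex^'r"
  assumes "\<And>S' f g h c. \<lbrakk>open S'; S' \<subseteq> S; smooth_on S' f; smooth_on S' g; smooth_on S' h; \<forall>v\<in>S'. h v = c *s f v + g v\<rbrakk>
    \<Longrightarrow> smooth_on S' (F h) \<and> (\<forall>v\<in>S'. F h v = c *s F f v + F g v)"
  shows "local_linear S F"
  unfolding local_linear_def
proof (intro allI impI, elim conjE)
  fix S' and f g h :: "'v \<Rightarrow> complex^'r" and c
  assume *: "open S'" "S' \<subseteq> S" "smooth_on S' f" "smooth_on S' g" "\<forall>v\<in>S'. h v = c *s f v + g v"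
  have "smooth_on S' h"
    by (rule smooth_on_cong[OF smooth_on_add[OF smooth_on_vector_scale[OF smooth_on_const[of _ c] *(3)] *(4)]])
      (use *(5) in simp)
  then show "smooth_on S' (F h) \<and> (\<forall>v\<in>S'. F h v = c *s F f v + F g v)" using assms * by blast
qed

lemma local_linearD:
  assumes "local_linear S F" "open S'" "S' \<subseteq> S" "smooth_on S' f" "smooth_on S' g"
    "\<And>v. v \<in> S' \<Longrightarrow> h v = c *s f v + g v"
  shows "smooth_on S' (F h)" "\<And>v. v \<in> S' \<Longrightarrow> F h v = c *s F f v + F g v"
  using assms unfolding local_linear_def by blast+

lemma local_linear_smooth: "\<lbrakk>local_linear S F; open S'; S' \<subseteq> S; smooth_on S' f\<rbrakk> \<Longrightarrow> smooth_on S' (F f)"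
  using local_linearD(1)[of S F S' f f f 0] by simp

lemma local_linear_cong:
  "\<lbrakk>local_linear S F; open S'; S' \<subseteq> S; smooth_on S' f; \<And>v. v \<in> S' \<Longrightarrow> f v = g v; v \<in> S'\<rbrakk> \<Longrightarrow> F f v = F g v"
  using local_linearD(2)[of S F S' f f g 0] by simp

text \<open>Where \<open>f\<close> vanishes it satisfies \<open>f = 1 *s f + f\<close>, and
  linearity on that open set alone gives F f = F f + F f. This is the statement that
  \<open>F\<close> does not enlarge supports.\<close>

lemma local_linear_zero:
  assumes "local_linear S F" "open S'" "S' \<subseteq> S" "\<And>v. v \<in> S' \<Longrightarrow> f v = 0" "v \<in> S'"
  shows "F f v = 0"
proof -
  have "smooth_on S' f" by (rule smooth_on_cong[OF smooth_on_const[of _ 0]]) (use assms(4) in simp)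
  from local_linearD(2)[OF assms(1-3) this this, of f 1] have "F f v = 1 *s F f v + F f v"
    using assms(4,5) by simp
  then show ?thesis by simp
qed

lemma local_linear_comp:
  fixes F F' :: "('v::euclidean_space \<Rightarrow> complex^'r::finite) \<Rightarrow> 'v \<Rightarrow> complex^'r"
  assumes F: "local_linear S F" and F': "local_linear S F'"
  shows "local_linear S (\<lambda>f. F (F' f))"
proof (rule local_linearI)
  fix S' and f g h :: "'v \<Rightarrow> complex^'r" and c
  assume *: "open S'" "S' \<subseteq> S" "smooth_on S' f" "smooth_on S' g" "\<forall>v\<in>S'. h v = c *s f v + g v"
  have 1: "smooth_on S' (F' f)" "smooth_on S' (F' g)" using * F' local_linear_smooth by blast+
  have 2: "\<And>v. v \<in> S' \<Longrightarrow> F' h v = c *s F' f v + F' g v" by (rule local_linearD[OF F' *(1-4)]) (use * in auto)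
  show "smooth_on S' (F (F' h)) \<and> (\<forall>v\<in>S'. F (F' h) v = c *s F (F' f) v + F (F' g) v)"
    using local_linearD[OF F *(1,2) 1 2] by blast
qed

lemma local_linear_id: "local_linear S (\<lambda>f. f)"
  by (rule local_linearI) auto

lemma local_linear_funpow: "local_linear S F \<Longrightarrow> local_linear S (F ^^ n)"
  by (induction n) (auto simp: o_def id_def intro: local_linear_comp local_linear_id)

section \<open>Differential operators as local linear operators\<close>

lemma D_dir_eq:
  assumes "f differentiable (at v)"
  shows "D_dir b f v = (- \<i>) *s frechet_derivative f (at v) b"
proof -
  have f: "(f has_derivative frechet_derivative f (at v)) (at (v + 0 *\<^sub>R b))"
    using assms frechet_derivative_works by auto
  have "((\<lambda>s::real. v + s *\<^sub>R b) has_derivative (\<lambda>s. s *\<^sub>R b)) (at 0)"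
    by (auto intro!: derivative_eq_intros)
  from has_derivative_compose[OF this f]
  have "((\<lambda>s::real. f (v + s *\<^sub>R b)) has_vector_derivative frechet_derivative f (at v) b) (at 0)"
    using linear_frechet_derivative[OF assms] by (simp add: has_vector_derivative_def linear_cmul)
  then show ?thesis unfolding D_dir_def by (simp add: vector_derivative_at)
qed

lemma smooth_on_differentiable: "\<lbrakk>open S; smooth_on S f; v \<in> S\<rbrakk> \<Longrightarrow> f differentiable (at v)"
  unfolding smooth_on_def using C_on_Suc_open by blast

lemma local_linear_D_dir: "local_linear S (D_dir b :: ('v::euclidean_space \<Rightarrow> complex^'r::finite) \<Rightarrow> _)"
proof (rule local_linearI)
  fix S' and f g h :: "'v \<Rightarrow> complex^'r" and c
  assume *: "open S'" "smooth_on S' f" "smooth_on S' g" "smooth_on S' h" and eq: "\<forall>v\<in>S'. h v = c *s f v + g v"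
  have "smooth_on S' (\<lambda>v. frechet_derivative h (at v) b)"
    using *(4) C_on_Suc_open[OF *(1), of _ h] by (auto simp: smooth_on_def simp del: C_on.simps)
  from smooth_on_vector_scale[OF smooth_on_const[of _ "- \<i>"] this]
  have "smooth_on S' (D_dir b h)"
    by (rule smooth_on_cong) (simp add: D_dir_eq smooth_on_differentiable[OF *(1,4)])
  moreover have "D_dir b h v = c *s D_dir b f v + D_dir b g v" if v: "v \<in> S'" for v
  proof -
    note d = smooth_on_differentiable[OF *(1) _ v]
    have "((\<lambda>v. c *s f v + g v) has_derivative
        (\<lambda>w. c *s frechet_derivative f (at v) w + frechet_derivative g (at v) w)) (at v)"
      by (rule has_derivative_add[OF bounded_linear.has_derivative[OF
          bounded_bilinear.bounded_linear_right[OF bounded_bilinear_vector_scale]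
          d[OF *(2), unfolded frechet_derivative_works]] d[OF *(3), unfolded frechet_derivative_works]])
    then have "(h has_derivative
        (\<lambda>w. c *s frechet_derivative f (at v) w + frechet_derivative g (at v) w)) (at v)"
      by (rule has_derivative_transform_within_open[OF _ *(1) v]) (simp add: eq)
    from frechet_derivative_at[OF this, symmetric]
    have "frechet_derivative h (at v) b = c *s frechet_derivative f (at v) b + frechet_derivative g (at v) b"
      by simp
    then show ?thesis
      unfolding D_dir_eq[OF d[OF *(4)]] D_dir_eq[OF d[OF *(3)]] D_dir_eq[OF d[OF *(2)]]
      by (simp add: vec_eq_iff algebra_simps)
  qed
  ultimately show "smooth_on S' (D_dir b h) \<and> (\<forall>v\<in>S'. D_dir b h v = c *s D_dir b f v + D_dir b g v)" by blast
qed

lemma local_linear_D_multi: "local_linear S (D_multi \<alpha>)"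
proof -
  have "local_linear S (\<lambda>f. foldr (\<lambda>b g. (D_dir b ^^ \<alpha> b) g) bs f)" for bs
    by (induction bs) (auto intro: local_linear_id local_linear_comp local_linear_funpow local_linear_D_dir)
  then show ?thesis unfolding D_multi_def[abs_def] .
qed

lemma local_linear_sum:
  fixes F :: "'i \<Rightarrow> ('v::euclidean_space \<Rightarrow> complex^'r::finite) \<Rightarrow> 'v \<Rightarrow> complex^'r"
  shows "(\<And>i. i \<in> I \<Longrightarrow> local_linear S (F i)) \<Longrightarrow> local_linear S (\<lambda>f v. \<Sum>i\<in>I. F i f v)"
proof (rule local_linearI)
  fix S' and f g h :: "'v \<Rightarrow> complex^'r" and c
  assume F: "\<And>i. i \<in> I \<Longrightarrow> local_linear S (F i)"
    and *: "open S'" "S' \<subseteq> S" "smooth_on S' f" "smooth_on S' g" "\<forall>v\<in>S'. h v = c *s f v + g v"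
  have h: "smooth_on S' (F i h)" "\<And>v. v \<in> S' \<Longrightarrow> F i h v = c *s F i f v + F i g v" if "i \<in> I" for i
    using local_linearD[OF F[OF that] *(1-4)] *(5) by blast+
  have "smooth_on S' (\<lambda>v. \<Sum>i\<in>I. F i h v)" using h by (intro smooth_on_sum) auto
  moreover have "(\<Sum>i\<in>I. F i h v) = c *s (\<Sum>i\<in>I. F i f v) + (\<Sum>i\<in>I. F i g v)" if "v \<in> S'" for v
    using h(2) that by (simp add: sum.distrib vec.scale_sum_right)
  ultimately show "smooth_on S' (\<lambda>v. \<Sum>i\<in>I. F i h v) \<and>
      (\<forall>v\<in>S'. (\<Sum>i\<in>I. F i h v) = c *s (\<Sum>i\<in>I. F i f v) + (\<Sum>i\<in>I. F i g v))" by blast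
qed

lemma local_linear_matrix_mult: "smooth_on S a \<Longrightarrow> local_linear S (\<lambda>f v. a v *v f v)"
  by (rule local_linearI)
    (auto intro: smooth_on_matrix_vector smooth_on_subset simp: vec.add vec.scale matrix_vector_right_distrib)

lemma local_linear_scaleR: "smooth_on S a \<Longrightarrow> local_linear S (\<lambda>f v. a v *\<^sub>R f v)"
  by (rule local_linearI)
    (auto intro: smooth_on_scaleR smooth_on_subset simp: scaleR_add_right vec_eq_iff algebra_simps)

section \<open>Cone operators on test sections\<close>

locale cone =
  fixes G :: "('p::t2_space, 'v::euclidean_space, 'r::finite) cone_geometry" and m :: nat
  assumes cone: "cone_setting G"
begin

section \<open>Charts, trivialisations and the interior\<close>

lemma cone_unfold:
  "compact (UNIV :: 'p set)" "smooth_atlas (atlas G)" "vector_bundle G" "hermitian_metric G"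
  "boundary_defining G" "b_density G"
  using cone by (auto simp: cone_setting_def)

lemma chart_props:
  assumes "(U, \<phi>) \<in> atlas G"
  shows "open U" "inj_on \<phi> U" "continuous_on U \<phi>" "openin (top_of_set halfspace) (\<phi> ` U)"
    "continuous_on (\<phi> ` U) (inv_into U \<phi>)" "is_chart (U, \<phi>)"
proof -
  show c: "is_chart (U, \<phi>)" using cone_unfold(2) assms by (auto simp: smooth_atlas_def)
  then obtain \<psi> where \<psi>: "homeomorphism U (\<phi> ` U) \<phi> \<psi>" "open U" "openin (top_of_set halfspace) (\<phi> ` U)"
    by (auto simp: is_chart_def)
  then show "open U" "continuous_on U \<phi>" "openin (top_of_set halfspace) (\<phi> ` U)"
    by (auto simp: homeomorphism_def)
  show inj: "inj_on \<phi> U" using \<psi>(1) by (auto simp: homeomorphism_def intro: inj_on_inverseI)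
  have "continuous_on (\<phi> ` U) \<psi>" using \<psi>(1) by (simp add: homeomorphism_def)
  moreover have "\<psi> v = inv_into U \<phi> v" if "v \<in> \<phi> ` U" for v
    using that \<psi>(1) inj by (auto simp: homeomorphism_def)
  ultimately show "continuous_on (\<phi> ` U) (inv_into U \<phi>)" using continuous_on_cong by metis
qed

lemma chart_at: obtains U \<phi> where "(U, \<phi>) \<in> atlas G" "p \<in> U"
  using cone_unfold(2) unfolding smooth_atlas_def by (metis UNIV_I UN_iff prod.collapse)

lemma triv_at: obtains V T where "(V, T) \<in> trivs G" "p \<in> V"
proof -
  have "p \<in> (\<Union>t\<in>trivs G. fst t)" using cone_unfold(3) by (simp add: vector_bundle_def)
  then show thesis using that by auto
qed

lemma triv_props:
  assumes "(V, T) \<in> trivs G"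
  shows "open V" "p \<in> V \<Longrightarrow> invertible (T p)" "p \<in> V \<Longrightarrow> matrix_inv (T p) *v (T p *v w) = w"
    "p \<in> V \<Longrightarrow> T p *v (matrix_inv (T p) *v w) = w"
proof -
  show V: "open V" and inv: "p \<in> V \<Longrightarrow> invertible (T p)" for p
    using cone_unfold(3) assms by (auto simp: vector_bundle_def)
  assume "p \<in> V"
  note i = inv[OF this]
  show "matrix_inv (T p) *v (T p *v w) = w" "T p *v (matrix_inv (T p) *v w) = w"
    using someI_ex[OF i[unfolded invertible_def], folded matrix_inv_def]
    by (simp_all add: matrix_vector_mul_assoc)
qed

lemma continuous_chart_pullback:
  assumes "(U, \<phi>) \<in> atlas G" "W \<subseteq> U" "continuous_on (\<phi> ` W) (f \<circ> inv_into U \<phi>)"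
  shows "continuous_on W f"
proof -
  have "continuous_on W (\<lambda>p. (f \<circ> inv_into U \<phi>) (\<phi> p))"
    using chart_props[OF assms(1)] assms(2,3)
    by (intro continuous_on_compose2[OF assms(3)]) (auto intro: continuous_on_subset)
  then show ?thesis
    by (rule continuous_on_eq) (use assms(2) chart_props(2)[OF assms(1)] in auto)
qed

lemma smooth_fun_continuous:
  assumes "smooth_fun G W f" "open W"
  shows "continuous_on W f"
proof -
  have "continuous_on (U \<inter> W) f" if c: "(U, \<phi>) \<in> atlas G" for U \<phi>
  proof (rule continuous_chart_pullback[OF c])
    have "smooth_on (\<phi> ` (U \<inter> W)) (f \<circ> inv_into U \<phi>)"
      using assms(1) c by (auto simp: smooth_fun_def)
    then show "continuous_on (\<phi> ` (U \<inter> W)) (f \<circ> inv_into U \<phi>)" by (rule smooth_on_continuous)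
  qed simp
  then have "continuous_on (\<Union>c\<in>atlas G. fst c \<inter> W) f"
    using chart_props(1) assms(2) by (intro continuous_on_open_UN) (auto simp: split_beta)
  moreover have "(\<Union>c\<in>atlas G. fst c) = UNIV" using cone_unfold(2) by (simp add: smooth_atlas_def)
  then have "(\<Union>c\<in>atlas G. fst c \<inter> W) = W" by blast
  ultimately show ?thesis by simp
qed

lemma bdf_continuous: "continuous_on UNIV (bdf G)"
  by (rule smooth_fun_continuous) (use cone_unfold(5)[unfolded boundary_defining_def] in blast, simp)

lemma bdf_cases: "p \<in> inter G \<Longrightarrow> 0 < bdf G p" "p \<in> bdry G \<Longrightarrow> bdf G p = 0"
  using cone_unfold(5)[unfolded boundary_defining_def] by blast+

lemma inter_iff: "p \<in> inter G \<longleftrightarrow> 0 < bdf G p"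
  using bdf_cases[of p] by (auto simp: inter_def)

lemma bdf_nonneg: "0 \<le> bdf G p"
  using bdf_cases[of p] by (cases "p \<in> bdry G") (auto simp: inter_def)

lemma open_inter: "open (inter G)"
proof -
  have "inter G = bdf G -` {0<..}" by (auto simp: inter_iff)
  then show ?thesis using bdf_continuous by (simp add: continuous_on_open_vimage)
qed

lemma bdry_eq: "bdry G = - inter G" by (simp add: inter_def)

lemma chart_normal_nonneg: "\<lbrakk>(U, \<phi>) \<in> atlas G; p \<in> U\<rbrakk> \<Longrightarrow> 0 \<le> \<phi> p \<bullet> nrm"
  using openin_imp_subset[OF chart_props(4)] by (force simp: halfspace_def)

lemma chart_normal_pos: "\<lbrakk>(U, \<phi>) \<in> atlas G; p \<in> U; p \<in> inter G\<rbrakk> \<Longrightarrow> 0 < \<phi> p \<bullet> nrm"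
  using chart_normal_nonneg[of U \<phi> p] by (force simp: inter_def bdry_def less_le)

text \<open>Charts are homeomorphisms onto relatively open subsets of the half space, so openness of
  images is at first only relative to it.\<close>

lemma openin_chart_image:
  assumes "(U, \<phi>) \<in> atlas G" "open W" "W \<subseteq> U"
  shows "openin (top_of_set halfspace) (\<phi> ` W)"
proof -
  have "openin (top_of_set U) W" using assms by (simp add: open_subset)
  moreover obtain \<psi> where "homeomorphism U (\<phi> ` U) \<phi> \<psi>"
    using chart_props(6)[OF assms(1)] by (auto simp: is_chart_def)
  ultimately have "openin (top_of_set (\<phi> ` U)) (\<phi> ` W)" by (simp add: homeomorphism_imp_open_map)
  then show ?thesis using chart_props(4)[OF assms(1)] openin_trans by blast
qed

text \<open>Interior points have strictly positive normal coordinate in every chart. An image of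
  interior points that is relatively open in the half space therefore lies in the open half space
  and is open in the model space.\<close>

lemma open_chart_image:
  assumes "(U, \<phi>) \<in> atlas G" "open W" "W \<subseteq> U" "W \<subseteq> inter G"
  shows "open (\<phi> ` W)"
proof -
  obtain X where X: "open X" "\<phi> ` W = halfspace \<inter> X"
    using openin_chart_image[OF assms(1-3)] by (auto simp: openin_open)
  have "\<phi> ` W = {v. 0 < v \<bullet> nrm} \<inter> X"
  proof (intro set_eqI iffI)
    fix v assume "v \<in> \<phi> ` W"
    then obtain p where "p \<in> W" "v = \<phi> p" by blast
    moreover have "v \<in> X" using X(2) \<open>v \<in> \<phi> ` W\<close> by blast
    ultimately show "v \<in> {v. 0 < v \<bullet> nrm} \<inter> X" using chart_normal_pos[OF assms(1)] assms(3,4) by blast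
  next
    fix v assume "v \<in> {v. 0 < v \<bullet> nrm} \<inter> X"
    then show "v \<in> \<phi> ` W" unfolding X(2) by (auto simp: halfspace_def)
  qed
  moreover have "open {v :: 'v. 0 < v \<bullet> nrm}" using open_halfspace_gt[of 0 "nrm :: 'v"] by (simp add: inner_commute)
  ultimately show ?thesis using X(1) by (simp add: open_Int)
qed

lemma inv_into_subset: "\<lbrakk>inj_on \<phi> U; W \<subseteq> U; v \<in> \<phi> ` W\<rbrakk> \<Longrightarrow> inv_into W \<phi> v = inv_into U \<phi> v"
  by (metis f_inv_into_f inv_into_f_f inv_into_into subset_iff)

lemma is_chart_subset:
  assumes "(U, \<phi>) \<in> atlas G" "open W" "W \<subseteq> U"
  shows "is_chart (W, \<phi>)"
proof -
  obtain \<psi> where "homeomorphism U (\<phi> ` U) \<phi> \<psi>"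
    using chart_props(6)[OF assms(1)] by (auto simp: is_chart_def)
  then have "homeomorphism W (\<phi> ` W) \<phi> \<psi>"
    by (rule homeomorphism_of_subsets) (use assms(3) in auto)
  then show ?thesis using openin_chart_image[OF assms] assms(2) by (auto simp: is_chart_def)
qed

lemma atlas_compatible: "\<lbrakk>c \<in> atlas G; d \<in> atlas G\<rbrakk> \<Longrightarrow> compatible c d"
  using cone_unfold(2) by (auto simp: smooth_atlas_def)

text \<open>The coefficients of an operator with respect to \<open>D_multi\<close> are given on
  charts of the maximal atlas inside the interior; cutting down the atlas charts provides enough of
  these.\<close>

lemma inter_chart:
  assumes c: "(U, \<phi>) \<in> atlas G"
  shows "(U \<inter> inter G, \<phi>) \<in> inter_charts G"
proof -
  let ?W = "U \<inter> inter G"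
  have o: "open ?W" using chart_props(1)[OF c] open_inter by auto
  have "compatible (?W, \<phi>) (U', \<phi>')" "compatible (U', \<phi>') (?W, \<phi>)" if d: "(U', \<phi>') \<in> atlas G" for U' \<phi>'
  proof -
    have "smooth_on (\<phi> ` (U \<inter> U')) (\<phi>' \<circ> inv_into U \<phi>)"
      using atlas_compatible[OF c d] by (simp add: compatible_def)
    then have "smooth_on (\<phi> ` (?W \<inter> U')) (\<phi>' \<circ> inv_into U \<phi>)" by (rule smooth_on_subset) auto
    then have "smooth_on (\<phi> ` (?W \<inter> U')) (\<phi>' \<circ> inv_into ?W \<phi>)"
      by (rule smooth_on_cong)
        (use inv_into_subset[OF chart_props(2)[OF c], of ?W] in auto)
    then show "compatible (?W, \<phi>) (U', \<phi>')" by (simp add: compatible_def)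
    have "smooth_on (\<phi>' ` (U' \<inter> U)) (\<phi> \<circ> inv_into U' \<phi>')"
      using atlas_compatible[OF d c] by (simp add: compatible_def)
    then have "smooth_on (\<phi>' ` (U' \<inter> ?W)) (\<phi> \<circ> inv_into U' \<phi>')" by (rule smooth_on_subset) auto
    then show "compatible (U', \<phi>') (?W, \<phi>)" by (simp add: compatible_def)
  qed
  then show ?thesis using is_chart_subset[OF c o] by (auto simp: inter_charts_def charts_def)
qed

lemma open_local_image:
  assumes "(U, \<phi>) \<in> atlas G" "(V, T) \<in> trivs G"
  shows "open (\<phi> ` (U \<inter> V \<inter> inter G))" "closed K \<Longrightarrow> open (\<phi> ` (U \<inter> V \<inter> inter G - K))"
proof -
  have o: "open (U \<inter> V \<inter> inter G)" using chart_props(1)[OF assms(1)] triv_props(1)[OF assms(2)] open_inter by auto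
  then show "open (\<phi> ` (U \<inter> V \<inter> inter G))" by (rule open_chart_image[OF assms(1)]) auto
  assume "closed K"
  with o have "open (U \<inter> V \<inter> inter G - K)" by (rule open_Diff)
  then show "open (\<phi> ` (U \<inter> V \<inter> inter G - K))" by (rule open_chart_image[OF assms(1)]) auto
qed

section \<open>Cone operators act on test sections\<close>

lemma smooth_section_interD:
  assumes "smooth_section G (inter G) u" "(U, \<phi>) \<in> atlas G" "(V, T) \<in> trivs G"
  shows "smooth_on (\<phi> ` (U \<inter> V \<inter> inter G)) (\<lambda>v. T (inv_into U \<phi> v) *v u (inv_into U \<phi> v))"
proof -
  have "smooth_on (\<phi> ` (U \<inter> (V \<inter> inter G))) ((\<lambda>p. T p *v u p) \<circ> inv_into U \<phi>)"
    using assms by (auto simp: smooth_section_def smooth_fun_def)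
  then show ?thesis by (simp add: o_def Int_assoc)
qed

lemma smooth_section_interI:
  assumes "\<And>U \<phi> V T. \<lbrakk>(U, \<phi>) \<in> atlas G; (V, T) \<in> trivs G\<rbrakk> \<Longrightarrow>
    smooth_on (\<phi> ` (U \<inter> V \<inter> inter G)) (\<lambda>v. T (inv_into U \<phi> v) *v u (inv_into U \<phi> v))"
  shows "smooth_section G (inter G) u"
  using assms by (auto simp: smooth_section_def smooth_fun_def o_def Int_assoc)

lemma smooth_section_lincomb:
  assumes "smooth_section G (inter G) u" "smooth_section G (inter G) w"
  shows "smooth_section G (inter G) (\<lambda>p. c *s u p + w p)"
proof (rule smooth_section_interI)
  fix U \<phi> V T assume *: "(U, \<phi>) \<in> atlas G" "(V, T) \<in> trivs G"
  have "smooth_on (\<phi> ` (U \<inter> V \<inter> inter G))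
     (\<lambda>v. c *s (T (inv_into U \<phi> v) *v u (inv_into U \<phi> v)) + T (inv_into U \<phi> v) *v w (inv_into U \<phi> v))"
    using assms * by (intro smooth_on_add smooth_on_vector_scale smooth_on_const smooth_section_interD)
  then show "smooth_on (\<phi> ` (U \<inter> V \<inter> inter G))
      (\<lambda>v. T (inv_into U \<phi> v) *v (c *s u (inv_into U \<phi> v) + w (inv_into U \<phi> v)))"
    by (simp add: matrix_vector_right_distrib vec.scale)
qed

text \<open>In the interior the operator is a smooth factor times a sum of coefficient matrices
  applied to derivatives, since the boundary defining function is positive there. Only locality,
  linearity and preservation of smoothness are kept of it; the next lemmas use nothing else.\<close>

lemma cone_op_local:
  assumes P: "P \<in> Diff_b G m" and c: "(U, \<phi>) \<in> atlas G" and t: "(V, T) \<in> trivs G"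
  obtains F where "local_linear (\<phi> ` (U \<inter> V \<inter> inter G)) F"
    "\<And>u v. \<lbrakk>smooth_section G (inter G) u; v \<in> \<phi> ` (U \<inter> V \<inter> inter G)\<rbrakk> \<Longrightarrow>
      T (inv_into U \<phi> v) *v cone_op G m P u (inv_into U \<phi> v)
        = F (\<lambda>v. T (inv_into U \<phi> v) *v u (inv_into U \<phi> v)) v"
proof -
  let ?W = "U \<inter> inter G" and ?S = "\<phi> ` (U \<inter> V \<inter> inter G)"
  note ch = chart_props[OF c]
  have S: "\<phi> ` (?W \<inter> V) = ?S" by (rule arg_cong[of _ _ "\<lambda>X. \<phi> ` X"]) auto
  have o: "open ?S" by (rule open_local_image(1)[OF c t])
  obtain a where a: "local_coeffs G m D_multi P (?W, \<phi>) (V, T) a"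
    using P inter_chart[OF c] t unfolding Diff_b_def by blast
  define x where "x v = inverse (bdf G (inv_into U \<phi> v) ^ m)" for v
  define F where "F f v = x v *\<^sub>R (\<Sum>\<alpha>\<in>multi_indices m. a \<alpha> v *v D_multi \<alpha> f v)" for f v
  have x: "smooth_on ?S x"
  proof -
    have "smooth_on (\<phi> ` (U \<inter> UNIV)) (bdf G \<circ> inv_into U \<phi>)"
      using cone_unfold(5) c by (auto simp: boundary_defining_def smooth_fun_def)
    then have x: "smooth_on ?S (\<lambda>v. bdf G (inv_into U \<phi> v))"
      unfolding o_def by (rule smooth_on_subset) auto
    show ?thesis unfolding x_def[abs_def]
      by (intro smooth_on_inverse smooth_on_power x) (use inter_iff ch(2) in auto)
  qed
  have "smooth_on ?S (a \<alpha>)" if "\<alpha> \<in> multi_indices m" for \<alpha>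
    using a that by (auto simp: local_coeffs_def S)
  then have F: "local_linear ?S F" unfolding F_def[abs_def]
    by (intro local_linear_comp[OF local_linear_scaleR[OF x]] local_linear_sum
        local_linear_comp[OF local_linear_matrix_mult] local_linear_D_multi)
  have "T (inv_into U \<phi> v) *v cone_op G m P u (inv_into U \<phi> v)
        = F (\<lambda>v. T (inv_into U \<phi> v) *v u (inv_into U \<phi> v)) v"
    if u: "smooth_section G (inter G) u" and v: "v \<in> ?S" for u v
  proof -
    have inv: "inv_into ?W \<phi> w = inv_into U \<phi> w" if "w \<in> ?S" for w
      using that by (intro inv_into_subset[OF ch(2)]) auto
    obtain p where p: "p \<in> U" "p \<in> V" "p \<in> inter G" "v = \<phi> p" using v by auto
    have ip: "inv_into U \<phi> v = p" using p ch(2) by simp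
    have "0 < v \<bullet> nrm" using chart_normal_pos[OF c p(1,3)] p(4) by simp
    then have "local_rep (?W, \<phi>) (V, T) (P u) v
        = (\<Sum>\<alpha>\<in>multi_indices m. a \<alpha> v *v D_multi \<alpha> (local_rep (?W, \<phi>) (V, T) u) v)"
      by (rule conjunct2[OF a[unfolded local_coeffs_def fst_conv snd_conv S], rule_format, OF u v])
    moreover have "T p *v cone_op G m P u p = x v *\<^sub>R (T p *v P u p)"
      using p(3) by (simp add: cone_op_def x_def ip scaleR_matrix_vector_assoc vec_eq_iff
          matrix_vector_mult_def scaleR_sum_right)
    ultimately have "T p *v cone_op G m P u p = F (local_rep (?W, \<phi>) (V, T) u) v"
      using inv[OF v] by (simp add: local_rep_def F_def ip)
    \<comment> \<open>\<open>local_rep\<close> inverts the restricted chart, the formula on the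
      right the full one. The two agree on the open set \<open>?S\<close> only, which suffices by
      locality.\<close>
    also have "\<dots> = F (\<lambda>v. T (inv_into U \<phi> v) *v u (inv_into U \<phi> v)) v"
    proof (rule local_linear_cong[OF F o order_refl _ _ v, symmetric])
      show "smooth_on ?S (\<lambda>v. T (inv_into U \<phi> v) *v u (inv_into U \<phi> v))"
        by (rule smooth_section_interD[OF u c t])
    qed (simp add: local_rep_def inv)
    finally show ?thesis by (simp add: ip)
  qed
  with F show ?thesis by (rule that)
qed

lemma cone_op_smooth:
  assumes "P \<in> Diff_b G m" "smooth_section G (inter G) u"
  shows "smooth_section G (inter G) (cone_op G m P u)"
proof (rule smooth_section_interI)
  fix U \<phi> V T assume c: "(U, \<phi>) \<in> atlas G" and t: "(V, T) \<in> trivs G"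
  let ?S = "\<phi> ` (U \<inter> V \<inter> inter G)"
  obtain F where F: "local_linear ?S F"
    "\<And>v. v \<in> ?S \<Longrightarrow> T (inv_into U \<phi> v) *v cone_op G m P u (inv_into U \<phi> v)
        = F (\<lambda>v. T (inv_into U \<phi> v) *v u (inv_into U \<phi> v)) v"
    by (rule cone_op_local[OF assms(1) c t]) (use assms(2) in blast)
  have "open ?S" by (rule open_local_image(1)[OF c t])
  then have "smooth_on ?S (F (\<lambda>v. T (inv_into U \<phi> v) *v u (inv_into U \<phi> v)))"
    by (rule local_linear_smooth[OF F(1) _ order_refl smooth_section_interD[OF assms(2) c t]])
  then show "smooth_on ?S (\<lambda>v. T (inv_into U \<phi> v) *v cone_op G m P u (inv_into U \<phi> v))"
    by (rule smooth_on_cong) (simp add: F(2))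
qed

lemma triv_inject: "\<lbrakk>(V, T) \<in> trivs G; p \<in> V; T p *v a = T p *v b\<rbrakk> \<Longrightarrow> a = b"
  by (metis triv_props(3))

lemma cone_op_linear:
  assumes P: "P \<in> Diff_b G m" and u: "smooth_section G (inter G) u" and w: "smooth_section G (inter G) w"
  shows "cone_op G m P (\<lambda>p. c *s u p + w p) = (\<lambda>p. c *s cone_op G m P u p + cone_op G m P w p)"
proof
  fix p
  show "cone_op G m P (\<lambda>p. c *s u p + w p) p = c *s cone_op G m P u p + cone_op G m P w p"
  proof (cases "p \<in> inter G")
    case True
    obtain U \<phi> where ch: "(U, \<phi>) \<in> atlas G" "p \<in> U" by (rule chart_at)
    obtain V T where t: "(V, T) \<in> trivs G" "p \<in> V" by (rule triv_at)
    let ?S = "\<phi> ` (U \<inter> V \<inter> inter G)"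
    obtain F where F: "local_linear ?S F"
      "\<And>u v. \<lbrakk>smooth_section G (inter G) u; v \<in> ?S\<rbrakk> \<Longrightarrow>
        T (inv_into U \<phi> v) *v cone_op G m P u (inv_into U \<phi> v)
          = F (\<lambda>v. T (inv_into U \<phi> v) *v u (inv_into U \<phi> v)) v"
      using cone_op_local[OF P ch(1) t(1)] by blast
    have o: "open ?S" by (rule open_local_image(1)[OF ch(1) t(1)])
    have v: "\<phi> p \<in> ?S" using ch t True by auto
    have ip: "inv_into U \<phi> (\<phi> p) = p" using ch chart_props(2) by simp
    have "T p *v cone_op G m P (\<lambda>p. c *s u p + w p) p
      = F (\<lambda>v. T (inv_into U \<phi> v) *v (c *s u (inv_into U \<phi> v) + w (inv_into U \<phi> v))) (\<phi> p)"
      using F(2)[OF smooth_section_lincomb[OF u w] v] by (simp add: ip)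
    also have "\<dots> = c *s F (\<lambda>v. T (inv_into U \<phi> v) *v u (inv_into U \<phi> v)) (\<phi> p)
        + F (\<lambda>v. T (inv_into U \<phi> v) *v w (inv_into U \<phi> v)) (\<phi> p)"
      by (rule local_linearD(2)[OF F(1) o order_refl smooth_section_interD[OF u ch(1) t(1)]
            smooth_section_interD[OF w ch(1) t(1)] _ v])
        (simp add: matrix_vector_right_distrib vec.scale)
    also have "\<dots> = T p *v (c *s cone_op G m P u p + cone_op G m P w p)"
      using F(2)[OF u v] F(2)[OF w v] by (simp add: ip matrix_vector_right_distrib vec.scale)
    finally show ?thesis by (rule triv_inject[OF t])
  qed (simp add: cone_op_def)
qed

lemma cone_op_support:
  assumes P: "P \<in> Diff_b G m" and u: "smooth_section G (inter G) u"
    and K: "closed K" "\<And>p. p \<notin> K \<Longrightarrow> u p = 0" and p: "p \<notin> K"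
  shows "cone_op G m P u p = 0"
proof (cases "p \<in> inter G")
  case True
  obtain U \<phi> where ch: "(U, \<phi>) \<in> atlas G" "p \<in> U" by (rule chart_at)
  obtain V T where t: "(V, T) \<in> trivs G" "p \<in> V" by (rule triv_at)
  let ?S = "\<phi> ` (U \<inter> V \<inter> inter G)" and ?S' = "\<phi> ` (U \<inter> V \<inter> inter G - K)"
  obtain F where F: "local_linear ?S F"
    "\<And>v. v \<in> ?S \<Longrightarrow> T (inv_into U \<phi> v) *v cone_op G m P u (inv_into U \<phi> v)
          = F (\<lambda>v. T (inv_into U \<phi> v) *v u (inv_into U \<phi> v)) v"
    by (rule cone_op_local[OF P ch(1) t(1)]) (use u in blast)
  have o: "open ?S'" by (rule open_local_image(2)[OF ch(1) t(1) K(1)])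
  have v: "\<phi> p \<in> ?S" "\<phi> p \<in> ?S'" using ch t True p by auto
  have ip: "inv_into U \<phi> (\<phi> q) = q" if "q \<in> U" for q using that ch chart_props(2) by simp
  have "T p *v cone_op G m P u p = F (\<lambda>v. T (inv_into U \<phi> v) *v u (inv_into U \<phi> v)) (\<phi> p)"
    using F(2)[OF v(1)] ch by (simp add: ip)
  also have "\<dots> = 0" by (rule local_linear_zero[OF F(1) o _ _ v(2)]) (auto simp: ip K)
  finally have "T p *v cone_op G m P u p = T p *v 0" by simp
  then show ?thesis by (rule triv_inject[OF t])
qed (simp add: cone_op_def)

lemma cone_op_test:
  assumes "P \<in> Diff_b G m" "u \<in> test_sections G"
  shows "cone_op G m P u \<in> test_sections G"
proof -
  obtain K where K: "smooth_section G (inter G) u" "compact K" "K \<subseteq> inter G" "\<And>p. p \<notin> K \<Longrightarrow> u p = 0"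
    using assms(2) by (auto simp: test_sections_def)
  then show ?thesis using cone_op_smooth[OF assms(1) K(1)]
      cone_op_support[OF assms(1) K(1) compact_imp_closed[OF K(2)]]
    by (auto simp: test_sections_def)
qed

lemma test_lincomb:
  assumes "u \<in> test_sections G" "w \<in> test_sections G"
  shows "(\<lambda>p. c *s u p + w p) \<in> test_sections G"
proof -
  obtain K L where K: "smooth_section G (inter G) u" "compact K" "K \<subseteq> inter G" "\<And>p. p \<notin> K \<Longrightarrow> u p = 0"
    and L: "smooth_section G (inter G) w" "compact L" "L \<subseteq> inter G" "\<And>p. p \<notin> L \<Longrightarrow> w p = 0"
    using assms by (auto simp: test_sections_def)
  have "compact (K \<union> L)" "K \<union> L \<subseteq> inter G" "\<And>p. p \<notin> K \<union> L \<Longrightarrow> c *s u p + w p = 0"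
    using K L by (auto simp: compact_Un)
  then show ?thesis using smooth_section_lincomb[OF K(1) L(1)] unfolding test_sections_def by blast
qed

lemma zero_test: "(\<lambda>p. 0) \<in> test_sections G"
  by (auto simp: test_sections_def smooth_section_def smooth_fun_def o_def smooth_on_const intro: exI[of _ "{}"])

end

section \<open>The Hilbert space of sections\<close>

context cone
begin

section \<open>The measure of the boundary and of compact subsets of the interior\<close>

lemma sets_dens [simp, measurable_cong]: "sets (dens G) = sets borel"
  using cone_unfold(6) by (simp add: b_density_def)

lemma space_dens [simp]: "space (dens G) = UNIV"
  using sets_eq_imp_space_eq[OF sets_dens] by simp

text \<open>A boundary point is a minimum of the boundary defining function, whose differential does not
  vanish there; hence it lies on the boundary of the half space in every chart.\<close>

lemma chart_bdry_normal:
  assumes c: "(U, \<phi>) \<in> atlas G" and p: "p \<in> U" "p \<in> bdry G"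
  shows "\<phi> p \<bullet> nrm = 0"
proof (rule ccontr)
  assume "\<phi> p \<bullet> nrm \<noteq> 0"
  then have pos: "0 < \<phi> p \<bullet> nrm" using chart_normal_nonneg[OF c p(1)] by simp
  obtain X where X: "open X" "\<phi> ` U = halfspace \<inter> X"
    using chart_props(4)[OF c] by (auto simp: openin_open)
  define S where "S = {v :: 'v. 0 < v \<bullet> nrm} \<inter> X"
  have S: "open S" "S \<subseteq> \<phi> ` U" "\<phi> p \<in> S"
  proof -
    show "open S" unfolding S_def using X(1) open_halfspace_gt[of 0 "nrm :: 'v"] by (auto simp: inner_commute)
    show "S \<subseteq> \<phi> ` U" unfolding X(2) S_def halfspace_def by auto
    have "\<phi> p \<in> X" using p(1) X(2) by blast
    then show "\<phi> p \<in> S" using pos by (simp add: S_def)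
  qed
  obtain L where L: "(bdf G \<circ> inv_into U \<phi> has_derivative L) (at (\<phi> p) within \<phi> ` U)" "L \<noteq> (\<lambda>_. 0)"
    using cone_unfold(5) c p unfolding boundary_defining_def by blast
  have "(bdf G \<circ> inv_into U \<phi> has_derivative L) (at (\<phi> p))"
    using has_derivative_subset[OF L(1) S(2)] at_within_open[OF S(3,1)] by simp
  moreover have "\<forall>y\<in>S. (bdf G \<circ> inv_into U \<phi>) (\<phi> p) \<le> (bdf G \<circ> inv_into U \<phi>) y"
    using bdf_nonneg bdf_cases(2)[OF p(2)] p(1) chart_props(2)[OF c] by simp
  ultimately have "L = (\<lambda>_. 0)" using differential_zero_maxmin[OF S(3,1)] by blast
  with L(2) show False by simp
qed

lemma bdry_null: "AE p in dens G. p \<in> inter G"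
proof -
  have "compact (UNIV :: 'p set)" "\<And>c. c \<in> atlas G \<Longrightarrow> open (fst c)" "UNIV \<subseteq> (\<Union>c\<in>atlas G. fst c)"
    using cone_unfold(1,2) chart_props(1) by (auto simp: smooth_atlas_def)
  then obtain C where C: "C \<subseteq> atlas G" "finite C" "UNIV \<subseteq> (\<Union>c\<in>C. fst c)" by (rule compactE_image)
  have "emeasure (dens G) (U \<inter> bdry G) = 0" if c: "(U, \<phi>) \<in> atlas G" for U \<phi>
  proof -
    obtain \<rho> where \<rho>: "b_density_in G (U, \<phi>) \<rho>" using cone_unfold(6) c unfolding b_density_def by blast
    have "U \<inter> bdry G \<in> sets borel" using chart_props(1)[OF c] open_inter by (simp add: bdry_eq)
    then have "emeasure (dens G) (U \<inter> bdry G)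
        = (\<integral>\<^sup>+v. ennreal (\<rho> v / (v \<bullet> nrm)) * indicator (\<phi> ` (U \<inter> bdry G)) v \<partial>lborel)"
      using \<rho> by (simp add: b_density_in_def)
    \<comment> \<open>On the boundary the normal coordinate is 0, so the quotient in the integrand
      is a division by zero and has the value 0.\<close>
    also have "\<dots> = (\<integral>\<^sup>+v. 0 \<partial>(lborel :: 'v measure))"
      using chart_bdry_normal[OF c] by (intro nn_integral_cong) (auto simp: indicator_def)
    finally show ?thesis by simp
  qed
  moreover have "U \<inter> bdry G \<in> sets borel" if c: "(U, \<phi>) \<in> atlas G" for U \<phi>
    using chart_props(1)[OF c] open_inter by (simp add: bdry_eq)
  ultimately have "fst c \<inter> bdry G \<in> null_sets (dens G)" if "c \<in> C" for c
    using C(1) that by (cases c) (auto simp: null_sets_def)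
  then have "(\<Union>c\<in>C. fst c \<inter> bdry G) \<in> null_sets (dens G)" using C(2) by (intro null_sets.finite_UN) auto
  then have "AE p in dens G. p \<notin> (\<Union>c\<in>C. fst c \<inter> bdry G)" by (rule AE_not_in)
  then show ?thesis by (rule eventually_mono) (use C(3) in \<open>auto simp: bdry_eq\<close>)
qed

text \<open>The density blows up only at the boundary: on a closed ball inside the chart image of
  the interior its coefficient is continuous and so bounded.\<close>

lemma finite_dens_nbhd:
  assumes p: "p \<in> inter G"
  obtains W where "open W" "p \<in> W" "emeasure (dens G) W < \<infinity>"
proof -
  obtain U \<phi> where c: "(U, \<phi>) \<in> atlas G" "p \<in> U" by (rule chart_at)
  obtain \<rho> where \<rho>: "b_density_in G (U, \<phi>) \<rho>" using cone_unfold(6) c unfolding b_density_def by blast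
  let ?W = "U \<inter> inter G"
  note ch = chart_props[OF c(1)]
  have W: "open ?W" using ch(1) open_inter by auto
  have S: "open (\<phi> ` ?W)" by (rule open_chart_image[OF c(1) W]) auto
  obtain r where r: "r > 0" "cball (\<phi> p) r \<subseteq> \<phi> ` ?W"
    using open_contains_cball[THEN iffD1, OF S] c(2) p by blast
  define O' where "O' = ?W \<inter> \<phi> -` ball (\<phi> p) r"
  have O': "open O'" unfolding O'_def
    using continuous_open_preimage[OF continuous_on_subset[OF ch(3)] W open_ball] by auto
  have "continuous_on (cball (\<phi> p) r) (\<lambda>v. \<rho> v / (v \<bullet> nrm))"
  proof (intro continuous_on_divide continuous_intros ballI)
    show "continuous_on (cball (\<phi> p) r) \<rho>"
      by (rule continuous_on_subset[OF smooth_on_continuous[of "\<phi> ` U"]])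
        (use \<rho> r(2) in \<open>auto simp: b_density_in_def\<close>)
    show "v \<bullet> nrm \<noteq> 0" if "v \<in> cball (\<phi> p) r" for v
      using that r(2) chart_normal_pos[OF c(1)] by force
  qed
  from compact_imp_bounded[OF compact_continuous_image[OF this compact_cball]]
  have "bounded ((\<lambda>v. \<rho> v / (v \<bullet> nrm)) ` cball (\<phi> p) r)" .
  then obtain B where "B > 0" and le: "\<forall>y\<in>(\<lambda>v. \<rho> v / (v \<bullet> nrm)) ` cball (\<phi> p) r. norm y \<le> B"
    unfolding bounded_pos by blast
  have B: "\<rho> v / (v \<bullet> nrm) \<le> B" if "v \<in> cball (\<phi> p) r" for v
    using bspec[OF le imageI[OF that]] by (simp only: real_norm_def abs_le_iff)
  have "emeasure (dens G) O' = (\<integral>\<^sup>+v. ennreal (\<rho> v / (v \<bullet> nrm)) * indicator (\<phi> ` O') v \<partial>lborel)"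
  proof -
    have "O' \<in> sets borel" "O' \<subseteq> U" using O' by (auto simp: O'_def)
    then show ?thesis using \<rho>[unfolded b_density_in_def prod.case] by blast
  qed
  also have "\<dots> \<le> (\<integral>\<^sup>+v. ennreal B * indicator (cball (\<phi> p) r) v \<partial>lborel)"
  proof (rule nn_integral_mono)
    fix v
    show "ennreal (\<rho> v / (v \<bullet> nrm)) * indicator (\<phi> ` O') v \<le> ennreal B * indicator (cball (\<phi> p) r) v"
      using B[of v] by (auto simp: indicator_def O'_def intro!: ennreal_leI)
  qed
  also have "\<dots> < \<infinity>"
    using emeasure_bounded_finite[OF bounded_cball, of "\<phi> p" r]
    by (simp add: nn_integral_cmult_indicator ennreal_mult_less_top)
  finally show ?thesis using that[of O'] O' c(2) p r(1) by (auto simp: O'_def)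
qed

lemma emeasure_lt_top_compact:
  assumes "compact K" "K \<subseteq> inter G"
  shows "emeasure (dens G) K < \<infinity>"
proof -
  let ?\<O> = "{W. open W \<and> emeasure (dens G) W < \<infinity>}"
  have "K \<subseteq> \<Union>?\<O>"
  proof
    fix p assume "p \<in> K"
    then obtain W where "open W" "p \<in> W" "emeasure (dens G) W < \<infinity>" using finite_dens_nbhd assms(2) by blast
    then show "p \<in> \<Union>?\<O>" by blast
  qed
  then obtain C where C: "C \<subseteq> ?\<O>" "finite C" "K \<subseteq> \<Union>C" using compactE[OF assms(1)] by (metis (no_types, lifting) mem_Collect_eq)
  have "emeasure (dens G) K \<le> emeasure (dens G) (\<Union>C)"
    using C by (intro emeasure_mono) (auto intro!: borel_open)
  also have "\<Union>C = (\<Union>W\<in>C. W)" by simp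
  also have "emeasure (dens G) (\<Union>W\<in>C. W) \<le> (\<Sum>W\<in>C. emeasure (dens G) W)"
    using C by (intro emeasure_subadditive_finite) (auto intro!: borel_open)
  also have "\<dots> < \<infinity>" using C by (auto simp: subset_iff)
  finally show ?thesis .
qed

section \<open>The Hermitian form on fibres and in frames\<close>

lemma herm_axioms:
  "herm G p (a *s u + v) w = a * herm G p u w + herm G p v w"
  "herm G p v u = cnj (herm G p u v)"
  "u \<noteq> 0 \<Longrightarrow> 0 < Re (herm G p u u)"
  using cone_unfold(4) unfolding hermitian_metric_def by blast+

lemma herm_simps:
  "herm G p 0 w = 0" "herm G p w 0 = 0"
  "herm G p (u + v) w = herm G p u w + herm G p v w"
  "herm G p (a *s u) w = a * herm G p u w"
  "herm G p w (u + v) = herm G p w u + herm G p w v"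
  "herm G p w (a *s u) = cnj a * herm G p w u"
proof -
  show z: "herm G p 0 w = 0" for w using herm_axioms(1)[of p 1 0 0 w] by simp
  then show "herm G p w 0 = 0" using herm_axioms(2)[of p w 0] by simp
  show a: "herm G p (u + v) w = herm G p u w + herm G p v w" for u v w
    using herm_axioms(1)[of p 1 u v w] by simp
  show s: "herm G p (a *s u) w = a * herm G p u w" for a u w
    using herm_axioms(1)[of p a u 0 w] z by simp
  show "herm G p w (u + v) = herm G p w u + herm G p w v"
    using herm_axioms(2)[of p w] a by simp
  show "herm G p w (a *s u) = cnj a * herm G p w u"
    using herm_axioms(2)[of p w] s by simp
qed

lemma herm_minus: "herm G p (- u) w = - herm G p u w" "herm G p w (- u) = - herm G p w u"
  using herm_simps(4)[of p "-1" u w] herm_simps(6)[of p w "-1" u] by simp_all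

lemma herm_diff: "herm G p (u - v) w = herm G p u w - herm G p v w"
  "herm G p w (u - v) = herm G p w u - herm G p w v"
  using herm_simps(3)[of p u "- v" w] herm_simps(5)[of p w u "- v"] by (simp_all add: herm_minus)

lemma herm_sum: "herm G p (\<Sum>i\<in>I. f i) w = (\<Sum>i\<in>I. herm G p (f i) w)"
  "herm G p w (\<Sum>i\<in>I. f i) = (\<Sum>i\<in>I. herm G p w (f i))"
  by (induction I rule: infinite_finite_induct) (simp_all add: herm_simps)

definition hs :: "'p \<Rightarrow> complex^'r \<Rightarrow> real" where
  "hs p a = Re (herm G p a a)"

lemma hs_nonneg: "0 \<le> hs p a"
  using herm_axioms(3)[of a p] by (cases "a = 0") (auto simp: hs_def herm_simps)

lemma hs_eq_0_iff: "hs p a = 0 \<longleftrightarrow> a = 0"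
  using herm_axioms(3)[of a p] by (cases "a = 0") (auto simp: hs_def herm_simps)

lemma hs_scale: "hs p (c *s a) = (cmod c)\<^sup>2 * hs p a"
proof -
  have "herm G p (c *s a) (c *s a) = (c * cnj c) * herm G p a a" by (simp add: herm_simps)
  then have "herm G p (c *s a) (c *s a) = of_real ((cmod c)\<^sup>2) * herm G p a a"
    by (simp only: complex_norm_square[symmetric] of_real_power)
  then show ?thesis by (simp add: hs_def)
qed

lemma hs_parallelogram: "hs p (a + b) + hs p (a - b) = 2 * hs p a + 2 * hs p b"
  by (simp add: hs_def herm_simps herm_diff)

lemma hs_add_le: "hs p (a + b) \<le> 2 * hs p a + 2 * hs p b"
  using hs_parallelogram[of p a b] hs_nonneg[of p "a - b"] by linarith

text \<open>\<open>hs\<close> is nonnegative at \<open>a - z *s b\<close>. A sum on the right,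
  instead of the product of Cauchy-Schwarz, is integrable at once when both sections are in
  \<open>L2\<close>.\<close>

lemma herm_le: "cmod (herm G p a b) \<le> hs p a + hs p b"
proof (cases "herm G p a b = 0")
  case True
  then show ?thesis using hs_nonneg[of p a] hs_nonneg[of p b] by simp
next
  case False
  \<comment> \<open>The phase of the product: multiplying \<open>b\<close> by \<open>z\<close> makes
    the cross term real and equal to the modulus.\<close>
  define z where "z = sgn (herm G p a b)"
  have z: "cmod z = 1" "cnj z * herm G p a b = of_real (cmod (herm G p a b))"
  proof -
    show "cmod z = 1" using False by (simp add: z_def norm_sgn)
    have "herm G p a b = of_real (cmod (herm G p a b)) * z"
      by (simp add: z_def sgn_div_norm scaleR_conv_of_real False)
    moreover have "cnj z * z = 1" using \<open>cmod z = 1\<close> complex_norm_square[of z] by (simp add: mult.commute)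
    ultimately show "cnj z * herm G p a b = of_real (cmod (herm G p a b))"
      by (metis mult.left_commute mult.right_neutral)
  qed
  have 1: "herm G p a (z *s b) = of_real (cmod (herm G p a b))" using z(2) by (simp add: herm_simps)
  have 2: "herm G p (z *s b) a = of_real (cmod (herm G p a b))"
    by (subst herm_axioms(2)) (simp only: 1 complex_cnj_complex_of_real)
  have "hs p (a - z *s b) = hs p a - 2 * cmod (herm G p a b) + hs p (z *s b)"
    by (simp add: hs_def herm_diff 1 2)
  then show ?thesis
    using hs_nonneg[of p "a - z *s b"] hs_nonneg[of p a] hs_nonneg[of p b] z(1) by (simp add: hs_scale)
qed

text \<open>Regularity of sections is known only for their coordinates, and that of the metric only
  for its products of frame vectors. This formula transfers measurability and continuity to
  \<open>herm\<close> of two sections.\<close>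

lemma herm_coords:
  assumes "(V, T) \<in> trivs G" "p \<in> V"
  shows "herm G p u w = (\<Sum>i\<in>UNIV. \<Sum>j\<in>UNIV. (T p *v u) $ i * cnj ((T p *v w) $ j) *
    herm G p (matrix_inv (T p) *v axis i 1) (matrix_inv (T p) *v axis j 1))"
proof -
  have exp: "a = (\<Sum>i\<in>UNIV. (T p *v a) $ i *s (matrix_inv (T p) *v axis i 1))" for a
  proof -
    have "a = matrix_inv (T p) *v (\<Sum>i\<in>UNIV. (T p *v a) $ i *s axis i 1)"
      using triv_props(3)[OF assms] by (simp add: basis_expansion)
    also have "\<dots> = (\<Sum>i\<in>UNIV. (T p *v a) $ i *s (matrix_inv (T p) *v axis i 1))"
      by (simp add: vec.linear_sum[OF matrix_vector_mul_linear_gen] vec.scale)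
    finally show ?thesis .
  qed
  have "herm G p u w = herm G p (\<Sum>i\<in>UNIV. (T p *v u) $ i *s (matrix_inv (T p) *v axis i 1))
      (\<Sum>i\<in>UNIV. (T p *v w) $ i *s (matrix_inv (T p) *v axis i 1))"
    using exp by metis
  also have "\<dots> = (\<Sum>j\<in>UNIV. \<Sum>i\<in>UNIV. (T p *v u) $ i * cnj ((T p *v w) $ j) *
      herm G p (matrix_inv (T p) *v axis i 1) (matrix_inv (T p) *v axis j 1))"
    by (simp add: herm_sum herm_simps sum_distrib_left mult_ac)
  finally show ?thesis by (subst sum.swap)
qed

lemma herm_frame_continuous:
  assumes "(V, T) \<in> trivs G"
  shows "continuous_on V (\<lambda>p. herm G p (matrix_inv (T p) *v a) (matrix_inv (T p) *v b))"
proof (rule smooth_fun_continuous)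
  show "smooth_fun G V (\<lambda>p. herm G p (matrix_inv (T p) *v a) (matrix_inv (T p) *v b))"
    using cone_unfold(4) assms unfolding hermitian_metric_def by blast
  show "open V" by (rule triv_props(1)[OF assms])
qed

section \<open>Measurable and square integrable sections\<close>

definition meas :: "('p, 'r) sect \<Rightarrow> bool" where
  "meas u \<longleftrightarrow> (\<forall>(V, T)\<in>trivs G. (\<lambda>p. T p *v u p) \<in> borel_measurable (restrict_space borel V))"

lemma measD: "\<lbrakk>meas u; (V, T) \<in> trivs G\<rbrakk> \<Longrightarrow> (\<lambda>p. T p *v u p) \<in> borel_measurable (restrict_space borel V)"
  by (auto simp: meas_def)

lemma finite_trivs: obtains C where "C \<subseteq> trivs G" "finite C" "UNIV = (\<Union>t\<in>C. fst t)"
proof -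
  have "compact (UNIV :: 'p set)" "\<And>c. c \<in> trivs G \<Longrightarrow> open (fst c)" "UNIV \<subseteq> (\<Union>c\<in>trivs G. fst c)"
    using cone_unfold(1,3) triv_props(1) by (auto simp: vector_bundle_def)
  then obtain C where "C \<subseteq> trivs G" "finite C" "UNIV \<subseteq> (\<Union>c\<in>C. fst c)" by (rule compactE_image)
  then show ?thesis using that by auto
qed

lemma measurable_if_local:
  assumes "\<And>V T. (V, T) \<in> trivs G \<Longrightarrow> f \<in> borel_measurable (restrict_space borel V)"
  shows "f \<in> borel_measurable borel"
proof -
  obtain C where C: "C \<subseteq> trivs G" "finite C" "UNIV = (\<Union>t\<in>C. fst t)" by (rule finite_trivs)
  show ?thesis
  proof (rule measurable_piecewise_restrict[of "fst ` C"])
    show "countable (fst ` C)" using C(2) by (simp add: countable_finite)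
    show "\<Omega> \<inter> space borel \<in> sets borel" if "\<Omega> \<in> fst ` C" for \<Omega>
      using that C(1) triv_props(1) by auto
    show "space borel \<subseteq> \<Union> (fst ` C)" using C(3) by simp
    show "f \<in> borel_measurable (restrict_space borel \<Omega>)" if "\<Omega> \<in> fst ` C" for \<Omega>
      using that C(1) assms by auto
  qed
qed

lemma herm_measurable:
  assumes "meas u" "meas w"
  shows "(\<lambda>p. herm G p (u p) (w p)) \<in> borel_measurable borel"
proof (rule measurable_if_local)
  fix V T assume t: "(V, T) \<in> trivs G"
  have c: "(\<lambda>p. (T p *v u p) $ i) \<in> borel_measurable (restrict_space borel V)" if "meas u" for u i
    using measurable_compose[OF measD[OF that t], of "\<lambda>x. x $ i" borel]
    by (simp add: borel_measurable_continuous_onI continuous_on_component)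
  have h: "(\<lambda>p. herm G p (matrix_inv (T p) *v axis i 1) (matrix_inv (T p) *v axis j 1))
      \<in> borel_measurable (restrict_space borel V)" for i j
    by (rule borel_measurable_continuous_on_restrict[OF herm_frame_continuous[OF t]])
  have cc: "(\<lambda>p. cnj ((T p *v w p) $ j)) \<in> borel_measurable (restrict_space borel V)" for j
    using measurable_compose[OF c[OF assms(2)], of cnj borel]
    by (simp add: borel_measurable_continuous_onI continuous_on_cnj)
  have "(\<lambda>p. \<Sum>i\<in>UNIV. \<Sum>j\<in>UNIV. (T p *v u p) $ i * cnj ((T p *v w p) $ j) *
      herm G p (matrix_inv (T p) *v axis i 1) (matrix_inv (T p) *v axis j 1))
      \<in> borel_measurable (restrict_space borel V)"
    by (intro borel_measurable_sum borel_measurable_times c cc h assms)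
  then show "(\<lambda>p. herm G p (u p) (w p)) \<in> borel_measurable (restrict_space borel V)"
    by (rule measurable_cong[THEN iffD1, rotated])
      (simp add: herm_coords[OF t] space_restrict_space)
qed

lemma meas_lincomb:
  assumes "meas u" "meas w"
  shows "meas (\<lambda>p. c *s u p + w p)"
  unfolding meas_def
proof clarify
  fix V T assume t: "(V, T) \<in> trivs G"
  have "((*s) c :: complex^'r \<Rightarrow> _) \<in> borel_measurable borel"
    by (intro borel_measurable_continuous_onI linear_continuous_on
        bounded_bilinear.bounded_linear_right[OF bounded_bilinear_vector_scale])
  from measurable_compose[OF measD[OF assms(1) t] this]
  have "(\<lambda>p. c *s (T p *v u p)) \<in> borel_measurable (restrict_space borel V)" .
  then have "(\<lambda>p. c *s (T p *v u p) + T p *v w p) \<in> borel_measurable (restrict_space borel V)"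
    using measD[OF assms(2) t] by (rule borel_measurable_add)
  then show "(\<lambda>p. T p *v (c *s u p + w p)) \<in> borel_measurable (restrict_space borel V)"
    by (simp add: matrix_vector_right_distrib vec.scale)
qed

lemma meas_zero: "meas (\<lambda>p. 0)"
  by (auto simp: meas_def)

lemma meas_diff: "\<lbrakk>meas u; meas w\<rbrakk> \<Longrightarrow> meas (\<lambda>p. u p - w p)"
  using meas_lincomb[of w u "-1"] by simp

definition wt :: "('p, 'r) sect \<Rightarrow> 'p \<Rightarrow> real" where
  "wt u p = bdf G p ^ m * hs p (u p)"

lemma wt_nonneg: "0 \<le> wt u p"
  by (simp add: wt_def bdf_nonneg hs_nonneg)

lemma bdf_measurable: "(\<lambda>p. bdf G p ^ m) \<in> borel_measurable borel"
  using bdf_continuous by (intro borel_measurable_continuous_onI continuous_intros)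

lemma wt_measurable:
  assumes "meas u"
  shows "wt u \<in> borel_measurable borel"
proof -
  have "(\<lambda>p. Re (herm G p (u p) (u p))) \<in> borel_measurable borel"
    using herm_measurable[OF assms assms] by simp
  then show ?thesis unfolding wt_def[abs_def] hs_def by (intro borel_measurable_times bdf_measurable)
qed

lemma L2_iff: "u \<in> L2 G m \<longleftrightarrow> meas u \<and> (\<integral>\<^sup>+p. ennreal (wt u p) \<partial>dens G) < \<infinity>"
  by (auto simp: L2_def meas_def wt_def hs_def)

lemma L2_lincomb:
  assumes "u \<in> L2 G m" "w \<in> L2 G m"
  shows "(\<lambda>p. c *s u p + w p) \<in> L2 G m"
proof -
  have m: "meas u" "meas w" using assms by (auto simp: L2_iff)
  have le: "wt (\<lambda>p. c *s u p + w p) p \<le> 2 * (cmod c)\<^sup>2 * wt u p + 2 * wt w p" for p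
    using mult_left_mono[OF hs_add_le[of p "c *s u p" "w p"], of "bdf G p ^ m"] bdf_nonneg
    by (simp add: wt_def hs_scale algebra_simps)
  have "(\<integral>\<^sup>+p. ennreal (wt (\<lambda>p. c *s u p + w p) p) \<partial>dens G)
      \<le> (\<integral>\<^sup>+p. ennreal (2 * (cmod c)\<^sup>2) * ennreal (wt u p) + ennreal 2 * ennreal (wt w p) \<partial>dens G)"
  proof (rule nn_integral_mono)
    fix p
    have "ennreal (wt (\<lambda>p. c *s u p + w p) p) \<le> ennreal (2 * (cmod c)\<^sup>2 * wt u p + 2 * wt w p)"
      by (rule ennreal_leI[OF le])
    also have "\<dots> = ennreal (2 * (cmod c)\<^sup>2) * ennreal (wt u p) + ennreal 2 * ennreal (wt w p)"
      by (subst ennreal_plus) (simp_all only: ennreal_mult wt_nonneg zero_le_power2 zero_le_numeral mult_nonneg_nonneg)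
    finally show "ennreal (wt (\<lambda>p. c *s u p + w p) p)
      \<le> ennreal (2 * (cmod c)\<^sup>2) * ennreal (wt u p) + ennreal 2 * ennreal (wt w p)" .
  qed
  also have "\<dots> = ennreal (2 * (cmod c)\<^sup>2) * (\<integral>\<^sup>+p. ennreal (wt u p) \<partial>dens G) + ennreal 2 * (\<integral>\<^sup>+p. ennreal (wt w p) \<partial>dens G)"
    using wt_measurable m by (simp add: nn_integral_add nn_integral_cmult)
  also have "\<dots> < \<infinity>" using assms by (simp add: L2_iff ennreal_mult_less_top)
  finally show ?thesis using m meas_lincomb by (simp add: L2_iff)
qed

lemma L2_zero: "(\<lambda>p. 0) \<in> L2 G m"
  by (simp add: L2_iff meas_zero wt_def hs_def herm_simps)

lemma L2_diff: "\<lbrakk>u \<in> L2 G m; w \<in> L2 G m\<rbrakk> \<Longrightarrow> (\<lambda>p. u p - w p) \<in> L2 G m"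
  using L2_lincomb[of w u "-1"] by simp

lemma ip_integrable:
  assumes "u \<in> L2 G m" "w \<in> L2 G m"
  shows "integrable (dens G) (\<lambda>p. of_real (bdf G p ^ m) * herm G p (u p) (w p))"
proof (rule integrableI_bounded)
  have m: "meas u" "meas w" using assms by (auto simp: L2_iff)
  have "(\<lambda>p. complex_of_real (bdf G p ^ m)) \<in> borel_measurable borel"
    using bdf_continuous by (intro borel_measurable_continuous_onI continuous_intros)
  then have "(\<lambda>p. of_real (bdf G p ^ m) * herm G p (u p) (w p)) \<in> borel_measurable borel"
    using herm_measurable[OF m] by (rule borel_measurable_times)
  then show "(\<lambda>p. of_real (bdf G p ^ m) * herm G p (u p) (w p)) \<in> borel_measurable (dens G)" by simp
  have "(\<integral>\<^sup>+p. ennreal (norm (of_real (bdf G p ^ m) * herm G p (u p) (w p))) \<partial>dens G)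
      \<le> (\<integral>\<^sup>+p. ennreal (wt u p) + ennreal (wt w p) \<partial>dens G)"
  proof (rule nn_integral_mono)
    fix p
    have "norm (of_real (bdf G p ^ m) * herm G p (u p) (w p)) \<le> wt u p + wt w p"
      using mult_left_mono[OF herm_le[of p "u p" "w p"], of "bdf G p ^ m"] bdf_nonneg[of p]
      by (simp add: norm_mult norm_power wt_def distrib_left)
    then show "ennreal (norm (of_real (bdf G p ^ m) * herm G p (u p) (w p))) \<le> ennreal (wt u p) + ennreal (wt w p)"
      by (simp add: ennreal_plus[symmetric] wt_nonneg ennreal_leI del: ennreal_plus)
  qed
  also have "\<dots> < \<infinity>" using wt_measurable m assms by (simp add: nn_integral_add L2_iff)
  finally show "(\<integral>\<^sup>+p. ennreal (norm (of_real (bdf G p ^ m) * herm G p (u p) (w p))) \<partial>dens G) < \<infinity>" .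
qed

lemma ip_lincomb_left:
  assumes "u \<in> L2 G m" "v \<in> L2 G m" "w \<in> L2 G m"
  shows "ip G m (\<lambda>p. c *s u p + v p) w = c * ip G m u w + ip G m v w"
proof -
  have "ip G m (\<lambda>p. c *s u p + v p) w
      = (\<integral>p. c * (of_real (bdf G p ^ m) * herm G p (u p) (w p)) + of_real (bdf G p ^ m) * herm G p (v p) (w p) \<partial>dens G)"
    unfolding ip_def by (intro Bochner_Integration.integral_cong) (simp_all add: herm_simps algebra_simps)
  also have "\<dots> = c * ip G m u w + ip G m v w"
    unfolding ip_def using ip_integrable assms
    by (subst Bochner_Integration.integral_add) (auto intro: integrable_mult_right)
  finally show ?thesis .
qed

lemma ip_cnj: "ip G m v u = cnj (ip G m u v)"
proof -
  have "ip G m v u = (\<integral>p. cnj (of_real (bdf G p ^ m) * herm G p (u p) (v p)) \<partial>dens G)"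
    unfolding ip_def by (intro Bochner_Integration.integral_cong refl) (simp flip: herm_axioms(2))
  then show ?thesis by (simp only: Bochner_Integration.integral_cnj ip_def)
qed

lemma ip_self_eq:
  assumes "u \<in> L2 G m"
  shows "Re (ip G m u u) = (\<integral>p. wt u p \<partial>dens G)" "integrable (dens G) (wt u)"
proof -
  have eq: "(\<lambda>p. Re (of_real (bdf G p ^ m) * herm G p (u p) (u p))) = wt u"
    by (simp add: fun_eq_iff wt_def hs_def flip: of_real_power)
  show "integrable (dens G) (wt u)"
    using integrable_Re[OF ip_integrable[OF assms assms]] by (simp only: eq)
  show "Re (ip G m u u) = (\<integral>p. wt u p \<partial>dens G)"
    using Bochner_Integration.integral_Re[OF ip_integrable[OF assms assms]] by (simp only: eq ip_def)
qed

lemma nn_integral_wt: "u \<in> L2 G m \<Longrightarrow> (\<integral>\<^sup>+p. ennreal (wt u p) \<partial>dens G) = ennreal (Re (ip G m u u))"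
  using ip_self_eq[of u] by (simp add: nn_integral_eq_integral wt_nonneg)

lemma ip_nonneg: "u \<in> L2 G m \<Longrightarrow> 0 \<le> Re (ip G m u u)"
  by (simp add: ip_self_eq wt_nonneg)

lemma wt_eq_0_iff: "p \<in> inter G \<Longrightarrow> wt u p = 0 \<longleftrightarrow> u p = 0"
  using bdf_cases(1)[of p] by (simp add: wt_def hs_eq_0_iff)

text \<open>The weight is positive in the interior but may vanish on the boundary, so a vanishing
  norm controls a section only in the interior; the boundary is a null set.\<close>

lemma null_sections_iff: "u \<in> null_sections G m \<longleftrightarrow> u \<in> L2 G m \<and> nm G m u = 0"
proof -
  have "nm G m u = 0 \<longleftrightarrow> (AE p in dens G. u p = 0)" if u: "u \<in> L2 G m"
  proof -
    have "nm G m u = 0 \<longleftrightarrow> (\<integral>p. wt u p \<partial>dens G) = 0" by (simp add: nm_def ip_self_eq[OF u])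
    also have "\<dots> \<longleftrightarrow> (AE p in dens G. wt u p = 0)"
      by (rule integral_nonneg_eq_0_iff_AE[OF ip_self_eq(2)[OF u]]) (simp add: wt_nonneg)
    also have "\<dots> \<longleftrightarrow> (AE p in dens G. u p = 0)"
      by (intro eventually_subst eventually_mono[OF bdry_null] wt_eq_0_iff)
    finally show ?thesis .
  qed
  then show ?thesis by (auto simp: null_sections_def)
qed

section \<open>Completeness\<close>

lemma hs_continuous: "continuous_on UNIV (hs p)"
proof -
  obtain V T where t: "(V, T) \<in> trivs G" "p \<in> V" by (rule triv_at)
  have T: "continuous_on UNIV (\<lambda>w. T p *v w)"
    by (intro linear_continuous_on bounded_bilinear.bounded_linear_right[OF bounded_bilinear_matrix_vector])
  have "continuous_on UNIV (\<lambda>w. Re (\<Sum>i\<in>UNIV. \<Sum>j\<in>UNIV. (T p *v w) $ i * cnj ((T p *v w) $ j) *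
    herm G p (matrix_inv (T p) *v axis i 1) (matrix_inv (T p) *v axis j 1)))"
    by (intro continuous_on_Re continuous_on_sum continuous_on_mult continuous_on_cnj
        continuous_on_component T continuous_on_const)
  then show ?thesis unfolding hs_def[abs_def] by (simp only: herm_coords[OF t, symmetric])
qed

lemma of_real_vector_scale: "complex_of_real c *s w = c *\<^sub>R w"
  by (simp only: vec_eq_iff vector_smult_component vector_scaleR_component
      scaleR_conv_of_real[where 'a = complex] simp_thms)

text \<open>\<open>hs p\<close> is homogeneous of degree 2 and attains a positive minimum on the
  unit sphere. The constant depends on \<open>p\<close>, which is enough for convergence at a single
  point.\<close>

lemma hs_norm_bound: obtains C where "C > 0" "\<And>w. (norm w)\<^sup>2 \<le> C * hs p w"
proof -
  have ne: "sphere (0 :: complex^'r) 1 \<noteq> {}" by simp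
  obtain w0 where w0: "w0 \<in> sphere 0 1" "\<And>w. w \<in> sphere 0 1 \<Longrightarrow> hs p w0 \<le> hs p w"
    using continuous_attains_inf[OF compact_sphere ne continuous_on_subset[OF hs_continuous]] by blast
  have pos: "hs p w0 > 0"
    using hs_nonneg[of p w0] hs_eq_0_iff[of p w0] w0(1) by (auto simp: less_le)
  have "(norm w)\<^sup>2 \<le> inverse (hs p w0) * hs p w" for w
  proof (cases "w = 0")
    case False
    have "hs p w0 \<le> hs p (complex_of_real (inverse (norm w)) *s w)"
      using False by (intro w0(2)) (simp only: of_real_vector_scale, simp)
    also have "\<dots> = hs p w / (norm w)\<^sup>2"
      unfolding hs_scale by (simp add: power_inverse divide_inverse norm_inverse)
    finally show ?thesis using pos False by (simp add: field_simps)
  next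
    case True
    then have "hs p w = 0" by (simp only: hs_eq_0_iff)
    then show ?thesis using True by simp
  qed
  then show ?thesis using that[of "inverse (hs p w0)"] pos by simp
qed

lemma nm_power2: "u \<in> L2 G m \<Longrightarrow> (nm G m u)\<^sup>2 = Re (ip G m u u)"
  by (simp add: nm_def ip_nonneg)

lemma nn_integral_wt_nm: "u \<in> L2 G m \<Longrightarrow> (\<integral>\<^sup>+p. ennreal (wt u p) \<partial>dens G) = ennreal ((nm G m u)\<^sup>2)"
  by (simp add: nn_integral_wt nm_power2)

lemma nm_nonneg: "u \<in> L2 G m \<Longrightarrow> 0 \<le> nm G m u"
  by (simp add: nm_def ip_nonneg)

text \<open>Stated with squares because integrals bound squared increments; taking roots leaves a
  geometric series with ratio \<open>sqrt (1/2)\<close>.\<close>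

lemma convergent_if_geometric_increments:
  fixes a :: "nat \<Rightarrow> 'z::banach"
  assumes "\<And>k. (norm (a (Suc k) - a k))\<^sup>2 \<le> D * (1/2) ^ k"
  shows "convergent a"
proof -
  have "D \<ge> 0" using assms[of 0] by (simp add: order_trans[OF zero_le_power2])
  have "norm (a (Suc k) - a k) \<le> sqrt D * (sqrt (1/2)) ^ k" for k
    using real_le_rsqrt[OF assms[of k]] by (simp add: real_sqrt_mult real_sqrt_power)
  moreover have "summable (\<lambda>k. sqrt D * (sqrt (1/2)) ^ k)"
    by (intro summable_mult summable_geometric) simp
  ultimately have "summable (\<lambda>k. a (Suc k) - a k)" by (rule summable_comparison_test'[rotated])
  then have "convergent (\<lambda>n. \<Sum>k<n. a (Suc k) - a k)" by (simp add: summable_iff_convergent)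
  then show ?thesis by (simp add: sum_lessThan_telescope convergent_diff_const_right_iff)
qed

text \<open>The value 0 where the sequence is not Cauchy makes the limit a total section. An
  invertible matrix preserves and reflects the Cauchy property, so the same case distinction can be
  made in every trivialisation.\<close>

lemma meas_pointwise_limit:
  assumes "\<And>k. meas (s k)"
  shows "meas (\<lambda>p. if Cauchy (\<lambda>k. s k p) then lim (\<lambda>k. s k p) else 0)" (is "meas ?f")
  unfolding meas_def
proof clarify
  fix V T assume t: "(V, T) \<in> trivs G"
  let ?M = "restrict_space borel V"
  let ?g = "\<lambda>p. if Cauchy (\<lambda>k. T p *v s k p) then lim (\<lambda>k. T p *v s k p) else 0"
  have m: "(\<lambda>p. T p *v s k p) \<in> borel_measurable ?M" for k by (rule measD[OF assms t])
  have "?g \<in> borel_measurable ?M"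
    by (intro measurable_If borel_measurable_lim_metric measurable_const sets_Collect_Cauchy m) simp
  moreover have "?g p = T p *v ?f p" if "p \<in> space ?M" for p
  proof -
    have p: "p \<in> V" using that by (simp add: space_restrict_space)
    have bl: "bounded_linear ((*v) M :: complex^'r \<Rightarrow> complex^'r)" for M :: "complex^'r^'r"
      by (rule bounded_bilinear.bounded_linear_right[OF bounded_bilinear_matrix_vector])
    have c: "Cauchy (\<lambda>k. T p *v s k p) \<longleftrightarrow> Cauchy (\<lambda>k. s k p)"
    proof
      assume "Cauchy (\<lambda>k. T p *v s k p)"
      from bounded_linear.Cauchy[OF bl this, of "matrix_inv (T p)"]
      show "Cauchy (\<lambda>k. s k p)" by (simp add: triv_props(3)[OF t p])
    qed (rule bounded_linear.Cauchy[OF bl])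
    show ?thesis
    proof (cases "Cauchy (\<lambda>k. s k p)")
      case True
      then have "(\<lambda>k. s k p) \<longlonglongrightarrow> lim (\<lambda>k. s k p)" by (simp add: Cauchy_convergent_iff convergent_LIMSEQ_iff)
      from bounded_linear.tendsto[OF bl this] have "lim (\<lambda>k. T p *v s k p) = T p *v lim (\<lambda>k. s k p)"
        by (rule limI)
      then show ?thesis using True c by simp
    qed (simp add: c)
  qed
  ultimately show "(\<lambda>p. T p *v ?f p) \<in> borel_measurable ?M"
    by (rule measurable_cong[THEN iffD1, rotated])
qed

text \<open>Riesz--Fischer. Weighting the squared increments of a rapidly convergent subsequence by
  \<open>2\<^sup>k\<close> makes Minkowski's inequality unnecessary.\<close>

lemma L2_complete:
  assumes s: "\<And>n::nat. s n \<in> L2 G m"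
    and cauchy: "\<And>e. e > 0 \<Longrightarrow> \<exists>M. \<forall>i\<ge>M. \<forall>j\<ge>M. nm G m (\<lambda>p. s i p - s j p) < e"
  shows "\<exists>f\<in>L2 G m. (\<lambda>n. nm G m (\<lambda>p. s n p - f p)) \<longlonglongrightarrow> 0"
proof -
  have "\<exists>M. \<forall>i\<ge>M. \<forall>j\<ge>M. nm G m (\<lambda>p. s i p - s j p) < (1/2) ^ k" for k by (rule cauchy) simp
  then obtain N where N: "\<And>k i j. N k \<le> i \<Longrightarrow> N k \<le> j \<Longrightarrow> nm G m (\<lambda>p. s i p - s j p) < (1/2) ^ k" by metis
  \<comment> \<open>The sum dominates all \<open>N i\<close> with \<open>i\<close> up to
    \<open>k\<close>, so \<open>r k\<close> and \<open>r (Suc k)\<close> are both at least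
    \<open>N k\<close>; the summand \<open>k\<close> makes the indices tend to infinity.\<close>
  define r where "r k = (\<Sum>i\<le>k. N i) + k" for k
  have rN: "N k \<le> r k" "N k \<le> r (Suc k)" "k \<le> r k" for k
  proof -
    have "N k \<le> (\<Sum>i\<le>j. N i)" if "k \<le> j" for j using that by (intro member_le_sum) auto
    from this[of k] this[of "Suc k"] show "N k \<le> r k" "N k \<le> r (Suc k)" "k \<le> r k"
      unfolding r_def by simp_all
  qed
  define d where "d k = wt (\<lambda>p. s (r (Suc k)) p - s (r k) p)" for k
  have ms: "meas (s n)" for n using s by (simp add: L2_iff)
  have md: "d k \<in> borel_measurable (dens G)" for k
    unfolding d_def using wt_measurable[OF meas_diff[OF ms ms]] by simp
  have int_d: "(\<integral>\<^sup>+p. ennreal (2 ^ k * d k p) \<partial>dens G) \<le> ennreal ((1/2) ^ k)" for k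
  proof -
    have "(\<integral>\<^sup>+p. ennreal (2 ^ k * d k p) \<partial>dens G) = ennreal (2 ^ k) * (\<integral>\<^sup>+p. ennreal (d k p) \<partial>dens G)"
      using md[of k] by (simp add: nn_integral_cmult[symmetric] ennreal_mult d_def wt_nonneg)
    also have "\<dots> = ennreal (2 ^ k * (nm G m (\<lambda>p. s (r (Suc k)) p - s (r k) p))\<^sup>2)"
      unfolding d_def by (subst nn_integral_wt_nm[OF L2_diff[OF s s]]) (simp add: ennreal_mult)
    also have "\<dots> \<le> ennreal (2 ^ k * ((1/2) ^ k)\<^sup>2)"
      using N[OF rN(2,1), of k] nm_nonneg[OF L2_diff[OF s s], of "r (Suc k)" "r k"]
      by (intro ennreal_leI mult_left_mono power_mono) auto
    also have "2 ^ k * ((1/2) ^ k)\<^sup>2 = (1/2 :: real) ^ k"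
      by (simp add: power2_eq_square power_divide)
    finally show ?thesis .
  qed
  have "(\<integral>\<^sup>+p. (\<Sum>k. ennreal (2 ^ k * d k p)) \<partial>dens G) = (\<Sum>k. \<integral>\<^sup>+p. ennreal (2 ^ k * d k p) \<partial>dens G)"
    by (rule nn_integral_suminf) (use md in measurable)
  also have "\<dots> \<le> (\<Sum>k. ennreal ((1/2) ^ k))"
    by (intro suminf_le int_d summableI)
  also have "\<dots> = ennreal (\<Sum>k. (1/2) ^ k)"
    by (rule suminf_ennreal2) (simp_all add: summable_geometric)
  also have "\<dots> < \<infinity>" by simp
  finally have "AE p in dens G. (\<Sum>k. ennreal (2 ^ k * d k p)) \<noteq> \<infinity>"
    by (intro nn_integral_PInf_AE borel_measurable_suminf) (use md in measurable)
  then have ae: "AE p in dens G. convergent (\<lambda>k. s (r k) p)"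
    using bdry_null
  proof eventually_elim
    fix p assume fin: "(\<Sum>k. ennreal (2 ^ k * d k p)) \<noteq> \<infinity>" and p: "p \<in> inter G"
    obtain B where B: "B \<ge> 0" "(\<Sum>k. ennreal (2 ^ k * d k p)) = ennreal B"
      using fin less_top_ennreal[of "\<Sum>k. ennreal (2 ^ k * d k p)"] by (auto simp: less_top)
    \<comment> \<open>A finite sum bounds each of its terms. Dividing by the weight gives
      \<open>d k p\<close> at most \<open>B * (1/2) ^ k\<close>, the decay that makes the
      subsequence converge at \<open>p\<close>.\<close>
    have "ennreal (2 ^ k * d k p) \<le> ennreal B" for k
      using sum_le_suminf[of "\<lambda>k. ennreal (2 ^ k * d k p)" "{k}"] B(2) by simp
    then have dB: "2 ^ k * d k p \<le> B" for k using B(1) by (simp add: ennreal_le_iff)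
    obtain C where C: "C > 0" "\<And>w. (norm w)\<^sup>2 \<le> C * hs p w" by (rule hs_norm_bound[of p]) blast
    have x: "bdf G p ^ m > 0" using bdf_cases(1)[OF p] by simp
    show "convergent (\<lambda>k. s (r k) p)"
    proof (rule convergent_if_geometric_increments)
      fix k
      have "hs p (s (r (Suc k)) p - s (r k) p) = d k p / bdf G p ^ m"
        unfolding d_def wt_def by (rule nonzero_mult_div_cancel_left[symmetric]) (use x in \<open>rule less_imp_neq[symmetric]\<close>)
      then have "(norm (s (r (Suc k)) p - s (r k) p))\<^sup>2 \<le> C * (d k p / bdf G p ^ m)" using C(2) by metis
      also have "d k p \<le> B * (1/2) ^ k" using dB[of k] by (simp add: power_divide field_simps)
      then have "C * (d k p / bdf G p ^ m) \<le> C * (B * (1/2) ^ k / bdf G p ^ m)"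
        using x C(1) by (intro mult_left_mono divide_right_mono) auto
      finally show "(norm (s (r (Suc k)) p - s (r k) p))\<^sup>2 \<le> (C * B / bdf G p ^ m) * (1/2) ^ k"
        by (simp add: field_simps)
    qed
  qed
  define f where "f p = (if Cauchy (\<lambda>k. s (r k) p) then lim (\<lambda>k. s (r k) p) else 0)" for p
  have mf: "meas f" unfolding f_def[abs_def] by (rule meas_pointwise_limit) (rule ms)
  \<comment> \<open>Fatou's lemma along the subsequence. The estimate shows both that
    \<open>s n - f\<close> is in \<open>L2\<close> and that its norm is small.\<close>
  have bound: "(\<integral>\<^sup>+p. ennreal (wt (\<lambda>p. s n p - f p) p) \<partial>dens G) \<le> ennreal (e\<^sup>2)"
    if e: "e > 0" and M: "\<forall>i\<ge>M. \<forall>j\<ge>M. nm G m (\<lambda>p. s i p - s j p) < e" and n: "n \<ge> M" for e M n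
  proof -
    have "(\<integral>\<^sup>+p. ennreal (wt (\<lambda>p. s n p - f p) p) \<partial>dens G)
        = (\<integral>\<^sup>+p. liminf (\<lambda>k. ennreal (wt (\<lambda>p. s n p - s (r k) p) p)) \<partial>dens G)"
    proof (rule nn_integral_cong_AE)
      show "AE p in dens G. ennreal (wt (\<lambda>p. s n p - f p) p) = liminf (\<lambda>k. ennreal (wt (\<lambda>p. s n p - s (r k) p) p))"
        using ae
      proof eventually_elim
        fix p assume "convergent (\<lambda>k. s (r k) p)"
        then have "(\<lambda>k. s (r k) p) \<longlonglongrightarrow> f p"
          by (simp add: f_def Cauchy_convergent_iff convergent_LIMSEQ_iff)
        then have "(\<lambda>k. s n p - s (r k) p) \<longlonglongrightarrow> s n p - f p" by (intro tendsto_intros)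
        from continuous_on_tendsto_compose[OF hs_continuous this]
        have "(\<lambda>k. wt (\<lambda>p. s n p - s (r k) p) p) \<longlonglongrightarrow> wt (\<lambda>p. s n p - f p) p"
          unfolding wt_def by (intro tendsto_intros) simp_all
        then have "(\<lambda>k. ennreal (wt (\<lambda>p. s n p - s (r k) p) p)) \<longlonglongrightarrow> ennreal (wt (\<lambda>p. s n p - f p) p)"
          by (rule tendsto_ennrealI)
        then show "ennreal (wt (\<lambda>p. s n p - f p) p) = liminf (\<lambda>k. ennreal (wt (\<lambda>p. s n p - s (r k) p) p))"
          by (intro lim_imp_Liminf[symmetric]) auto
      qed
    qed
    also have "\<dots> \<le> liminf (\<lambda>k. \<integral>\<^sup>+p. ennreal (wt (\<lambda>p. s n p - s (r k) p) p) \<partial>dens G)"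
    proof (rule nn_integral_liminf)
      fix k show "(\<lambda>p. ennreal (wt (\<lambda>p. s n p - s (r k) p) p)) \<in> borel_measurable (dens G)"
        using wt_measurable[OF meas_diff[OF ms ms], of n "r k"] by simp
    qed
    also have "\<dots> \<le> ennreal (e\<^sup>2)"
    proof (rule Liminf_le)
      have "(\<integral>\<^sup>+p. ennreal (wt (\<lambda>p. s n p - s (r k) p) p) \<partial>dens G) \<le> ennreal (e\<^sup>2)" if "k \<ge> M" for k
      proof -
        have "nm G m (\<lambda>p. s n p - s (r k) p) < e" using M n that rN(3)[of k] by auto
        then show ?thesis using nm_nonneg[OF L2_diff[OF s s], of n "r k"]
          by (simp only: nn_integral_wt_nm[OF L2_diff[OF s s]]) (intro ennreal_leI power_mono, auto)
      qed
      then show "\<forall>\<^sub>F k in sequentially. (\<integral>\<^sup>+p. ennreal (wt (\<lambda>p. s n p - s (r k) p) p) \<partial>dens G) \<le> ennreal (e\<^sup>2)"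
        by (auto simp: eventually_sequentially)
    qed simp
    finally show ?thesis .
  qed
  have diff_L2: "\<exists>M. \<forall>n\<ge>M. (\<lambda>p. s n p - f p) \<in> L2 G m \<and> nm G m (\<lambda>p. s n p - f p) \<le> e" if e: "e > 0" for e
  proof -
    obtain M where M: "\<forall>i\<ge>M. \<forall>j\<ge>M. nm G m (\<lambda>p. s i p - s j p) < e" using cauchy[OF e] by blast
    have "(\<lambda>p. s n p - f p) \<in> L2 G m \<and> nm G m (\<lambda>p. s n p - f p) \<le> e" if n: "n \<ge> M" for n
    proof -
      have b: "(\<integral>\<^sup>+p. ennreal (wt (\<lambda>p. s n p - f p) p) \<partial>dens G) \<le> ennreal (e\<^sup>2)" by (rule bound[OF e M n])
      then have "(\<integral>\<^sup>+p. ennreal (wt (\<lambda>p. s n p - f p) p) \<partial>dens G) < \<infinity>"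
        by (rule le_less_trans) simp
      then have L: "(\<lambda>p. s n p - f p) \<in> L2 G m" using meas_diff[OF ms mf] by (simp add: L2_iff)
      have "(nm G m (\<lambda>p. s n p - f p))\<^sup>2 \<le> e\<^sup>2"
        using b unfolding nn_integral_wt_nm[OF L] by (simp add: ennreal_le_iff)
      then have "nm G m (\<lambda>p. s n p - f p) \<le> e" by (rule power2_le_imp_le) (use e in simp)
      with L show ?thesis by blast
    qed
    then show ?thesis by blast
  qed
  obtain M where "(\<lambda>p. s M p - f p) \<in> L2 G m" using diff_L2[of 1] by auto
  \<comment> \<open>Here \<open>f\<close> is recovered as \<open>s M - (s M - f)\<close>.\<close>
  from L2_diff[OF s[of M] this] have f: "f \<in> L2 G m" by simp
  have "(\<lambda>n. nm G m (\<lambda>p. s n p - f p)) \<longlonglongrightarrow> 0"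
  proof (rule LIMSEQ_I)
    fix e :: real assume "e > 0"
    then obtain M where "\<forall>n\<ge>M. nm G m (\<lambda>p. s n p - f p) \<le> e / 2" using diff_L2[of "e/2"] by auto
    then have "\<forall>n\<ge>M. norm (nm G m (\<lambda>p. s n p - f p) - 0) < e"
      using nm_nonneg[OF L2_diff[OF s f]] \<open>e > 0\<close> by fastforce
    then show "\<exists>M. \<forall>n\<ge>M. norm (nm G m (\<lambda>p. s n p - f p) - 0) < e" by blast
  qed
  then show ?thesis by (rule bexI[OF _ f])
qed

text \<open>The integrand is continuous on the interior, hence bounded on the compact support, and
  the support has finite measure.\<close>

lemma test_L2:
  assumes u: "u \<in> test_sections G"
  shows "u \<in> L2 G m"
proof -
  obtain K where K: "smooth_section G (inter G) u" "compact K" "K \<subseteq> inter G" "\<And>p. p \<notin> K \<Longrightarrow> u p = 0"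
    using u by (auto simp: test_sections_def)
  have cont: "continuous_on (V \<inter> inter G) (\<lambda>p. T p *v u p)" if t: "(V, T) \<in> trivs G" for V T
  proof (rule smooth_fun_continuous)
    show "smooth_fun G (V \<inter> inter G) (\<lambda>p. T p *v u p)" using K(1) t by (auto simp: smooth_section_def)
    show "open (V \<inter> inter G)" using triv_props(1)[OF t] open_inter by auto
  qed
  have "meas u" unfolding meas_def
  proof clarify
    fix V T assume t: "(V, T) \<in> trivs G"
    \<comment> \<open>Continuity is known only over the interior. Off it the section vanishes, so
      the indicator changes nothing on \<open>V\<close>.\<close>
    have "(\<lambda>p. indicator (V \<inter> inter G) p *\<^sub>R (T p *v u p)) \<in> borel_measurable borel"
      using triv_props(1)[OF t] open_inter
      by (intro borel_measurable_continuous_on_indicator cont[OF t]) auto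
    then have "(\<lambda>p. indicator (V \<inter> inter G) p *\<^sub>R (T p *v u p)) \<in> borel_measurable (restrict_space borel V)"
      by (rule measurable_restrict_space1)
    moreover have "indicator (V \<inter> inter G) p *\<^sub>R (T p *v u p) = T p *v u p" if "p \<in> space (restrict_space borel V)" for p
    proof (cases "p \<in> inter G")
      case False
      then have "u p = 0" using K(3,4) by blast
      then show ?thesis by simp
    qed (use that in \<open>simp add: space_restrict_space\<close>)
    ultimately show "(\<lambda>p. T p *v u p) \<in> borel_measurable (restrict_space borel V)"
      by (rule measurable_cong[THEN iffD1, rotated])
  qed
  have "continuous_on (\<Union>t\<in>trivs G. fst t \<inter> inter G) (wt u)"
  proof (rule continuous_on_open_UN)
    show "open (fst t \<inter> inter G)" if "t \<in> trivs G" for t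
      using that triv_props(1) open_inter by (cases t) auto
    show "continuous_on (fst t \<inter> inter G) (wt u)" if "t \<in> trivs G" for t
    proof -
      obtain V T where t: "t = (V, T)" "(V, T) \<in> trivs G" using \<open>t \<in> trivs G\<close> by (cases t) auto
      have c1: "continuous_on (V \<inter> inter G) (bdf G)"
        by (rule continuous_on_subset[OF bdf_continuous]) simp
      have c2: "continuous_on (V \<inter> inter G)
          (\<lambda>p. herm G p (matrix_inv (T p) *v a) (matrix_inv (T p) *v b))" for a b
        by (rule continuous_on_subset[OF herm_frame_continuous[OF t(2)]]) simp
      define h where "h p = bdf G p ^ m * Re (\<Sum>i\<in>UNIV. \<Sum>j\<in>UNIV. (T p *v u p) $ i *
          cnj ((T p *v u p) $ j) * herm G p (matrix_inv (T p) *v axis i 1) (matrix_inv (T p) *v axis j 1))" for p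
      have "continuous_on (V \<inter> inter G) h" unfolding h_def[abs_def]
        by (intro continuous_on_Re continuous_on_sum continuous_on_mult continuous_on_cnj
            continuous_on_component cont[OF t(2)] continuous_on_power c1 c2)
      moreover have "h p = wt u p" if "p \<in> V \<inter> inter G" for p
      proof -
        have "p \<in> V" using that by simp
        then show ?thesis unfolding wt_def hs_def h_def by (simp only: herm_coords[OF t(2), of p "u p" "u p", symmetric])
      qed
      ultimately have "continuous_on (V \<inter> inter G) (wt u)" by (rule continuous_on_eq[of _ h])
      then show ?thesis by (simp add: t(1))
    qed
  qed
  moreover have "K \<subseteq> (\<Union>t\<in>trivs G. fst t \<inter> inter G)"
  proof
    fix p assume "p \<in> K"
    moreover obtain V T where "(V, T) \<in> trivs G" "p \<in> V" by (rule triv_at)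
    ultimately show "p \<in> (\<Union>t\<in>trivs G. fst t \<inter> inter G)" using K(3) by force
  qed
  ultimately have "continuous_on K (wt u)" by (rule continuous_on_subset)
  from compact_imp_bounded[OF compact_continuous_image[OF this K(2)]]
  obtain B where "B > 0" and le: "\<forall>y\<in>wt u ` K. norm y \<le> B" unfolding bounded_pos by blast
  have B: "wt u p \<le> B" if "p \<in> K" for p
    using bspec[OF le imageI[OF that]] by (simp only: real_norm_def abs_le_iff)
  have "(\<integral>\<^sup>+p. ennreal (wt u p) \<partial>dens G) \<le> (\<integral>\<^sup>+p. ennreal B * indicator K p \<partial>dens G)"
  proof (rule nn_integral_mono)
    fix p show "ennreal (wt u p) \<le> ennreal B * indicator K p"
      using B[of p] K(4)[of p] by (auto simp: indicator_def wt_def hs_def herm_simps intro: ennreal_leI)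
  qed
  also have "\<dots> = ennreal B * emeasure (dens G) K"
    using compact_imp_closed[OF K(2)] by (simp add: nn_integral_cmult_indicator)
  also have "\<dots> < \<infinity>" using emeasure_lt_top_compact[OF K(2,3)] by (simp add: ennreal_mult_less_top)
  finally show ?thesis using \<open>meas u\<close> by (simp add: L2_iff)
qed

end

section \<open>Density of the test sections\<close>

text \<open>For \<open>k > 0\<close> it is nonzero exactly on the open box. The parameter
  \<open>k\<close> sharpens it: \<open>flat 0 (k * t)\<close> tends to 1 for \<open>t > 0\<close>,
  so for large \<open>k\<close> the function approximates the indicator of the box.\<close>

definition bump :: "real \<Rightarrow> 'v::euclidean_space \<Rightarrow> 'v \<Rightarrow> 'v \<Rightarrow> real" where
  "bump k a b v = (\<Prod>i\<in>Basis. flat 0 (k * (v \<bullet> i - a \<bullet> i)) * flat 0 (k * (b \<bullet> i - v \<bullet> i)))"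

lemma smooth_on_bump:
  assumes "smooth_on S g"
  shows "smooth_on S (\<lambda>x. bump k a b (g x))"
proof -
  have g: "smooth_on S (\<lambda>x. g x \<bullet> i)" for i
    by (rule smooth_on_bounded_bilinear[OF bounded_bilinear_inner assms smooth_on_const])
  have "smooth_on S (\<lambda>x. k * (g x \<bullet> i + (- (a \<bullet> i))))" "smooth_on S (\<lambda>x. k * (b \<bullet> i + (-1) * (g x \<bullet> i)))" for i
    by (intro smooth_on_mult smooth_on_add smooth_on_const g)+
  then have "smooth_on S (\<lambda>x. flat 0 (k * (g x \<bullet> i - a \<bullet> i)))"
     "smooth_on S (\<lambda>x. flat 0 (k * (b \<bullet> i - g x \<bullet> i)))" for i
    by (auto intro: smooth_on_flat)
  then show ?thesis unfolding bump_def by (intro smooth_on_prod smooth_on_mult)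
qed

lemma flat_0: "0 \<le> flat 0 t" "flat 0 t \<le> 1" "flat 0 t \<noteq> 0 \<longleftrightarrow> t > 0"
  by (auto simp: flat_def)

lemma bump_bounds: "0 \<le> bump k a b v" "bump k a b v \<le> 1"
  unfolding bump_def by (auto intro!: prod_nonneg prod_le_1 mult_le_one simp: flat_0)

lemma bump_nonzero_iff: "k > 0 \<Longrightarrow> bump k a b v \<noteq> 0 \<longleftrightarrow> v \<in> box a b"
  by (auto simp: bump_def flat_0(3) mem_box zero_less_mult_iff)

lemma bump_tendsto_indicator: "(\<lambda>n. bump (real (Suc n)) a b v) \<longlonglongrightarrow> indicator (box a b) v"
proof (cases "v \<in> box a b")
  case True
  have lim: "(\<lambda>n. flat 0 (real (Suc n) * t)) \<longlonglongrightarrow> 1" if "t > 0" for t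
  proof -
    have "(\<lambda>n. - (inverse (real (Suc n)) * inverse t)) \<longlonglongrightarrow> - (0 * inverse t)"
      by (intro tendsto_intros LIMSEQ_inverse_real_of_nat)
    then have "(\<lambda>n. exp (- (inverse (real (Suc n)) * inverse t))) \<longlonglongrightarrow> exp (- (0 * inverse t))"
      by (rule tendsto_exp)
    moreover have "flat 0 (real (Suc n) * t) = exp (- (inverse (real (Suc n)) * inverse t))" for n
      using that by (simp add: flat_def)
    ultimately show ?thesis by simp
  qed
  have "(\<lambda>n. bump (real (Suc n)) a b v) \<longlonglongrightarrow> (\<Prod>i\<in>(Basis :: 'a set). 1 * 1)"
    unfolding bump_def by (intro tendsto_prod tendsto_mult lim) (use True in \<open>auto simp: mem_box\<close>)
  then show ?thesis using True by simp
next
  case False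
  then have "bump (real (Suc n)) a b v = 0" for n using bump_nonzero_iff[of "real (Suc n)" a b v] by simp
  then show ?thesis using False by simp
qed

context cone
begin

text \<open>Smoothness of \<open>\<beta>\<close> is required after composition with any smooth map,
  because in another chart \<open>\<beta>\<close> is composed with a transition map.\<close>

lemma smooth_section_extension:
  assumes c: "(U, \<phi>) \<in> atlas G" and t: "(V, T) \<in> trivs G"
    and box: "cbox a b \<subseteq> \<phi> ` (U \<inter> V \<inter> inter G)"
    and smooth: "\<And>S (g :: 'v \<Rightarrow> 'v). smooth_on S g \<Longrightarrow> smooth_on S (\<lambda>x. \<beta> (g x))"
    and supp: "\<And>v. \<beta> v \<noteq> (0 :: real) \<Longrightarrow> v \<in> cbox a b"
  shows "(\<lambda>p. if p \<in> U \<inter> V \<inter> inter G then \<beta> (\<phi> p) *\<^sub>R (matrix_inv (T p) *v e) else 0) \<in> test_sections G"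
    (is "?s \<in> _")
proof -
  note ch = chart_props[OF c]
  define K where "K = inv_into U \<phi> ` cbox a b"
  let ?W = "U \<inter> V \<inter> inter G"
  have KW: "K \<subseteq> ?W"
  proof
    fix p assume "p \<in> K"
    then obtain v where "v \<in> cbox a b" "p = inv_into U \<phi> v" by (auto simp: K_def)
    moreover from this box obtain q where "q \<in> ?W" "v = \<phi> q" by blast
    ultimately show "p \<in> ?W" using ch(2) by simp
  qed
  have "cbox a b \<subseteq> \<phi> ` U" using box by blast
  then have K: "compact K" unfolding K_def
    by (intro compact_continuous_image continuous_on_subset[OF ch(5)] compact_cbox)
  have zero: "?s p = 0" if p: "p \<notin> K" for p
  proof (cases "p \<in> ?W")
    case True
    have "\<beta> (\<phi> p) = 0"
    proof (rule ccontr)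
      assume "\<beta> (\<phi> p) \<noteq> 0"
      then have "inv_into U \<phi> (\<phi> p) \<in> K" unfolding K_def using supp by blast
      then show False using p True ch(2) by simp
    qed
    then show ?thesis by simp
  next
    case False
    then show ?thesis by (simp only: if_False)
  qed
  have "smooth_section G (inter G) ?s"
  proof (rule smooth_section_interI)
    fix U' \<phi>' V' T' assume c': "(U', \<phi>') \<in> atlas G" and t': "(V', T') \<in> trivs G"
    note ch' = chart_props[OF c']
    let ?i = "inv_into U' \<phi>'" and ?W' = "U' \<inter> V' \<inter> inter G"
    \<comment> \<open>On \<open>?Z1\<close> the original chart and frame are available and the
      formula for the section applies; on \<open>?Z2\<close> the section is 0. The two open sets
      cover since \<open>K\<close> lies in \<open>?W\<close>.\<close>
    let ?Z1 = "\<phi>' ` (?W' \<inter> (U \<inter> V))" and ?Z2 = "\<phi>' ` (?W' - K)"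
    have "smooth_on (\<phi>' ` (U' \<inter> U)) (\<phi> \<circ> ?i)"
      using atlas_compatible[OF c' c] by (simp add: compatible_def)
    then have 1: "smooth_on ?Z1 (\<lambda>v. \<beta> (\<phi> (?i v)))"
      unfolding o_def by (intro smooth) (rule smooth_on_subset, auto)
    have "smooth_fun G (V \<inter> V') (\<lambda>p. T' p ** matrix_inv (T p))"
      using cone_unfold(3) t t' unfolding vector_bundle_def by blast
    then have "smooth_on (\<phi>' ` (U' \<inter> (V \<inter> V'))) ((\<lambda>p. T' p ** matrix_inv (T p)) \<circ> ?i)"
      using c' unfolding smooth_fun_def by blast
    then have 2: "smooth_on ?Z1 (\<lambda>v. T' (?i v) ** matrix_inv (T (?i v)))"
      unfolding o_def by (rule smooth_on_subset) auto
    have "smooth_on ?Z1 (\<lambda>v. \<beta> (\<phi> (?i v)) *\<^sub>R ((T' (?i v) ** matrix_inv (T (?i v))) *v e))"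
      by (intro smooth_on_scaleR smooth_on_matrix_vector 1 2 smooth_on_const)
    then have s1: "smooth_on ?Z1 (\<lambda>v. T' (?i v) *v ?s (?i v))"
    proof (rule smooth_on_cong)
      fix v assume "v \<in> ?Z1"
      then have "?i v \<in> ?W" using ch'(2) by auto
      then show "\<beta> (\<phi> (?i v)) *\<^sub>R ((T' (?i v) ** matrix_inv (T (?i v))) *v e) = T' (?i v) *v ?s (?i v)"
        by (simp add: matrix_vector_mul_assoc[symmetric] bounded_bilinear.scaleR_right[OF bounded_bilinear_matrix_vector])
    qed
    have s2: "smooth_on ?Z2 (\<lambda>v. T' (?i v) *v ?s (?i v))"
    proof (rule smooth_on_cong[OF smooth_on_const[of _ 0]])
      fix v assume "v \<in> ?Z2"
      then have "?i v \<notin> K" using ch'(2) by auto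
      then have "?s (?i v) = 0" by (rule zero)
      then show "0 = T' (?i v) *v ?s (?i v)" by (simp only: matrix_vector_mult_0_right)
    qed
    have o: "open (U \<inter> V)" using ch(1) triv_props(1)[OF t] by auto
    have o': "open ?W'" using ch'(1) triv_props(1)[OF t'] open_inter by auto
    have "open ?Z1" by (rule open_chart_image[OF c' open_Int[OF o' o]]) auto
    moreover have "open ?Z2"
      by (rule open_chart_image[OF c' open_Diff[OF o' compact_imp_closed[OF K]]]) auto
    moreover have "?Z1 \<union> ?Z2 = \<phi>' ` ?W'" using KW by blast
    ultimately show "smooth_on (\<phi>' ` ?W') (\<lambda>v. T' (?i v) *v ?s (?i v))"
      using smooth_on_Un_open[OF _ _ s1 s2] by metis
  qed
  moreover have "\<forall>p. p \<notin> K \<longrightarrow> ?s p = 0" using zero by blast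
  moreover have "K \<subseteq> inter G" using KW by blast
  ultimately show ?thesis using K unfolding test_sections_def mem_Collect_eq by blast
qed

end

text \<open>The image under \<open>\<phi>\<close> of the complex measure with density
  \<open>g\<close> vanishes on open boxes, which generate the Borel sets and are stable under
  intersection. The vanishing total mass is what complements require.\<close>

lemma integral_vimage_zero:
  fixes \<phi> :: "'p \<Rightarrow> 'v::euclidean_space" and g :: "'p \<Rightarrow> complex"
  assumes \<phi>[measurable]: "\<phi> \<in> borel_measurable M" and g: "integrable M g"
    and total: "(\<integral>p. g p \<partial>M) = 0"
    and boxes: "\<And>a b. (\<integral>p. indicator (box a b) (\<phi> p) *\<^sub>R g p \<partial>M) = 0"
    and B: "B \<in> sets borel"
  shows "(\<integral>p. indicator B (\<phi> p) *\<^sub>R g p \<partial>M) = 0"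
proof -
  have int: "integrable M (\<lambda>p. indicator A (\<phi> p) *\<^sub>R g p)" if "A \<in> sets borel" for A
  proof -
    have "integrable M (\<lambda>p. indicator (\<phi> -` A \<inter> space M) p *\<^sub>R g p)"
      using measurable_sets[OF \<phi> that] g by (rule integrable_mult_indicator)
    then show ?thesis by (rule Bochner_Integration.integrable_cong[THEN iffD1, rotated 2]) (auto simp: indicator_def)
  qed
  have borel: "sets (borel :: 'v measure) = sigma_sets UNIV (range (\<lambda>(a, b). box a b))"
    by (subst borel_eq_box) simp
  have "Int_stable (range (\<lambda>(a, b). box a b :: 'v set))"
    by (auto simp: Int_stable_def box_Int_box)
  moreover have "range (\<lambda>(a, b). box a b :: 'v set) \<subseteq> Pow UNIV" by simp
  moreover note B[unfolded borel]
  ultimately show ?thesis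
  proof (induction rule: sigma_sets_induct_disjoint)
    case (basic A)
    then show ?case using boxes by auto
  next
    case empty
    then show ?case by simp
  next
    case (compl A)
    have A: "A \<in> sets borel" using compl.hyps borel by simp
    have "(\<integral>p. indicator (UNIV - A) (\<phi> p) *\<^sub>R g p \<partial>M) = (\<integral>p. g p - indicator A (\<phi> p) *\<^sub>R g p \<partial>M)"
      by (intro Bochner_Integration.integral_cong) (auto simp: indicator_def)
    then show ?case using int[OF A] g total compl.IH by simp
  next
    case (union A)
    have A: "A i \<in> sets borel" for i using union.hyps borel by auto
    have UA: "(\<Union>i. A i) \<in> sets borel" using A by auto
    let ?A = "\<lambda>i. \<phi> -` A i \<inter> space M"
    have eq: "(\<integral>p. indicator X (\<phi> p) *\<^sub>R g p \<partial>M) = (LINT p:(\<phi> -` X \<inter> space M)|M. g p)" for X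
      unfolding set_lebesgue_integral_def
      by (intro Bochner_Integration.integral_cong) (auto simp: indicator_def)
    have Un: "\<phi> -` (\<Union>i. A i) \<inter> space M = (\<Union>i. ?A i)" by auto
    have "(LINT p:(\<Union>i. ?A i)|M. g p) = (\<Sum>i. LINT p:?A i|M. g p)"
    proof (rule lebesgue_integral_countable_add)
      show "?A i \<in> sets M" for i using measurable_sets[OF \<phi> A] .
      show "?A i \<inter> ?A j = {}" if "i \<noteq> j" for i j
        using union.hyps(1) that by (auto simp: disjoint_family_on_def)
      show "set_integrable M (\<Union>i. ?A i) g"
        unfolding set_integrable_def using measurable_sets[OF \<phi> UA] g unfolding Un
        by (intro integrable_mult_indicator)
    qed
    also have "\<dots> = 0" using union.IH by (simp add: eq)
    finally show ?case unfolding eq Un .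
  qed
qed

lemma AE_zero_if_Re_le_zero:
  assumes "\<And>z :: complex. AE p in M. Re (z * g p) \<le> 0"
  shows "AE p in M. g p = 0"
  \<comment> \<open>The factors 1 and -1 bound the real part from both sides, the factors
    \<open>\<i>\<close> and \<open>-\<i>\<close> the imaginary part.\<close>
  using assms[of 1] assms[of "-1"] assms[of \<i>] assms[of "-\<i>"]
  by eventually_elim (simp add: complex_eq_iff)

context cone
begin

text \<open>The fundamental lemma of the calculus of variations in one chart. Orthogonality makes
  the integral of \<open>g\<close> against every bump vanish; sharpening the bumps gives boxes,
  boxes give Borel sets, and a suitable Borel set gives the positive part of Re (z g).\<close>

lemma perp_test_local:
  assumes f: "f \<in> L2 G m" and perp: "\<And>s. s \<in> test_sections G \<Longrightarrow> ip G m f s = 0"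
    and c: "(U, \<phi>) \<in> atlas G" and t: "(V, T) \<in> trivs G"
    and box: "cbox a b \<subseteq> \<phi> ` (U \<inter> V \<inter> inter G)"
  shows "AE p in dens G. p \<in> U \<inter> V \<inter> inter G \<and> \<phi> p \<in> box a b \<longrightarrow> herm G p (f p) (matrix_inv (T p) *v e) = 0"
proof -
  note ch = chart_props[OF c]
  let ?W = "U \<inter> V \<inter> inter G"
  define sec where "sec \<beta> p = (if p \<in> ?W then \<beta> (\<phi> p) *\<^sub>R (matrix_inv (T p) *v e) else 0)" for \<beta> :: "'v \<Rightarrow> real" and p
  have W: "open ?W" using ch(1) triv_props(1)[OF t] open_inter by auto
  have supp1: "v \<in> cbox a b" if "bump 1 a b v \<noteq> 0" for v
    using that bump_nonzero_iff[of 1 a b v] box_subset_cbox by auto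
  have sec1: "sec (bump 1 a b) \<in> test_sections G"
    unfolding sec_def[abs_def]
    by (rule smooth_section_extension[OF c t box]) (auto intro: smooth_on_bump supp1)
  \<comment> \<open>The fixed second factor keeps the support inside the chart whatever the box
    \<open>a'\<close>, \<open>b'\<close> and the sharpness \<open>k\<close> of the first factor
    are.\<close>
  have sec2: "sec (\<lambda>v. bump k a' b' v * bump 1 a b v) \<in> test_sections G" for k a' b'
    unfolding sec_def[abs_def]
    by (rule smooth_section_extension[OF c t box]) (auto intro: smooth_on_bump smooth_on_mult supp1)
  define g where "g p = of_real (bdf G p ^ m) * herm G p (f p) (sec (bump 1 a b) p)" for p
  have g_off: "g p = 0" if "p \<notin> ?W" for p using that by (simp only: g_def sec_def if_False herm_simps mult_zero_right)
  have g: "integrable (dens G) g" "(\<integral>p. g p \<partial>dens G) = 0"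
    using ip_integrable[OF f test_L2[OF sec1]] perp[OF sec1] by (simp_all add: g_def[abs_def] ip_def)
  \<comment> \<open>A globally measurable replacement for the chart. Its value 0 off
    \<open>?W\<close> is harmless because \<open>g\<close> vanishes there.\<close>
  define \<psi> where "\<psi> p = indicator ?W p *\<^sub>R \<phi> p" for p
  have "\<psi> \<in> borel_measurable borel" unfolding \<psi>_def[abs_def]
    using W by (intro borel_measurable_continuous_on_indicator continuous_on_subset[OF ch(3)]) auto
  then have \<psi>: "\<psi> \<in> borel_measurable (dens G)" by simp
  have herm_scaleR: "herm G p x (r *\<^sub>R y) = of_real r * herm G p x y" for p x r y
    using herm_simps(6)[of p x "of_real r" y] by (simp add: of_real_vector_scale)
  have bump_int: "(\<integral>p. bump k a' b' (\<psi> p) *\<^sub>R g p \<partial>dens G) = 0" for k a' b'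
  proof -
    have "(\<integral>p. bump k a' b' (\<psi> p) *\<^sub>R g p \<partial>dens G)
        = ip G m f (sec (\<lambda>v. bump k a' b' v * bump 1 a b v))"
      unfolding ip_def g_def sec_def \<psi>_def
      by (intro Bochner_Integration.integral_cong refl)
        (auto simp: herm_simps herm_scaleR scaleR_conv_of_real[where 'a = complex])
    then show ?thesis using perp[OF sec2] by simp
  qed
  have boxes: "(\<integral>p. indicator (box a' b') (\<psi> p) *\<^sub>R g p \<partial>dens G) = 0" for a' b'
  proof -
    have cont: "continuous_on UNIV (bump k a' b')" for k
      using smooth_on_bump[OF smooth_on_bounded_linear[OF bounded_linear_ident], of UNIV k a' b']
      by (rule smooth_on_continuous)
    have "(\<lambda>n. \<integral>p. bump (real (Suc n)) a' b' (\<psi> p) *\<^sub>R g p \<partial>dens G)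
        \<longlonglongrightarrow> (\<integral>p. indicator (box a' b') (\<psi> p) *\<^sub>R g p \<partial>dens G)"
    proof (rule integral_dominated_convergence[where w = "\<lambda>p. norm (g p)"])
      have "(\<lambda>p. indicator (box a' b') (\<psi> p) :: real) \<in> borel_measurable (dens G)"
        using measurable_compose[OF \<psi> borel_measurable_indicator[of "box a' b'" borel]] by simp
      then show "(\<lambda>p. indicator (box a' b') (\<psi> p) *\<^sub>R g p) \<in> borel_measurable (dens G)"
        using borel_measurable_integrable[OF g(1)] by (rule borel_measurable_scaleR)
      show "(\<lambda>p. bump (real (Suc n)) a' b' (\<psi> p) *\<^sub>R g p) \<in> borel_measurable (dens G)" for n
        using measurable_compose[OF \<psi> borel_measurable_continuous_onI[OF cont]]
          borel_measurable_integrable[OF g(1)] by (rule borel_measurable_scaleR)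
      show "integrable (dens G) (\<lambda>p. norm (g p))" using g(1) by simp
      show "AE p in dens G. (\<lambda>n. bump (real (Suc n)) a' b' (\<psi> p) *\<^sub>R g p) \<longlonglongrightarrow> indicator (box a' b') (\<psi> p) *\<^sub>R g p"
        by (intro AE_I2 tendsto_scaleR bump_tendsto_indicator tendsto_const)
      show "AE p in dens G. norm (bump (real (Suc n)) a' b' (\<psi> p) *\<^sub>R g p) \<le> norm (g p)" for n
        by (intro AE_I2) (simp add: mult_left_le_one_le bump_bounds)
    qed
    then show ?thesis unfolding bump_int by (simp add: LIMSEQ_const_iff)
  qed
  have "AE p in dens G. Re (z * g p) \<le> 0" for z
  proof -
    \<comment> \<open>The chart is injective, so the indicator of \<open>B\<close> along
      \<open>\<psi>\<close> selects exactly the points of \<open>?W\<close> where Re (z g) is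
      positive; the corresponding integral is that of its positive part.\<close>
    define B where "B = {v \<in> \<phi> ` ?W. 0 < Re (z * g (inv_into U \<phi> v))}"
    have S: "open (\<phi> ` ?W)" by (rule open_local_image(1)[OF c t])
    have "continuous_on (\<phi> ` ?W) (inv_into U \<phi>)" by (rule continuous_on_subset[OF ch(5)]) auto
    then have "inv_into U \<phi> \<in> borel_measurable (restrict_space borel (\<phi> ` ?W))"
      by (rule borel_measurable_continuous_on_restrict)
    moreover have "g \<in> borel_measurable borel" using borel_measurable_integrable[OF g(1)] by simp
    ultimately have gi: "(\<lambda>v. g (inv_into U \<phi> v)) \<in> borel_measurable (restrict_space borel (\<phi> ` ?W))"
      by (rule measurable_compose)
    then have "(\<lambda>v. Re (z * g (inv_into U \<phi> v))) \<in> borel_measurable (restrict_space borel (\<phi> ` ?W))"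
      by measurable
    then have "{v \<in> space (restrict_space borel (\<phi> ` ?W)). 0 < Re (z * g (inv_into U \<phi> v))}
        \<in> sets (restrict_space borel (\<phi> ` ?W))" by (intro borel_measurable_less borel_measurable_const)
    then have "B \<in> sets (restrict_space borel (\<phi> ` ?W))" by (simp add: B_def space_restrict_space)
    then have B: "B \<in> sets borel" using S by (simp add: sets_restrict_space_iff)
    define h where "h p = indicator B (\<psi> p) * Re (z * g p)" for p
    have h_eq: "h p = max 0 (Re (z * g p))" for p
    proof (cases "p \<in> ?W")
      case True
      then have "\<psi> p = \<phi> p" "inv_into U \<phi> (\<phi> p) = p" "\<phi> p \<in> \<phi> ` ?W" using ch(2) by (auto simp: \<psi>_def)
      then show ?thesis by (auto simp: h_def B_def indicator_def)
    qed (simp add: h_def g_off)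
    have int_h: "integrable (dens G) h" unfolding h_eq[abs_def]
      using g(1) by (intro integrable_max integrable_zero integrable_Re integrable_mult_right)
    have "(\<integral>p. indicator B (\<psi> p) *\<^sub>R g p \<partial>dens G) = 0"
      by (rule integral_vimage_zero[OF \<psi> g boxes B])
    moreover have int_g: "integrable (dens G) (\<lambda>p. indicator B (\<psi> p) *\<^sub>R g p)"
    proof (rule Bochner_Integration.integrable_bound[OF g(1)])
      have "(\<lambda>p. indicator B (\<psi> p) :: real) \<in> borel_measurable (dens G)"
        using measurable_compose[OF \<psi> borel_measurable_indicator[OF B]] by simp
      then show "(\<lambda>p. indicator B (\<psi> p) *\<^sub>R g p) \<in> borel_measurable (dens G)"
        using borel_measurable_integrable[OF g(1)] by (rule borel_measurable_scaleR)
    qed (auto simp: indicator_def)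
    ultimately have "(\<integral>p. Re (z * (indicator B (\<psi> p) *\<^sub>R g p)) \<partial>dens G) = 0"
      unfolding Bochner_Integration.integral_Re[OF integrable_mult_right[OF int_g]]
        Bochner_Integration.integral_mult_right[OF int_g] by simp
    moreover have "Re (z * (indicator B (\<psi> p) *\<^sub>R g p)) = h p" for p
      by (simp add: h_def indicator_def)
    ultimately have "(\<integral>p. h p \<partial>dens G) = 0" by simp
    moreover have "AE p in dens G. 0 \<le> h p" by (simp add: h_eq)
    ultimately have "AE p in dens G. h p = 0" using integral_nonneg_eq_0_iff_AE[OF int_h] by blast
    then show ?thesis by (rule eventually_mono) (simp add: h_eq)
  qed
  then have "AE p in dens G. g p = 0" by (rule AE_zero_if_Re_le_zero)
  then show ?thesis
  proof (rule eventually_mono, intro impI)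
    fix p assume "g p = 0" and p: "p \<in> ?W \<and> \<phi> p \<in> box a b"
    then have "of_real (bdf G p ^ m) * (of_real (bump 1 a b (\<phi> p)) * herm G p (f p) (matrix_inv (T p) *v e)) = 0"
      by (simp only: g_def sec_def herm_scaleR if_True)
    moreover have "bump 1 a b (\<phi> p) \<noteq> 0" using p by (simp add: bump_nonzero_iff)
    moreover have "bdf G p \<noteq> 0" using p bdf_cases(1)[of p] by auto
    ultimately show "herm G p (f p) (matrix_inv (T p) *v e) = 0" by simp
  qed
qed

text \<open>The local statements are combined over countably many boxes of a chart and finitely many
  frame vectors, charts and trivialisations, so that the exceptional sets stay null.\<close>

lemma perp_test_null:
  assumes f: "f \<in> L2 G m" and perp: "\<And>s. s \<in> test_sections G \<Longrightarrow> ip G m f s = 0"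
  shows "f \<in> null_sections G m"
proof -
  have loc: "AE p in dens G. p \<in> U \<inter> V \<inter> inter G \<longrightarrow> f p = 0"
    if c: "(U, \<phi>) \<in> atlas G" and t: "(V, T) \<in> trivs G" for U \<phi> V T
  proof -
    let ?S = "\<phi> ` (U \<inter> V \<inter> inter G)"
    define \<F> where "\<F> = {box a b | a b. cbox a b \<subseteq> ?S}"
    have S: "open ?S" by (rule open_local_image(1)[OF c t])
    have "openin (top_of_set UNIV) X" if "X \<in> \<F>" for X using that by (auto simp: \<F>_def open_box)
    \<comment> \<open>The boxes with closure in \<open>?S\<close> cover \<open>?S\<close> but are
      uncountably many; Lindelof leaves countably many with the same union.\<close>
    then obtain \<F>' where F': "\<F>' \<subseteq> \<F>" "countable \<F>'" "\<Union>\<F>' = \<Union>\<F>" by (rule Lindelof_openin)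
    have "AE p in dens G. \<forall>X\<in>\<F>'. p \<in> U \<inter> V \<inter> inter G \<and> \<phi> p \<in> X \<longrightarrow> f p = 0"
    proof (rule AE_ball_countable'[OF _ F'(2)])
      fix X assume "X \<in> \<F>'"
      then obtain a b where X: "X = box a b" "cbox a b \<subseteq> ?S" using F'(1) by (auto simp: \<F>_def)
      have "AE p in dens G. \<forall>j\<in>UNIV. p \<in> U \<inter> V \<inter> inter G \<and> \<phi> p \<in> box a b \<longrightarrow>
          herm G p (f p) (matrix_inv (T p) *v axis j 1) = 0"
        by (intro AE_finite_allI finite perp_test_local[OF f perp c t X(2)])
      then show "AE p in dens G. p \<in> U \<inter> V \<inter> inter G \<and> \<phi> p \<in> X \<longrightarrow> f p = 0"
      proof (rule eventually_mono, intro impI)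
        fix p assume *: "\<forall>j\<in>UNIV. p \<in> U \<inter> V \<inter> inter G \<and> \<phi> p \<in> box a b \<longrightarrow>
          herm G p (f p) (matrix_inv (T p) *v axis j 1) = 0" and p: "p \<in> U \<inter> V \<inter> inter G \<and> \<phi> p \<in> X"
        \<comment> \<open>A vector orthogonal to all members of a frame is orthogonal to itself, as
          the frame expands it.\<close>
        have "f p = matrix_inv (T p) *v (\<Sum>i\<in>UNIV. (T p *v f p) $ i *s axis i 1)"
          using triv_props(3)[OF t] p by (simp add: basis_expansion)
        then have "f p = (\<Sum>i\<in>UNIV. (T p *v f p) $ i *s (matrix_inv (T p) *v axis i 1))"
          by (simp add: vec.linear_sum[OF matrix_vector_mul_linear_gen] vec.scale)
        then have "herm G p (f p) (f p)
            = herm G p (f p) (\<Sum>i\<in>UNIV. (T p *v f p) $ i *s (matrix_inv (T p) *v axis i 1))"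
          by (rule arg_cong)
        also have "\<dots> = 0" using * p X(1) by (simp add: herm_sum herm_simps)
        finally have "hs p (f p) = 0" by (simp add: hs_def)
        then show "f p = 0" by (simp only: hs_eq_0_iff)
      qed
    qed
    then show ?thesis
    proof (rule eventually_mono, intro impI)
      fix p assume *: "\<forall>X\<in>\<F>'. p \<in> U \<inter> V \<inter> inter G \<and> \<phi> p \<in> X \<longrightarrow> f p = 0" and p: "p \<in> U \<inter> V \<inter> inter G"
      then have "\<phi> p \<in> ?S" by blast
      then obtain a b where "cbox a b \<subseteq> ?S" "\<phi> p \<in> box a b" by (rule open_contains_cbox[OF S])
      then have "\<phi> p \<in> \<Union>\<F>'" unfolding F'(3) \<F>_def by blast
      then show "f p = 0" using * p by blast
    qed
  qed
  have "compact (UNIV :: 'p set)" "\<And>c. c \<in> atlas G \<Longrightarrow> open (fst c)" "UNIV \<subseteq> (\<Union>c\<in>atlas G. fst c)"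
    using cone_unfold(1,2) chart_props(1) by (auto simp: smooth_atlas_def)
  then obtain C where C: "C \<subseteq> atlas G" "finite C" "UNIV \<subseteq> (\<Union>c\<in>C. fst c)" by (rule compactE_image)
  obtain E where E: "E \<subseteq> trivs G" "finite E" "UNIV = (\<Union>t\<in>E. fst t)" by (rule finite_trivs)
  have "AE p in dens G. \<forall>x\<in>C \<times> E. p \<in> fst (fst x) \<inter> fst (snd x) \<inter> inter G \<longrightarrow> f p = 0"
  proof (rule AE_finite_allI)
    show "finite (C \<times> E)" using C E by simp
    fix x assume "x \<in> C \<times> E"
    then have "(fst (fst x), snd (fst x)) \<in> atlas G" "(fst (snd x), snd (snd x)) \<in> trivs G" using C E by auto
    then show "AE p in dens G. p \<in> fst (fst x) \<inter> fst (snd x) \<inter> inter G \<longrightarrow> f p = 0" by (rule loc)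
  qed
  then have "AE p in dens G. f p = 0" using bdry_null
  proof eventually_elim
    fix p assume *: "\<forall>x\<in>C \<times> E. p \<in> fst (fst x) \<inter> fst (snd x) \<inter> inter G \<longrightarrow> f p = 0" and p: "p \<in> inter G"
    obtain c t where "c \<in> C" "p \<in> fst c" "t \<in> E" "p \<in> fst t" using C(3) E(3) by blast
    then have "(c, t) \<in> C \<times> E" "p \<in> fst (fst (c, t)) \<inter> fst (snd (c, t)) \<inter> inter G" using p by auto
    then show "f p = 0" using * by blast
  qed
  then show ?thesis using f by (simp add: null_sections_def)
qed

end

section \<open>Selfadjoint extensions of cone operators\<close>

lemma sum_fun_apply: "(\<Sum>i\<in>I. f i) x = (\<Sum>i\<in>I. f i x)"
  by (induction I rule: infinite_finite_induct) auto

interpretation sect: vector_space "\<lambda>c (u :: ('p, 'r::finite) sect) p. c *s u p"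
  by unfold_locales (simp_all add: fun_eq_iff vec_eq_iff algebra_simps)

lemma csubspace_iff: "csubspace X \<longleftrightarrow> sect.subspace X"
proof
  assume "csubspace X"
  then have zero: "0 \<in> X" and lin: "\<And>u v a. \<lbrakk>u \<in> X; v \<in> X\<rbrakk> \<Longrightarrow> (\<lambda>p. a *s u p + v p) \<in> X"
    by (auto simp: csubspace_def zero_fun_def)
  have "u + v \<in> X" if "u \<in> X" "v \<in> X" for u v
    using lin[OF that, of 1] by (simp add: plus_fun_def)
  moreover have "(\<lambda>p. c *s u p) \<in> X" if "u \<in> X" for u c
    using lin[OF that zero, of c] by (simp add: zero_fun_def)
  ultimately show "sect.subspace X" using zero by (simp add: sect.subspace_def)
next
  assume X: "sect.subspace X"
  have "(\<lambda>p. a *s u p + v p) \<in> X" if "u \<in> X" "v \<in> X" for u v a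
    using sect.subspace_add[OF X sect.subspace_scale[OF X that(1), of a] that(2)] by (simp add: plus_fun_def)
  then show "csubspace X" using sect.subspace_0[OF X] by (simp add: csubspace_def zero_fun_def)
qed

context cone
begin

section \<open>The sections as an instance of the abstract theory\<close>

sublocale sh: semi_hilbert "\<lambda>c (u :: ('p, 'r) sect) p. c *s u p" "L2 G m" "ip G m"
proof unfold_locales
  show "sect.subspace (L2 G m)"
    unfolding csubspace_iff[symmetric] csubspace_def using L2_zero L2_lincomb by blast
  show "ip G m (u + v) w = ip G m u w + ip G m v w" if "u \<in> L2 G m" "v \<in> L2 G m" "w \<in> L2 G m" for u v w
    using ip_lincomb_left[OF that, of 1] by (simp add: plus_fun_def)
  show "ip G m (\<lambda>p. c *s u p) v = c * ip G m u v" if "u \<in> L2 G m" "v \<in> L2 G m" for u v c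
  proof -
    have "ip G m (\<lambda>p. 0) v = 0" by (simp add: ip_def herm_simps)
    then show ?thesis using ip_lincomb_left[OF that(1) L2_zero that(2), of c] by simp
  qed
  show "ip G m v u = cnj (ip G m u v)" for u v by (rule ip_cnj)
  show "0 \<le> Re (ip G m u u)" if "u \<in> L2 G m" for u by (rule ip_nonneg[OF that])
  show "\<exists>f\<in>L2 G m. (\<lambda>n. sqrt (Re (ip G m (s n - f) (s n - f)))) \<longlonglongrightarrow> 0"
    if "\<And>n::nat. s n \<in> L2 G m"
      "\<And>e. e > 0 \<Longrightarrow> \<exists>M. \<forall>i\<ge>M. \<forall>j\<ge>M. sqrt (Re (ip G m (s i - s j) (s i - s j))) < e" for s
    using L2_complete[of s] that by (simp add: nm_def fun_diff_def)
qed

lemma sn_eq: "sh.sn = nm G m"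
  by (simp add: fun_eq_iff sh.sn_def nm_def)

lemma null_eq: "sh.null = null_sections G m"
  using null_sections_iff by (auto simp: sh.null_def sn_eq)

lemma tends_eq: "sh.tends s f \<longleftrightarrow> (\<lambda>n. nm G m (\<lambda>p. s n p - f p)) \<longlonglongrightarrow> 0"
  by (simp add: sh.tends_def sn_eq fun_diff_def)

lemma is_closed_eq: "sh.is_closed X \<longleftrightarrow> closed_in_L2 G m X"
  by (simp add: sh.is_closed_def closed_in_L2_def tends_eq)

lemma qdim_eq: "sh.qdim X W n \<longleftrightarrow> has_qdim X W n"
proof -
  have "(\<Sum>b\<in>B. (\<lambda>p. c b *s b p)) = (\<lambda>p. \<Sum>b\<in>B. c b *s b p)" for B :: "('p, 'r) sect set" and c
    by (simp add: fun_eq_iff sum_fun_apply)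
  then show ?thesis by (simp add: sh.qdim_def has_qdim_def fun_diff_def)
qed

lemma perp_test: "sh.perp (test_sections G) \<subseteq> sh.null"
  unfolding null_eq by (auto simp: sh.perp_def intro: perp_test_null)

end

locale symmetric_cone_operator = cone G m
  for G :: "('p::t2_space, 'v::euclidean_space, 'r::finite) cone_geometry" and m :: nat +
  fixes A :: "('p, 'r) sect \<Rightarrow> ('p, 'r) sect"
  assumes A: "A \<in> cone_Diff G m"
    and sym: "symmetric_graph G m (ext_graph G m A (Dmin G m A))"
begin

lemma A_facts:
  shows "\<phi> \<in> test_sections G \<Longrightarrow> A \<phi> \<in> test_sections G"
    and "\<lbrakk>\<phi> \<in> test_sections G; \<psi> \<in> test_sections G\<rbrakk> \<Longrightarrow> A (\<lambda>p. c *s \<phi> p + \<psi> p) = (\<lambda>p. c *s A \<phi> p + A \<psi> p)"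
  using A cone_op_test cone_op_linear by (auto simp: cone_Diff_def test_sections_def)

text \<open>This brings the symmetry hypothesis, which concerns \<open>Dmin\<close>, to bear on test
  sections. That A acts weakly as itself is immediate from the definition of
  \<open>formal_adjoint\<close>.\<close>

lemma test_ext_graph:
  assumes "\<phi> \<in> test_sections G"
  shows "(\<phi>, A \<phi>) \<in> ext_graph G m A (Dmin G m A)"
proof -
  have L: "\<phi> \<in> L2 G m" "A \<phi> \<in> L2 G m" using assms A_facts(1) test_L2 by blast+
  have "acts G m A \<phi> (A \<phi>)" using L assms by (auto simp: acts_def formal_adjoint_def)
  moreover have "\<phi> \<in> Dmin G m A" unfolding Dmin_def mem_Collect_eq tends_eq[symmetric]
    using L assms by (intro conjI bexI[of _ "A \<phi>"] exI[of _ "\<lambda>_. \<phi>"] sh.tends_const) auto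
  ultimately show ?thesis by (simp add: ext_graph_def)
qed

text \<open>Symmetry makes \<open>A\<close> its own formal adjoint, so no integration by parts is needed.\<close>

sublocale op: symmetric_operator "\<lambda>c (u :: ('p, 'r) sect) p. c *s u p" "L2 G m" "ip G m" "test_sections G" A
proof unfold_locales
  show "sect.subspace (test_sections G)"
    unfolding csubspace_iff[symmetric] csubspace_def using zero_test test_lincomb by blast
  show "test_sections G \<subseteq> L2 G m" using test_L2 by blast
  show "A \<phi> \<in> test_sections G" if "\<phi> \<in> test_sections G" for \<phi> by (rule A_facts(1)[OF that])
  show "A (\<phi> + \<psi>) = A \<phi> + A \<psi>" if "\<phi> \<in> test_sections G" "\<psi> \<in> test_sections G" for \<phi> \<psi>
    using A_facts(2)[OF that, of 1] by (simp add: plus_fun_def)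
  show "A (\<lambda>p. c *s \<phi> p) = (\<lambda>p. c *s A \<phi> p)" if "\<phi> \<in> test_sections G" for \<phi> c
  proof -
    have "A (\<lambda>p. 0) = (\<lambda>p. A (\<lambda>p. 0) p + A (\<lambda>p. 0) p)" using A_facts(2)[OF zero_test zero_test, of 1] by simp
    then have "A (\<lambda>p. 0) = (\<lambda>p. 0)" by (simp add: fun_eq_iff)
    then show ?thesis using A_facts(2)[OF that zero_test, of c] by simp
  qed
  show "ip G m (A \<phi>) \<psi> = ip G m \<phi> (A \<psi>)" if "\<phi> \<in> test_sections G" "\<psi> \<in> test_sections G" for \<phi> \<psi>
    using sym test_ext_graph[OF that(1)] test_ext_graph[OF that(2)] unfolding symmetric_graph_def by blast
  show "sh.perp (test_sections G) \<subseteq> sh.null" by (rule perp_test)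
qed

text \<open>If \<open>\<psi>\<close> is a formal adjoint value for \<open>\<phi>\<close>, then by
  symmetry \<open>\<psi> - A \<phi>\<close> is orthogonal to all test sections, so it is in
  \<open>sh.null\<close> by density. Testing with all formal adjoint pairs thus amounts to testing
  with the pairs \<open>(\<phi>, A \<phi>)\<close>.\<close>

lemma acts_eq: "acts G m A u f \<longleftrightarrow> op.acts_on u f"
proof
  assume a: "acts G m A u f"
  have "formal_adjoint G m A \<phi> (A \<phi>)" if "\<phi> \<in> test_sections G" for \<phi>
    using that op.A_T op.A_sym by (auto simp: formal_adjoint_def)
  then show "op.acts_on u f" using a by (auto simp: acts_def op.acts_on_def)
next
  assume a: "op.acts_on u f"
  note H = op.acts_onD[OF a]
  have "ip G m u \<psi> = ip G m f \<phi>" if fa: "formal_adjoint G m A \<phi> \<psi>" for \<phi> \<psi>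
  proof -
    have T: "\<phi> \<in> test_sections G" "\<psi> \<in> test_sections G" using fa by (auto simp: formal_adjoint_def)
    have L: "A \<phi> \<in> L2 G m" "\<psi> \<in> L2 G m" using op.AT_H[OF T(1)] op.T_H[OF T(2)] .
    have "ip G m \<eta> (\<psi> - A \<phi>) = 0" if "\<eta> \<in> test_sections G" for \<eta>
      using fa op.A_sym[OF that T(1)] that op.T_H[OF that] L
      by (simp add: sh.ip_diff_right formal_adjoint_def)
    then have "\<psi> - A \<phi> \<in> sh.perp (test_sections G)"
      using L op.T_H ip_cnj[of "\<psi> - A \<phi>"] by (auto simp: sh.perp_def)
    then have "ip G m u (\<psi> - A \<phi>) = 0" using perp_test sh.null_ip(2) H(1) by blast
    then show ?thesis using a T(1) L H by (simp add: sh.ip_diff_right op.acts_on_def)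
  qed
  then show "acts G m A u f" using H by (simp add: acts_def)
qed

lemma Dmin_eq: "Dmin G m A = op.dmin"
  by (auto simp: Dmin_def op.dmin_def tends_eq)

lemma ext_graph_eq: "ext_graph G m A D = op.graph_on D"
  by (auto simp: ext_graph_def op.graph_on_def acts_eq)

lemma adjoint_graph_eq: "adjoint_graph G m R = op.adjoint R"
  by (auto simp: adjoint_graph_def op.adjoint_def)

lemma ker_of_eq: "ker_of G m R = op.kern R"
  by (auto simp: ker_of_def op.kern_def null_eq)

lemma densely_defined_extension:
  assumes "op.dmin \<subseteq> D"
  shows "densely_defined G m (op.graph_on D)"
  unfolding densely_defined_def
proof (intro ballI allI impI)
  fix u and e :: real assume "u \<in> L2 G m" "e > 0"
  then obtain \<phi> where \<phi>: "\<phi> \<in> test_sections G" "nm G m (u - \<phi>) < e"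
    using sh.dense_if_perp_null[OF op.subspace_T op.T_subset perp_test] unfolding sn_eq by blast
  moreover have "\<phi> \<in> Domain (op.graph_on D)"
  proof -
    have "\<phi> \<in> op.dmin" using op.gmin_T[OF \<phi>(1)] op.dmin_iff by blast
    then show ?thesis using assms op.acts_on_T[OF \<phi>(1)] by (auto simp: op.graph_on_def)
  qed
  ultimately show "\<exists>v\<in>Domain (op.graph_on D). nm G m (\<lambda>p. u p - v p) < e"
    by (auto simp: fun_diff_def)
qed

end

theorem proposition6p7:
  fixes G :: "('p::t2_space, 'v::euclidean_space, 'r::finite) cone_geometry"
    and m :: nat
    and A :: "('p, 'r) sect \<Rightarrow> ('p, 'r) sect"
    and k :: int
  assumes "cone_setting G"
    and "A \<in> cone_Diff G m"
    and "c_elliptic G m A"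
    and "symmetric_graph G m (ext_graph G m A (Dmin G m A))"
    and "has_index G m (ext_graph G m A (Dmin G m A)) k"
    and "- k > 0"
  shows "\<forall>\<mu>::real. \<exists>\<D>\<in>SA G m A. complex_of_real \<mu> \<in> spec G m (ext_graph G m A \<D>)"
proof
  fix \<mu> :: real
  interpret symmetric_cone_operator G m A
    using assms by (simp add: symmetric_cone_operator_def symmetric_cone_operator_axioms_def cone_def)
  have graph: "ext_graph G m A (Dmin G m A) = op.gmin" by (simp add: Dmin_eq ext_graph_eq op.gmin_def)
  obtain i j where cl: "sh.is_closed (Range op.gmin)"
    and dims: "sh.qdim (op.kern op.gmin) sh.null i" "sh.qdim (L2 G m) (Range op.gmin) j" "k = int i - int j"
    using assms(5) unfolding graph has_index_def is_closed_eq qdim_eq ker_of_eq null_eq by blast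
  have "i < j" using dims(3) assms(6) by simp
  obtain D where D: "sect.subspace D" "op.dmin \<subseteq> D" "\<And>u. u \<in> D \<Longrightarrow> \<exists>f. op.acts_on u f"
    "op.adjoint (op.graph_on D) = op.graph_on D" "sh.is_closed (Range (op.graph_on D))"
    "\<exists>n. sh.qdim (op.kern (op.graph_on D)) sh.null n \<and> sh.qdim (L2 G m) (Range (op.graph_on D)) n"
    "\<not> (\<exists>C. \<forall>(u, f)\<in>op.graph_on D. sh.sn u \<le> C * sh.sn (f - (\<lambda>p. complex_of_real \<mu> *s u p)))"
    by (rule op.selfadjoint_extension_with_spectrum[OF cl dims(1,2) \<open>i < j\<close>, of \<mu>]) blast
  have "has_index G m (op.graph_on D) 0"
    using D(5,6) unfolding has_index_def is_closed_eq qdim_eq ker_of_eq null_eq by force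
  moreover have "D \<subseteq> Dmax G m A" using D(3) by (auto simp: Dmax_def acts_eq)
  ultimately have "D \<in> GG G m A" using D(1,2) by (simp add: GG_def csubspace_iff Dmin_eq ext_graph_eq)
  moreover have "selfadjoint G m (op.graph_on D)"
    using D(2,4) densely_defined_extension by (simp add: selfadjoint_def adjoint_graph_eq)
  ultimately have "D \<in> SA G m A" by (simp add: SA_def ext_graph_eq)
  \<comment> \<open>The estimate refuted in \<open>D(7)\<close> is the first condition in the
    definition of the resolvent set.\<close>
  moreover have "complex_of_real \<mu> \<in> spec G m (ext_graph G m A D)"
    using D(7) unfolding spec_def resolvent_set_def ext_graph_eq sn_eq fun_diff_def by simp
  ultimately show "\<exists>\<D>\<in>SA G m A. complex_of_real \<mu> \<in> spec G m (ext_graph G m A \<D>)" by blast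
qed

end
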